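(* Let $n\ge 2$ be an integer, let $K\ge 0$, and let $(M,\mathsf d,\mathsf m)$ be a proper metric measure space (every bounded closed subset of $M$ is compact) which satisfies the curvature-dimension condition $\mathsf{CD}(K,n)$. Let $p\in(1,n)$, and assume that for some $x_0\in M$ $$\liminf_{\rho\to 0}\frac{\mathsf m(B_{x_0}(\rho))}{\omega_n\rho^n}=1 .$$ Then the following statements hold. (i) If $1<\alpha\le \frac{n}{n-p}$ and the inequality $$\|u\|_{L^{\alpha p}}\le \mathcal C\,\||\nabla u|_{\mathsf d}\|_{L^p}^{\theta}\,\|u\|_{L^{\alpha(p-1)+1}}^{1-\theta}\qquad\text{for all } u\in \mathrm{Lip}_0(M)$$ holds for some $\mathcal C\ge \mathcal G_{\alpha,p,n}$, then $K=0$ and $$\mathsf m(B_x(\rho))\ge \left(\frac{\mathcal G_{\alpha,p,n}}{\mathcal C}\right)^{\frac n\theta}\omega_n\rho^n\qquad\text{for all } x\in M \text{ and } \rho\ge 0.$$ (ii) If $0<\alpha<1$ and the inequality $$\|u\|_{L^{\alpha(p-1)+1}}\le \mathcal C\,\||\nabla u|_{\mathsf d}\|_{L^p}^{\gamma}\,\|u\|_{L^{\alpha p}}^{1-\gamma}\qquad\text{for all } u\in \mathrm{Lip}_0(M)$$ holds for some $\mathcal C\ge \mathcal N_{\alpha,p,n}$, then $K=0$ and $$\mathsf m(B_x(\rho))\ge \left(\frac{\mathcal N_{\alpha,p,n}}{\mathcal C}\right)^{\frac n\gamma}\omega_n\rho^n\qquad\text{for all } x\in M \text{ and } \rho\ge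 0.$$
   Context: Metric measure space: $(M,\mathsf d)$ is a complete separable metric space and $\mathsf m$ is a locally finite Borel measure on $M$ that is strictly positive, i.e. $\mathrm{supp}[\mathsf m]=M$. $B_x(r)=\{y\in M:\mathsf d(x,y)<r\}$. $\omega_n=\pi^{n/2}/\Gamma(\frac n2+1)$. $\mathrm{Lip}_0(M)$ is the space of Lipschitz functions $u:M\to\mathbb R$ with compact support; for such $u$, $|\nabla u|_{\mathsf d}(x)=\limsup_{y\to x}\frac{|u(y)-u(x)|}{\mathsf d(x,y)}$, $x\in M$. For $q>0$, $\|u\|_{L^q}=(\int_M|u|^q\,d\mathsf m)^{1/q}$. Curvature-dimension condition: $\mathcal P_2(M,\mathsf d)$ is the $L^2$-Wasserstein space of probability measures on $M$ and $\mathcal P_2(M,\mathsf d,\mathsf m)$ its subspace of $\mathsf m$-absolutely continuous measures. For $N\ge1$, the Rényi entropy is $S_N(\mu|\mathsf m)=-\int_M\rho^{-1/N}d\mu$, where $\rho$ is the density of the absolutely continuous part $\mu^c$ in the decomposition $\mu=\mu^c+\mu^s=\rho\,\mathsf m+\mu^s$. For $K\ge0$, $N\ge1$, $t\in[0,1]$, $s\ge0$ let $\tau_{K,N}^{(t)}(s)=+\infty$ if $Ks^2\ge (N-1)\pi^2$; $\tau_{K,N}^{(t)}(s)=t^{1/N}\left(\sin\left(\sqrt{\tfrac{K}{N-1}}\,ts\right)\big/\sin\left(\sqrt{\tfrac{K}{N-1}}\,s\right)\right)^{1-1/N}$ if $0<Ks^2<(N-1)\pi^2$; $\tau_{K,N}^{(t)}(s)=t$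 if $Ks^2=0$. $(M,\mathsf d,\mathsf m)$ satisfies $\mathsf{CD}(K,N)$ if for all $\mu_0,\mu_1\in\mathcal P_2(M,\mathsf d,\mathsf m)$ there exist an optimal coupling $\pi$ of $\mu_0,\mu_1$ and a geodesic $\Gamma:[0,1]\to\mathcal P_2(M,\mathsf d,\mathsf m)$ joining $\mu_0$ and $\mu_1$ such that for every $t\in[0,1]$ and $N'\ge N$ $$S_{N'}(\Gamma(t)|\mathsf m)\le-\int_{M\times M}\left[\tau_{K,N'}^{(1-t)}(\mathsf d(y_0,y_1))\rho_0^{-1/N'}(y_0)+\tau_{K,N'}^{(t)}(\mathsf d(y_0,y_1))\rho_1^{-1/N'}(y_1)\right]d\pi(y_0,y_1),$$ where $\rho_0,\rho_1$ are the densities of $\mu_0,\mu_1$ with respect to $\mathsf m$. Constants: $p'=\frac p{p-1}$, $p^\star=\frac{pn}{n-p}$, $\mathsf B$ is the Euler beta-function, $$\theta=\frac{p^\star(\alpha-1)}{\alpha p(p^\star-\alpha p+\alpha-1)},\qquad \gamma=\frac{p^\star(1-\alpha)}{(p^\star-\alpha p)(\alpha p+1-\alpha)},$$ $$\mathcal G_{\alpha,p,n}=\left(\frac{\alpha-1}{p'}\right)^\theta\frac{\left(\frac{p'}{n}\right)^{\frac\theta p+\frac\theta n}\left(\frac{\alpha(p-1)+1}{\alpha-1}-\frac n{p'}\right)^{\frac1{\alpha p}}\left(\frac{\alpha(p-1)+1}{\alpha-1}\right)^{\frac\theta p-\frac1{\alpha p}}}{\left(\omega_n\,\mathsf B\left(\frac{\alpha(p-1)+1}{\alpha-1}-\frac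 n{p'},\frac n{p'}\right)\right)^{\frac\theta n}}\quad(1<\alpha\le\tfrac n{n-p}),$$ $$\mathcal N_{\alpha,p,n}=\left(\frac{1-\alpha}{p'}\right)^\gamma\frac{\left(\frac{p'}{n}\right)^{\frac\gamma p+\frac\gamma n}\left(\frac{\alpha(p-1)+1}{1-\alpha}+\frac n{p'}\right)^{\frac\gamma p-\frac1{\alpha(p-1)+1}}\left(\frac{\alpha(p-1)+1}{1-\alpha}\right)^{\frac1{\alpha(p-1)+1}}}{\left(\omega_n\,\mathsf B\left(\frac{\alpha(p-1)+1}{1-\alpha},\frac n{p'}\right)\right)^{\frac\gamma n}}\quad(0<\alpha<1).$$ These are the best constants in the corresponding inequalities on $\mathbb R^n$. *)

theory Defs
  imports "HOL-Probability.Probability"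
begin

section \<open>Metric measure spaces\<close>

text \<open>The complete separable metric space is a type of class \<^class>\<open>polish_space\<close>.\<close>

definition locally_finite_measure :: "'a::metric_space measure \<Rightarrow> bool" where
  "locally_finite_measure m \<longleftrightarrow> (\<forall>x. \<exists>r>0. emeasure m (ball x r) < \<infinity>)"

definition measure_support :: "'a::topological_space measure \<Rightarrow> 'a set" where
  "measure_support m = {x. \<forall>U. open U \<and> x \<in> U \<longrightarrow> 0 < emeasure m U}"

definition metric_measure_space :: "'a::polish_space measure \<Rightarrow> bool" where
  "metric_measure_space m \<longleftrightarrow>
     sets m = sets borel \<and> locally_finite_measure m \<and> measure_support m = UNIV"

definition Lip0 :: "('a::metric_space \<Rightarrow> real) set" where
  "Lip0 = {u. (\<exists>L. L-lipschitz_on UNIV u) \<and> compact (closure {x. u x \<noteq> 0})}"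

text \<open>
  Since the limsup is taken in \<^typ>\<open>ennreal\<close>, it is \<open>0\<close> at isolated points. For Lipschitz
  \<open>u\<close> it is bounded by the Lipschitz constant, so \<^const>\<open>enn2real\<close> loses nothing.
\<close>

definition local_lip :: "('a::metric_space \<Rightarrow> real) \<Rightarrow> 'a \<Rightarrow> real" where
  "local_lip u x = enn2real (Limsup (at x) (\<lambda>y. ennreal (\<bar>u y - u x\<bar> / dist x y)))"

text \<open>
  Only used for \<open>u\<close> in \<^const>\<open>Lip0\<close> and its local Lipschitz constant. Both are bounded
  Borel functions of compact support, so for a locally finite Borel measure and
  \<open>q > 0\<close> the integrand below is integrable.
\<close>

definition Lnorm :: "'a measure \<Rightarrow> real \<Rightarrow> ('a \<Rightarrow> real) \<Rightarrow> real" where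
  "Lnorm m q u = (\<integral>x. \<bar>u x\<bar> powr q \<partial>m) powr (1 / q)"


section \<open>The Wasserstein space\<close>

definition P2 :: "'a::polish_space measure set" where
  "P2 = {\<mu>. prob_space \<mu> \<and> sets \<mu> = sets borel \<and>
             (\<exists>x. (\<integral>\<^sup>+ y. ennreal ((dist x y)\<^sup>2) \<partial>\<mu>) < \<infinity>)}"

definition P2_ac :: "'a::polish_space measure \<Rightarrow> 'a measure set" where
  "P2_ac m = {\<mu> \<in> P2. absolutely_continuous m \<mu>}"

definition couplings ::
    "'a::polish_space measure \<Rightarrow> 'a measure \<Rightarrow> ('a \<times> 'a) measure set" where
  "couplings \<mu> \<nu> = {\<pi>. sets \<pi> = sets borel \<and> distr \<pi> borel fst = \<mu> \<and> distr \<pi> borel snd = \<nu>}"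

definition transport_cost :: "('a::polish_space \<times> 'a) measure \<Rightarrow> ennreal" where
  "transport_cost \<pi> = (\<integral>\<^sup>+ z. ennreal ((dist (fst z) (snd z))\<^sup>2) \<partial>\<pi>)"

definition optimal_coupling ::
    "'a::polish_space measure \<Rightarrow> 'a measure \<Rightarrow> ('a \<times> 'a) measure \<Rightarrow> bool" where
  "optimal_coupling \<mu> \<nu> \<pi> \<longleftrightarrow>
     \<pi> \<in> couplings \<mu> \<nu> \<and> (\<forall>\<pi>' \<in> couplings \<mu> \<nu>. transport_cost \<pi> \<le> transport_cost \<pi>')"

text \<open>The infimum is finite for \<open>\<mu>\<close>, \<open>\<nu>\<close> in \<^const>\<open>P2\<close>.\<close>

definition W2 :: "'a::polish_space measure \<Rightarrow> 'a measure \<Rightarrow> real" where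
  "W2 \<mu> \<nu> = sqrt (enn2real (INF \<pi> \<in> couplings \<mu> \<nu>. transport_cost \<pi>))"

text \<open>Geodesics are minimizing and parametrized proportionally to arc length.\<close>

definition geodesic_P2_ac ::
    "'a::polish_space measure \<Rightarrow> 'a measure \<Rightarrow> 'a measure \<Rightarrow> (real \<Rightarrow> 'a measure) \<Rightarrow> bool" where
  "geodesic_P2_ac m \<mu>0 \<mu>1 \<Gamma> \<longleftrightarrow>
     \<Gamma> ` {0..1} \<subseteq> P2_ac m \<and> \<Gamma> 0 = \<mu>0 \<and> \<Gamma> 1 = \<mu>1 \<and>
     (\<forall>s\<in>{0..1}. \<forall>t\<in>{0..1}. W2 (\<Gamma> s) (\<Gamma> t) = \<bar>s - t\<bar> * W2 \<mu>0 \<mu>1)"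


section \<open>The curvature-dimension condition\<close>

text \<open>\<open>\<mu> = \<rho> m + \<mu>s\<close> with \<open>\<mu>s\<close> singular with respect to \<open>m\<close>.\<close>

definition lebesgue_decomposition ::
    "'a measure \<Rightarrow> 'a measure \<Rightarrow> ('a \<Rightarrow> ennreal) \<Rightarrow> 'a measure \<Rightarrow> bool" where
  "lebesgue_decomposition m \<mu> \<rho> \<mu>s \<longleftrightarrow>
     \<rho> \<in> borel_measurable m \<and> sets \<mu>s = sets m \<and>
     (\<exists>A\<in>sets m. emeasure m A = 0 \<and> emeasure \<mu>s (space m - A) = 0) \<and>
     (\<forall>B\<in>sets m. emeasure \<mu> B = emeasure (density m \<rho>) B + emeasure \<mu>s B)"

definition ac_density :: "'a measure \<Rightarrow> 'a measure \<Rightarrow> 'a \<Rightarrow> ennreal" where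
  "ac_density m \<mu> = (SOME \<rho>. \<exists>\<mu>s. lebesgue_decomposition m \<mu> \<rho> \<mu>s)"

text \<open>
  The exponent is negative, so \<open>\<rho>\<close> is meant to be positive and finite here, which holds
  almost everywhere with respect to the measure with density \<open>\<rho>\<close>; the value chosen
  elsewhere does not matter.
\<close>

definition neg_root :: "real \<Rightarrow> ennreal \<Rightarrow> ennreal" where
  "neg_root N \<rho> = ennreal (enn2real \<rho> powr (- 1 / N))"

text \<open>
  \<open>- \<integral> \<rho>\<^bsup>-1/N\<^esup> d\<mu>\<close>, where the singular part of \<open>\<mu>\<close> contributes nothing, i.e. the integral
  equals \<open>\<integral> \<rho>\<^bsup>1-1/N\<^esup> dm\<close>. It may diverge, and then the entropy is \<open>-\<infinity>\<close>.
\<close>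

definition renyi_entropy :: "real \<Rightarrow> 'a measure \<Rightarrow> 'a measure \<Rightarrow> ereal" where
  "renyi_entropy N \<mu> m =
     - enn2ereal (\<integral>\<^sup>+ x. neg_root N (ac_density m \<mu> x) \<partial>density m (ac_density m \<mu>))"

text \<open>The case \<open>K s\<^sup>2 = 0\<close> comes first: it overlaps with the infinite one only if \<open>N = 1\<close>.\<close>

definition tau :: "real \<Rightarrow> real \<Rightarrow> real \<Rightarrow> real \<Rightarrow> ennreal" where
  "tau K N t s =
     (if K * s\<^sup>2 = 0 then ennreal t
      else if K * s\<^sup>2 \<ge> (N - 1) * pi\<^sup>2 then \<infinity>
      else ennreal (t powr (1 / N) *
             (sin (sqrt (K / (N - 1)) * t * s) / sin (sqrt (K / (N - 1)) * s)) powr (1 - 1 / N)))"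

definition CD :: "'a::polish_space measure \<Rightarrow> real \<Rightarrow> real \<Rightarrow> bool" where
  "CD m K N \<longleftrightarrow>
     (\<forall>\<mu>0\<in>P2_ac m. \<forall>\<mu>1\<in>P2_ac m. \<exists>\<pi> \<Gamma>.
        optimal_coupling \<mu>0 \<mu>1 \<pi> \<and> geodesic_P2_ac m \<mu>0 \<mu>1 \<Gamma> \<and>
        (\<forall>t\<in>{0..1}. \<forall>N'\<ge>N.
           renyi_entropy N' (\<Gamma> t) m \<le>
           - enn2ereal (\<integral>\<^sup>+ y. tau K N' (1 - t) (dist (fst y) (snd y)) * neg_root N' (RN_deriv m \<mu>0 (fst y))
                              + tau K N' t (dist (fst y) (snd y)) * neg_root N' (RN_deriv m \<mu>1 (snd y)) \<partial>\<pi>)))"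


section \<open>Constants\<close>

definition conj_exp :: "real \<Rightarrow> real" where
  "conj_exp p = p / (p - 1)"

definition sobolev_exp :: "real \<Rightarrow> real \<Rightarrow> real" where
  "sobolev_exp p n = p * n / (n - p)"

definition gn_theta :: "real \<Rightarrow> real \<Rightarrow> real \<Rightarrow> real" where
  "gn_theta \<alpha> p n =
     sobolev_exp p n * (\<alpha> - 1) / (\<alpha> * p * (sobolev_exp p n - \<alpha> * p + \<alpha> - 1))"

definition gn_gamma :: "real \<Rightarrow> real \<Rightarrow> real \<Rightarrow> real" where
  "gn_gamma \<alpha> p n =
     sobolev_exp p n * (1 - \<alpha>) / ((sobolev_exp p n - \<alpha> * p) * (\<alpha> * p + 1 - \<alpha>))"

definition gn_G :: "real \<Rightarrow> real \<Rightarrow> real \<Rightarrow> real" where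
  "gn_G \<alpha> p n =
     (let \<theta> = gn_theta \<alpha> p n; p' = conj_exp p; a = (\<alpha> * (p - 1) + 1) / (\<alpha> - 1)
      in ((\<alpha> - 1) / p') powr \<theta> *
         ((p' / n) powr (\<theta> / p + \<theta> / n) *
          (a - n / p') powr (1 / (\<alpha> * p)) *
          a powr (\<theta> / p - 1 / (\<alpha> * p))) /
         (unit_ball_vol n * Beta (a - n / p') (n / p')) powr (\<theta> / n))"

definition gn_N :: "real \<Rightarrow> real \<Rightarrow> real \<Rightarrow> real" where
  "gn_N \<alpha> p n =
     (let \<gamma> = gn_gamma \<alpha> p n; p' = conj_exp p; a = (\<alpha> * (p - 1) + 1) / (1 - \<alpha>)
      in ((1 - \<alpha>) / p') powr \<gamma> *
         ((p' / n) powr (\<gamma> / p + \<gamma> / n) *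
          (a + n / p') powr (\<gamma> / p - 1 / (\<alpha> * (p - 1) + 1)) *
          a powr (1 / (\<alpha> * (p - 1) + 1))) /
         (unit_ball_vol n * Beta a (n / p')) powr (\<gamma> / n))"

end

theory Submission
  imports Defs
begin

text \<open>
  The curvature-dimension condition gives Bishop--Gromov monotonicity of \<open>m (B_x(r)) / r\<^sup>n\<close> and, for
  \<open>K > 0\<close>, compactness; on a compact space the constant function violates the inequality, so \<open>K = 0\<close>.
  The inequality with a hat function keeps the volume ratio away from \<open>0\<close>, hence its limit \<open>a\<close> at
  infinity is positive. Radial functions \<open>g (d(x, \<cdot>) / R)\<close> then have, as \<open>R \<rightarrow> \<infinity>\<close>, the same norms as
  on \<open>\<real>\<^sup>n\<close> up to powers of \<open>a / \<omega>\<^sub>n\<close>, and inserting the Euclidean extremal as \<open>g\<close> bounds \<open>a\<close> from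
  below by the ratio of the constants.

  To see that an intermediate measure of \<open>\<mu>\<^sub>0\<close> and \<open>\<mu>\<^sub>1\<close> lives on intermediate points, near-optimal
  couplings are glued approximately along small cells; for the distances \<open>f\<close>, \<open>g\<close> to the intermediate
  point, strict convexity of \<open>f\<^sup>2 / t + g\<^sup>2 / (1 - t)\<close> forces \<open>f\<close> to be close to \<open>t (f + g)\<close>.
\<close>

section \<open>Approximate gluing of couplings\<close>

text \<open>The curvature-dimension condition supplies some geodesic of measures but does not say
  where its measures sit. The entropy at time t only controls the volume of a set that carries the
  measure at time t, so this localisation is the crucial transport fact, and it has to be extracted
  from the \<open>W2\<close> distances alone.

  Both inequalities satisfy 1/s = \<theta> (1/p - 1/n) + (1 - \<theta>)/s', where s and s' are the
  exponents on the left and on the right. This relation expresses invariance under dilation, so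
  every power of R cancels. When each of the three limiting integrals carries a factor a, it leaves
  exactly a to the power \<theta>/n; hence the exponent n/\<theta> in the conclusion.

  The gradient stands on the larger side, so an upper bound for the local Lipschitz constant is
  enough, and the volumes of balls about one centre determine all radial integrals. Since the volume
  ratio decreases, its limit a is also its infimum: a bound on a is a bound at every radius, and the
  argument runs at each centre x separately.\<close>

lemma couplingsD:
  assumes "\<pi> \<in> couplings \<mu> \<nu>"
  shows "sets \<pi> = sets borel" "distr \<pi> borel fst = \<mu>" "distr \<pi> borel snd = \<nu>"
  using assms by (auto simp: couplings_def)

lemma measurable_from_borel_prod_sets:
  fixes \<pi> :: "('a::polish_space \<times> 'a) measure"
  assumes "sets \<pi> = sets borel"
  shows "fst \<in> measurable \<pi> borel" "snd \<in> measurable \<pi> borel"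
  unfolding measurable_cong_sets[OF assms refl]
  by (auto intro!: borel_measurable_continuous_onI continuous_intros)

lemma coupling_prob_space:
  fixes \<pi> :: "('a::polish_space \<times> 'a) measure"
  assumes "\<pi> \<in> couplings \<mu> \<nu>" "prob_space \<mu>"
  shows "prob_space \<pi>"
proof
  note c = couplingsD[OF assms(1)]
  have "emeasure \<mu> UNIV = emeasure \<pi> (space \<pi>)"
    unfolding c(2)[symmetric]
    using measurable_from_borel_prod_sets[OF c(1)] by (subst emeasure_distr) auto
  moreover have "space \<mu> = UNIV" using c(2) by auto
  ultimately show "emeasure \<pi> (space \<pi>) = 1"
    using prob_space.emeasure_space_1[OF assms(2)] by simp
qed

lemma coupling_nn_integral:
  fixes \<pi> :: "('a::polish_space \<times> 'a) measure"
  assumes "\<pi> \<in> couplings \<mu> \<nu>" "f \<in> borel_measurable borel"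
  shows "(\<integral>\<^sup>+z. f (fst z) \<partial>\<pi>) = (\<integral>\<^sup>+x. f x \<partial>\<mu>)" "(\<integral>\<^sup>+z. f (snd z) \<partial>\<pi>) = (\<integral>\<^sup>+x. f x \<partial>\<nu>)"
proof -
  note c = couplingsD[OF assms(1)] and m = measurable_from_borel_prod_sets[OF couplingsD(1)[OF assms(1)]]
  show "(\<integral>\<^sup>+z. f (fst z) \<partial>\<pi>) = (\<integral>\<^sup>+x. f x \<partial>\<mu>)"
    unfolding c(2)[symmetric] using m assms(2) by (subst nn_integral_distr) auto
  show "(\<integral>\<^sup>+z. f (snd z) \<partial>\<pi>) = (\<integral>\<^sup>+x. f x \<partial>\<nu>)"
    unfolding c(3)[symmetric] using m assms(2) by (subst nn_integral_distr) auto
qed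

lemma coupling_AE:
  fixes \<pi> :: "('a::polish_space \<times> 'a) measure"
  assumes "\<pi> \<in> couplings \<mu> \<nu>"
  shows "AE x in \<mu>. P x \<Longrightarrow> AE z in \<pi>. P (fst z)" "AE x in \<nu>. P x \<Longrightarrow> AE z in \<pi>. P (snd z)"
proof -
  note c = couplingsD[OF assms(1)] and m = measurable_from_borel_prod_sets[OF couplingsD(1)[OF assms(1)]]
  show "AE x in \<mu>. P x \<Longrightarrow> AE z in \<pi>. P (fst z)" using AE_distrD[OF m(1)] c(2) by metis
  show "AE x in \<nu>. P x \<Longrightarrow> AE z in \<pi>. P (snd z)" using AE_distrD[OF m(2)] c(3) by metis
qed

text \<open>This keeps the infimum in \<open>W2\<close> away from \<infinity>, which
  \<open>enn2real\<close> would collapse to 0.\<close>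

lemma transport_cost_finite:
  fixes \<pi> :: "('a::polish_space \<times> 'a) measure"
  assumes \<pi>: "\<pi> \<in> couplings \<mu> \<nu>" and P: "\<mu> \<in> P2" "\<nu> \<in> P2"
  shows "transport_cost \<pi> < \<infinity>"
proof -
  obtain x y where x: "(\<integral>\<^sup>+z. ennreal ((dist x z)\<^sup>2) \<partial>\<mu>) < \<infinity>" and y: "(\<integral>\<^sup>+z. ennreal ((dist y z)\<^sup>2) \<partial>\<nu>) < \<infinity>"
    using P by (auto simp: P2_def)
  interpret prob_space \<pi> using coupling_prob_space[OF \<pi>] P by (auto simp: P2_def)
  note c = couplingsD[OF \<pi>] and m = measurable_from_borel_prod_sets[OF couplingsD(1)[OF \<pi>]]
  have *: "(dist u v)\<^sup>2 \<le> 4 * (dist x u)\<^sup>2 + 4 * (dist y v)\<^sup>2 + 4 * (dist x y)\<^sup>2" for u v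
  proof -
    have "dist u v \<le> dist x u + dist x y + dist y v"
      by metric
    then have "(dist u v)\<^sup>2 \<le> (dist x u + dist x y + dist y v)\<^sup>2" by (intro power_mono) auto
    moreover have "(a+b+c)\<^sup>2 \<le> 4*a\<^sup>2 + 4*c\<^sup>2 + 4*b\<^sup>2" for a b c :: real
      by (sos)
    ultimately show ?thesis by (meson order_trans)
  qed
  have "transport_cost \<pi> \<le> (\<integral>\<^sup>+ z. 4 * ennreal ((dist x (fst z))\<^sup>2) + 4 * ennreal ((dist y (snd z))\<^sup>2) + ennreal (4 * (dist x y)\<^sup>2) \<partial>\<pi>)"
    unfolding transport_cost_def
  proof (rule nn_integral_mono)
    fix z
    have "ennreal ((dist (fst z) (snd z))\<^sup>2) \<le> ennreal (4 * (dist x (fst z))\<^sup>2 + 4 * (dist y (snd z))\<^sup>2 + 4 * (dist x y)\<^sup>2)"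
      by (rule ennreal_leI) (rule *)
    then show "ennreal ((dist (fst z) (snd z))\<^sup>2) \<le> 4 * ennreal ((dist x (fst z))\<^sup>2) + 4 * ennreal ((dist y (snd z))\<^sup>2) + ennreal (4 * (dist x y)\<^sup>2)"
      by (simp add: ennreal_plus ennreal_mult)
  qed
  also have "\<dots> = 4 * (\<integral>\<^sup>+z. ennreal ((dist x (fst z))\<^sup>2) \<partial>\<pi>) + 4 * (\<integral>\<^sup>+z. ennreal ((dist y (snd z))\<^sup>2) \<partial>\<pi>) + ennreal (4 * (dist x y)\<^sup>2)"
    using m by (simp add: nn_integral_add nn_integral_cmult emeasure_space_1)
  also have "\<dots> < \<infinity>"
    using x y by (subst coupling_nn_integral(1)[OF \<pi>], simp, subst coupling_nn_integral(2)[OF \<pi>], simp)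
      (simp add: ennreal_mult_less_top)
  finally show ?thesis .
qed

lemma couplings_nonempty:
  fixes \<mu> \<nu> :: "'a::polish_space measure"
  assumes P: "\<mu> \<in> P2" "\<nu> \<in> P2"
  shows "\<mu> \<Otimes>\<^sub>M \<nu> \<in> couplings \<mu> \<nu>"
proof -
  have s: "sets \<mu> = sets borel" "sets \<nu> = sets borel" using P by (auto simp: P2_def)
  interpret a: prob_space \<mu> using P by (auto simp: P2_def)
  interpret b: prob_space \<nu> using P by (auto simp: P2_def)
  have sp: "sets (\<mu> \<Otimes>\<^sub>M \<nu>) = sets borel"
    using sets_pair_measure_cong[OF s] by (simp only: borel_prod)
  note m = measurable_from_borel_prod_sets[OF sp]
  interpret pair_prob_space \<mu> \<nu> ..
  have sU: "space \<mu> = UNIV" "space \<nu> = UNIV" using s[THEN sets_eq_imp_space_eq] by auto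
  have "distr (\<mu> \<Otimes>\<^sub>M \<nu>) borel fst = \<mu>"
  proof (rule measure_eqI)
    fix A assume "A \<in> sets (distr (\<mu> \<Otimes>\<^sub>M \<nu>) borel fst)"
    then have A: "A \<in> sets borel" by simp
    have "fst -` A \<inter> space (\<mu> \<Otimes>\<^sub>M \<nu>) = A \<times> space \<nu>" by (auto simp: space_pair_measure sU)
    then show "emeasure (distr (\<mu> \<Otimes>\<^sub>M \<nu>) borel fst) A = emeasure \<mu> A"
      using A b.emeasure_pair_measure_Times[of A \<mu> "space \<nu>"] s(1) by (simp add: emeasure_distr m b.emeasure_space_1)
  qed (use s in auto)
  moreover have "distr (\<mu> \<Otimes>\<^sub>M \<nu>) borel snd = \<nu>"
  proof (rule measure_eqI)
    fix A assume "A \<in> sets (distr (\<mu> \<Otimes>\<^sub>M \<nu>) borel snd)"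
    then have A: "A \<in> sets borel" by simp
    have "snd -` A \<inter> space (\<mu> \<Otimes>\<^sub>M \<nu>) = space \<mu> \<times> A" by (auto simp: space_pair_measure sU)
    then show "emeasure (distr (\<mu> \<Otimes>\<^sub>M \<nu>) borel snd) A = emeasure \<nu> A"
      using A b.emeasure_pair_measure_Times[of "space \<mu>" \<mu> A] s(2) by (simp add: emeasure_distr m a.emeasure_space_1)
  qed (use s in auto)
  ultimately show ?thesis using sp by (auto simp: couplings_def)
qed

lemma W2_square:
  fixes \<mu> \<nu> :: "'a::polish_space measure"
  assumes P: "\<mu> \<in> P2" "\<nu> \<in> P2"
  shows "(INF \<pi> \<in> couplings \<mu> \<nu>. transport_cost \<pi>) = ennreal ((W2 \<mu> \<nu>)\<^sup>2)"
proof -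
  have "(INF \<pi> \<in> couplings \<mu> \<nu>. transport_cost \<pi>) \<le> transport_cost (\<mu> \<Otimes>\<^sub>M \<nu>)"
    by (rule INF_lower) (rule couplings_nonempty[OF P])
  also have "\<dots> < top" using transport_cost_finite[OF couplings_nonempty[OF P] P] by simp
  finally show ?thesis by (simp add: W2_def)
qed

text \<open>The slack \<delta> is carried along as an error and sent to 0 in
  \<open>intermediate_measure_support\<close>.\<close>

lemma near_optimal_coupling:
  fixes \<mu> \<nu> :: "'a::polish_space measure"
  assumes P: "\<mu> \<in> P2" "\<nu> \<in> P2" and "\<delta> > 0"
  obtains \<pi> where "\<pi> \<in> couplings \<mu> \<nu>" "transport_cost \<pi> \<le> ennreal ((W2 \<mu> \<nu>)\<^sup>2 + \<delta>)"
proof -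
  have "(INF \<pi> \<in> couplings \<mu> \<nu>. transport_cost \<pi>) < ennreal ((W2 \<mu> \<nu>)\<^sup>2 + \<delta>)"
    unfolding W2_square[OF P] using \<open>\<delta> > 0\<close> by (intro ennreal_lessI) (auto intro: add_nonneg_pos)
  then obtain \<pi> where "\<pi> \<in> couplings \<mu> \<nu>" "transport_cost \<pi> < ennreal ((W2 \<mu> \<nu>)\<^sup>2 + \<delta>)"
    unfolding INF_less_iff by blast
  then show ?thesis using that by (auto intro: less_imp_le)
qed

text \<open>A point is sent to the index of the first point of a countable dense sequence within
  distance \<delta>/2. Equal indices give \<delta>-closeness through that common point, and choosing
  the least index makes the map measurable.\<close>

lemma countable_measurable_partition:
  fixes \<delta> :: real
  assumes "\<delta> > 0"
  obtains c :: "'a::polish_space \<Rightarrow> nat" where "c \<in> measurable borel (count_space UNIV)"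
    "\<And>x y. c x = c y \<Longrightarrow> dist x y < \<delta>"
proof -
  obtain D :: "'a set" where D: "countable D" "\<And>X. open X \<Longrightarrow> X \<noteq> {} \<Longrightarrow> \<exists>d\<in>D. d \<in> X"
    using countable_dense_setE by blast
  have Dne: "D \<noteq> {}" using D(2)[of UNIV] by auto
  define c where "c z = (LEAST i. dist z (from_nat_into D i) < \<delta> / 2)" for z :: 'a
  have ex: "\<exists>i. dist z (from_nat_into D i) < \<delta> / 2" for z
  proof -
    obtain d where "d \<in> D" "d \<in> ball z (\<delta>/2)" using D(2)[of "ball z (\<delta>/2)"] assms by auto
    then show ?thesis using from_nat_into_surj[OF D(1)] by (metis mem_ball)
  qed
  have c: "dist z (from_nat_into D (c z)) < \<delta> / 2" for z
    unfolding c_def using ex by (rule LeastI_ex)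
  show ?thesis
  proof
    show "c \<in> measurable borel (count_space UNIV)"
      unfolding c_def by (rule measurable_Least) measurable
    show "dist x y < \<delta>" if "c x = c y" for x y
      using c[of x] c[of y] that dist_triangle2[of x y "from_nat_into D (c x)"] by simp
  qed
qed

text \<open>
  Gluing along \<open>\<nu>\<close> usually needs disintegration. Conditioning the product of the two couplings on
  both \<open>\<nu>\<close>-coordinates lying in the same small cell gives a substitute up to an error \<open>\<delta>\<close>.
\<close>

lemma approximate_gluing:
  fixes \<nu> :: "'a::polish_space measure"
  assumes a: "\<pi>a \<in> couplings \<mu>0 \<nu>" and b: "\<pi>b \<in> couplings \<nu> \<mu>1" and \<nu>: "prob_space \<nu>" "sets \<nu> = sets borel"
    and "prob_space \<mu>0" and "\<delta> > 0"
  obtains \<sigma> :: "(('a \<times> 'a) \<times> ('a \<times> 'a)) measure"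
  where "sets \<sigma> = sets borel" "distr \<sigma> borel fst = \<pi>a" "distr \<sigma> borel snd = \<pi>b"
    "AE w in \<sigma>. dist (snd (fst w)) (fst (snd w)) < \<delta>"
proof -
  obtain c :: "'a \<Rightarrow> nat" where c[measurable]: "c \<in> measurable borel (count_space UNIV)"
    and cd: "\<And>x y. c x = c y \<Longrightarrow> dist x y < \<delta>"
    using countable_measurable_partition[OF \<open>\<delta> > 0\<close>] by metis
  interpret \<nu>: prob_space \<nu> by fact
  interpret a: prob_space \<pi>a using coupling_prob_space a assms by blast
  interpret b: prob_space \<pi>b using coupling_prob_space b assms by blast
  interpret ab: pair_prob_space \<pi>a \<pi>b ..
  have sa[measurable_cong]: "sets \<pi>a = sets borel" and sb[measurable_cong]: "sets \<pi>b = sets borel"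
    using couplingsD a b by auto
  note \<nu>(2)[measurable_cong]
  note [measurable] = measurable_from_borel_prod_sets[OF sa] measurable_from_borel_prod_sets[OF sb]
  define N where "N i = emeasure \<nu> {z. c z = i}" for i
  \<comment> \<open>The density of the glued measure with respect to the product. Dividing by the
    mass of the common cell makes \<open>k z\<close> integrate to 1 against \<nu>, which is what
    preserves both marginals. On a cell of mass 0 its value is \<infinity>, but these countably many
    cells form a \<nu>-null set.\<close>
  define k where "k z z' = (if c z = c z' then inverse (N (c z)) else 0)" for z z'
  have cell[measurable]: "{z. c z = i} \<in> sets borel" for i
    using measurable_sets[OF c, of "{i}"] by (simp add: vimage_def)
  have k_meas[measurable]: "(\<lambda>x. k (f x) (g x)) \<in> borel_measurable M"
    if [measurable]: "f \<in> measurable M borel" "g \<in> measurable M borel" for f g and M :: "'b measure"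
  proof -
    have cf: "(\<lambda>x. c (f x)) \<in> measurable M (count_space UNIV)" and cg: "(\<lambda>x. c (g x)) \<in> measurable M (count_space UNIV)"
      using measurable_compose[OF that(1) c] measurable_compose[OF that(2) c] by auto
    have [measurable]: "(\<lambda>x. real (c (f x))) \<in> borel_measurable M" "(\<lambda>x. real (c (g x))) \<in> borel_measurable M"
      "(\<lambda>x. inverse (N (c (f x)))) \<in> borel_measurable M"
      by (auto intro: measurable_compose[OF cf] measurable_compose[OF cg])
    \<comment> \<open>Cell indices are compared through their real values, so that the case
      distinction falls under the measurability rules for real functions.\<close>
    have "(\<lambda>x. if real (c (f x)) = real (c (g x)) then inverse (N (c (f x))) else 0) \<in> borel_measurable M"
      by measurable
    then show ?thesis by (simp add: k_def)
  qed
  have kint: "(\<integral>\<^sup>+z'. k z z' \<partial>\<nu>) = 1" if "N (c z) \<noteq> 0" for z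
  proof -
    have "(\<integral>\<^sup>+z'. k z z' \<partial>\<nu>) = (\<integral>\<^sup>+z'. inverse (N (c z)) * indicator {z'. c z' = c z} z' \<partial>\<nu>)"
      by (intro nn_integral_cong) (auto simp: k_def)
    also have "\<dots> = inverse (N (c z)) * N (c z)"
      by (subst nn_integral_cmult_indicator) (use \<nu>(2) in \<open>auto simp: N_def\<close>)
    also have "\<dots> = 1"
    proof -
      have "N (c z) < top" unfolding N_def using \<nu>.emeasure_finite by (simp add: less_top[symmetric])
      from ennreal_divide_self[OF that this] show ?thesis by (simp add: divide_ennreal_def mult.commute)
    qed
    finally show ?thesis .
  qed
  have ksym: "k z z' = k z' z" for z z' by (auto simp: k_def)
  have AEN: "AE z in \<nu>. N (c z) \<noteq> 0"
  proof -
    have "(\<Union>i\<in>{i. N i = 0}. {z. c z = i}) \<in> null_sets \<nu>"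
      by (rule null_sets_UN') (use \<nu>(2) in \<open>auto simp: N_def null_sets_def\<close>)
    then show ?thesis by (rule AE_I') auto
  qed
  define \<sigma> where "\<sigma> = density (\<pi>a \<Otimes>\<^sub>M \<pi>b) (\<lambda>w. k (snd (fst w)) (fst (snd w)))"
  have s\<sigma>: "sets \<sigma> = sets borel"
    unfolding \<sigma>_def sets_density using sets_pair_measure_cong[OF sa sb] by (simp only: borel_prod)
  have m\<sigma>[measurable]: "fst \<in> measurable \<sigma> borel" "snd \<in> measurable \<sigma> borel"
    unfolding measurable_cong_sets[OF s\<sigma> refl]
    by (auto intro!: borel_measurable_continuous_onI continuous_intros)
  have "distr \<sigma> borel fst = \<pi>a"
  proof (rule measure_eqI)
    fix A assume "A \<in> sets (distr \<sigma> borel fst)"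
    then have A[measurable]: "A \<in> sets borel" by simp
    have "emeasure (distr \<sigma> borel fst) A = (\<integral>\<^sup>+w. indicator A (fst w) \<partial>\<sigma>)"
      by (subst nn_integral_distr[symmetric, OF m\<sigma>(1)]) auto
    also have "\<dots> = (\<integral>\<^sup>+w. k (snd (fst w)) (fst (snd w)) * indicator A (fst w) \<partial>(\<pi>a \<Otimes>\<^sub>M \<pi>b))"
      unfolding \<sigma>_def by (subst nn_integral_density) auto
    also have "\<dots> = (\<integral>\<^sup>+u. (\<integral>\<^sup>+v. k (snd u) (fst v) * indicator A u \<partial>\<pi>b) \<partial>\<pi>a)"
    proof -
      have [measurable]: "(\<lambda>w. indicator A (fst w) :: ennreal) \<in> borel_measurable (\<pi>a \<Otimes>\<^sub>M \<pi>b)"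
        by (rule measurable_compose[OF measurable_fst]) (use sa in simp)
      show ?thesis by (subst b.nn_integral_fst[symmetric]) simp_all
    qed
    also have "\<dots> = (\<integral>\<^sup>+u. (\<integral>\<^sup>+z. k (snd u) z \<partial>\<nu>) * indicator A u \<partial>\<pi>a)"
      by (intro nn_integral_cong, subst nn_integral_multc, measurable, subst coupling_nn_integral(1)[OF b]) auto
    also have "\<dots> = (\<integral>\<^sup>+u. indicator A u \<partial>\<pi>a)"
      by (rule nn_integral_cong_AE, use coupling_AE(2)[OF a AEN] in eventually_elim) (simp add: kint)
    finally show "emeasure (distr \<sigma> borel fst) A = emeasure \<pi>a A" by (simp add: sa)
  qed (use sa in auto)
  moreover have "distr \<sigma> borel snd = \<pi>b"
  proof (rule measure_eqI)
    fix A assume "A \<in> sets (distr \<sigma> borel snd)"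
    then have A[measurable]: "A \<in> sets borel" by simp
    have "emeasure (distr \<sigma> borel snd) A = (\<integral>\<^sup>+w. indicator A (snd w) \<partial>\<sigma>)"
      by (subst nn_integral_distr[symmetric, OF m\<sigma>(2)]) auto
    also have "\<dots> = (\<integral>\<^sup>+w. k (snd (fst w)) (fst (snd w)) * indicator A (snd w) \<partial>(\<pi>a \<Otimes>\<^sub>M \<pi>b))"
      unfolding \<sigma>_def by (subst nn_integral_density) auto
    also have "\<dots> = (\<integral>\<^sup>+v. (\<integral>\<^sup>+u. k (snd u) (fst v) * indicator A v \<partial>\<pi>a) \<partial>\<pi>b)"
    proof -
      have [measurable]: "(\<lambda>w. indicator A (snd w) :: ennreal) \<in> borel_measurable (\<pi>a \<Otimes>\<^sub>M \<pi>b)"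
        by (rule measurable_compose[OF measurable_snd]) (use sb in simp)
      show ?thesis by (subst ab.nn_integral_snd[symmetric]) simp_all
    qed
    also have "\<dots> = (\<integral>\<^sup>+v. (\<integral>\<^sup>+z. k (fst v) z \<partial>\<nu>) * indicator A v \<partial>\<pi>b)"
      by (intro nn_integral_cong, subst nn_integral_multc, measurable, subst ksym,
          subst coupling_nn_integral(2)[OF a]) auto
    also have "\<dots> = (\<integral>\<^sup>+v. indicator A v \<partial>\<pi>b)"
      by (rule nn_integral_cong_AE, use coupling_AE(1)[OF b AEN] in eventually_elim) (simp add: kint)
    finally show "emeasure (distr \<sigma> borel snd) A = emeasure \<pi>b A" by (simp add: sb)
  qed (use sb in auto)
  moreover have "AE w in \<sigma>. dist (snd (fst w)) (fst (snd w)) < \<delta>"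
    unfolding \<sigma>_def
  proof (subst AE_density)
    have "dist z z' < \<delta>" if "0 < k z z'" for z z' using that cd by (auto simp: k_def split: if_splits)
    then show "AE w in \<pi>a \<Otimes>\<^sub>M \<pi>b. 0 < k (snd (fst w)) (fst (snd w)) \<longrightarrow> dist (snd (fst w)) (fst (snd w)) < \<delta>"
      by blast
  qed measurable
  ultimately show ?thesis using that s\<sigma> by blast
qed

section \<open>Supports of intermediate measures\<close>

text \<open>
  For \<open>h = f + g\<close>, the right-hand side minus \<open>d\<^sup>2\<close> dominates \<open>(h\<^sup>2 - d\<^sup>2 + 2 L \<delta>) + (f - t h)\<^sup>2\<close>, a sum of
  nonnegative terms; if \<open>f > t L + s\<close>, then \<open>\<bar>f - t h\<bar> \<ge> s / 2\<close> or \<open>h > L + s / 2\<close>.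
\<close>

lemma intermediate_excess:
  fixes f g d t s L \<delta> :: real
  assumes t: "0 < t" "t < 1" and nn: "0 \<le> f" "0 \<le> g" "0 \<le> d" and "d \<le> L" "0 < \<delta>" "0 < s"
    and tri: "d \<le> f + g + \<delta>"
  shows "(if t * L + s < f then s\<^sup>2 / 4 else 0) + d\<^sup>2 \<le> f\<^sup>2 / t + g\<^sup>2 / (1 - t) + 2 * L * \<delta>"
proof -
  define h where "h = f + g"
  have L: "0 \<le> L" using assms by linarith
  have eq: "f\<^sup>2 / t + g\<^sup>2 / (1 - t) = h\<^sup>2 + (f - t * h)\<^sup>2 / (t * (1 - t))"
    using t by (simp add: h_def field_simps power2_eq_square)
  have "0 < t * (1 - t)" using t by simp
  moreover have "t * (1 - t) \<le> 1" using t by (simp add: mult_le_one)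
  ultimately have q: "(f - t * h)\<^sup>2 \<le> (f - t * h)\<^sup>2 / (t * (1 - t))"
    by (simp add: mult_left_le pos_le_divide_eq)
  have lo: "d\<^sup>2 - 2 * L * \<delta> \<le> h\<^sup>2"
  \<comment> \<open>Squaring d - \<delta> \<le> h is legitimate only for d \<ge> \<delta>. Below
    that, d squared is at most L \<delta>, and the left-hand side is not positive.\<close>
  proof (cases "d \<le> \<delta>")
    case True
    have "d * d \<le> L * \<delta>" using assms True by (intro mult_mono) auto
    moreover have "0 \<le> L * \<delta>" using L \<open>0 < \<delta>\<close> by simp
    moreover have "0 \<le> h\<^sup>2" by simp
    ultimately show ?thesis unfolding power2_eq_square by linarith
  next
    case False
    have "(d - \<delta>)\<^sup>2 \<le> h\<^sup>2" using False tri nn by (intro power_mono) (auto simp: h_def)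
    moreover have "d * \<delta> \<le> L * \<delta>" using assms by (intro mult_right_mono) auto
    moreover have "0 \<le> \<delta> * \<delta>" by simp
    moreover have "(d - \<delta>)\<^sup>2 = d\<^sup>2 - 2 * (d * \<delta>) + \<delta> * \<delta>" by (simp add: power2_eq_square algebra_simps)
    ultimately show ?thesis by linarith
  qed
  show ?thesis
  proof (cases "t * L + s < f")
    case False
    have "0 \<le> (f - t * h)\<^sup>2" by simp
    moreover have "(if t * L + s < f then s\<^sup>2 / 4 else 0) = 0" using False by simp
    ultimately show ?thesis using eq q lo by linarith
  next
    case True
    show ?thesis
    proof (cases "s / 2 \<le> \<bar>f - t * h\<bar>")
      case far: True
      have "(s / 2)\<^sup>2 \<le> \<bar>f - t * h\<bar>\<^sup>2" using far \<open>0 < s\<close> by (intro power_mono) auto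
      moreover have "(s / 2)\<^sup>2 = s\<^sup>2 / 4" by (simp add: power_divide)
      moreover have "(if t * L + s < f then s\<^sup>2 / 4 else 0) = s\<^sup>2 / 4" using True by simp
      ultimately show ?thesis using eq q lo unfolding power2_abs by linarith
    next
      case False
      then have "t * L + s / 2 < t * h" using True by linarith
      moreover have "t * (s / 2) \<le> s / 2" using t \<open>0 < s\<close> by simp
      ultimately have "t * (L + s / 2) < t * h" by (simp add: distrib_left)
      then have "L + s / 2 < h" using t by simp
      then have "(L + s / 2)\<^sup>2 \<le> h\<^sup>2" using L \<open>0 < s\<close> by (intro power_mono) auto
      moreover have "d\<^sup>2 \<le> L\<^sup>2" using assms by (intro power_mono) auto
      moreover have "(L + s / 2)\<^sup>2 = L\<^sup>2 + L * s + s\<^sup>2 / 4" by (simp add: power2_eq_square field_simps)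
      moreover have "0 \<le> L * s" "0 \<le> L * \<delta>" using L \<open>0 < s\<close> \<open>0 < \<delta>\<close> by auto
      moreover have "0 \<le> (f - t * h)\<^sup>2" by simp
      moreover have "(if t * L + s < f then s\<^sup>2 / 4 else 0) = s\<^sup>2 / 4" using True by simp
      ultimately show ?thesis using eq q by linarith
    qed
  qed
qed

text \<open>\<open>intermediate_excess\<close> is integrated over the glued measure. The weights 1/t
  and 1/(1 - t) turn the two near-optimal costs into t D^2 + (1 - t) D^2 = D^2 up to multiples of
  \<delta>, where D is the distance of the endpoints. The two outer coordinates form a coupling of
  the endpoints, so the integral of d^2 is at least D^2. Cancelling D^2 leaves a Chebyshev-type
  bound for the set of points that are too far away.\<close>

lemma intermediate_tail_bound:
  fixes \<mu>0 \<mu>1 \<nu> :: "'a::polish_space measure"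
  assumes P: "\<mu>0 \<in> P2" "\<mu>1 \<in> P2" "\<nu> \<in> P2" and t: "0 < t" "t < 1"
    and W: "W2 \<mu>0 \<nu> = t * W2 \<mu>0 \<mu>1" "W2 \<nu> \<mu>1 = (1 - t) * W2 \<mu>0 \<mu>1"
    and conc: "AE y in \<mu>0. y \<in> A0" "AE y in \<mu>1. y \<in> A1"
    and L: "\<And>y0 y1. y0 \<in> A0 \<Longrightarrow> y1 \<in> A1 \<Longrightarrow> dist y0 y1 \<le> L" and "0 \<le> L" and A0: "A0 \<subseteq> cball x0 \<epsilon>"
    and "0 < s" "0 < \<delta>"
  shows "ennreal (s\<^sup>2 / 4) * emeasure \<nu> {z. \<epsilon> + t * L + s < dist x0 z}
     \<le> ennreal (\<delta> / t + \<delta> / (1 - t) + 2 * L * \<delta>)"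
proof -
  define D where "D = W2 \<mu>0 \<mu>1"
  obtain \<pi>a where a: "\<pi>a \<in> couplings \<mu>0 \<nu>" and ca: "transport_cost \<pi>a \<le> ennreal ((t * D)\<^sup>2 + \<delta>)"
    using near_optimal_coupling[OF P(1,3) \<open>0 < \<delta>\<close>] W(1) by (metis D_def)
  obtain \<pi>b where b: "\<pi>b \<in> couplings \<nu> \<mu>1" and cb: "transport_cost \<pi>b \<le> ennreal (((1 - t) * D)\<^sup>2 + \<delta>)"
    using near_optimal_coupling[OF P(3,2) \<open>0 < \<delta>\<close>] W(2) by (metis D_def)
  have pr: "prob_space \<nu>" "sets \<nu> = sets borel" "prob_space \<mu>0" using P by (auto simp: P2_def)
  obtain \<sigma> :: "(('a \<times> 'a) \<times> ('a \<times> 'a)) measure" where \<sigma>: "sets \<sigma> = sets borel"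
    "distr \<sigma> borel fst = \<pi>a" "distr \<sigma> borel snd = \<pi>b"
    and AE\<delta>: "AE w in \<sigma>. dist (snd (fst w)) (fst (snd w)) < \<delta>"
    by (rule approximate_gluing[OF a b pr \<open>0 < \<delta>\<close>])
  have m: "fst \<in> measurable \<sigma> borel" "snd \<in> measurable \<sigma> borel"
    "(\<lambda>w. fst (fst w)) \<in> measurable \<sigma> borel" "(\<lambda>w. snd (fst w)) \<in> measurable \<sigma> borel"
    "(\<lambda>w. fst (snd w)) \<in> measurable \<sigma> borel" "(\<lambda>w. snd (snd w)) \<in> measurable \<sigma> borel"
    unfolding measurable_cong_sets[OF \<sigma>(1) refl]
    by (auto intro!: borel_measurable_continuous_onI continuous_intros)
  note [measurable] = m
  note sa = couplingsD(1)[OF a] and sb = couplingsD(1)[OF b]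
  note ma = measurable_from_borel_prod_sets[OF sa] and mb = measurable_from_borel_prod_sets[OF sb]
  have bfs: "fst \<in> measurable (borel :: ('a \<times> 'a) measure) borel" "snd \<in> measurable (borel :: ('a \<times> 'a) measure) borel"
    by (auto intro!: borel_measurable_continuous_onI continuous_intros)
  note [measurable] = bfs
  interpret \<sigma>: prob_space \<sigma>
  proof
    interpret a: prob_space \<pi>a using coupling_prob_space[OF a] pr by blast
    have "emeasure \<sigma> (space \<sigma>) = emeasure \<pi>a (space \<pi>a)"
      unfolding \<sigma>(2)[symmetric] by (subst emeasure_distr) auto
    then show "emeasure \<sigma> (space \<sigma>) = 1" by (simp add: a.emeasure_space_1)
  qed
  define f where "f w = dist (fst (fst w)) (snd (fst w))" for w :: "('a \<times> 'a) \<times> ('a \<times> 'a)"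
  define g where "g w = dist (fst (snd w)) (snd (snd w))" for w :: "('a \<times> 'a) \<times> ('a \<times> 'a)"
  define d where "d w = dist (fst (fst w)) (snd (snd w))" for w :: "('a \<times> 'a) \<times> ('a \<times> 'a)"
  have [measurable]: "f \<in> borel_measurable \<sigma>" "g \<in> borel_measurable \<sigma>" "d \<in> borel_measurable \<sigma>"
    unfolding f_def g_def d_def by measurable
  have Ef: "(\<integral>\<^sup>+w. ennreal ((f w)\<^sup>2) \<partial>\<sigma>) \<le> ennreal ((t * D)\<^sup>2 + \<delta>)"
  proof -
    have "(\<integral>\<^sup>+w. ennreal ((f w)\<^sup>2) \<partial>\<sigma>) = transport_cost \<pi>a"
      unfolding transport_cost_def \<sigma>(2)[symmetric] f_def by (subst nn_integral_distr) auto
    then show ?thesis using ca by simp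
  qed
  have Eg: "(\<integral>\<^sup>+w. ennreal ((g w)\<^sup>2) \<partial>\<sigma>) \<le> ennreal (((1 - t) * D)\<^sup>2 + \<delta>)"
  proof -
    have "(\<integral>\<^sup>+w. ennreal ((g w)\<^sup>2) \<partial>\<sigma>) = transport_cost \<pi>b"
      unfolding transport_cost_def \<sigma>(3)[symmetric] g_def by (subst nn_integral_distr) auto
    then show ?thesis using cb by simp
  qed
  define P where "P = (\<lambda>w::('a \<times> 'a) \<times> ('a \<times> 'a). (fst (fst w), snd (snd w)))"
  have P_meas: "P \<in> measurable \<sigma> borel"
    unfolding P_def measurable_cong_sets[OF \<sigma>(1) refl]
    by (auto intro!: borel_measurable_continuous_onI continuous_intros)
  have Pc: "distr \<sigma> borel P \<in> couplings \<mu>0 \<mu>1"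
  proof -
    have "distr (distr \<sigma> borel P) borel fst = distr (distr \<sigma> borel fst) borel fst"
      by (subst (1 2) distr_distr) (auto simp: P_meas bfs m P_def o_def)
    moreover have "distr (distr \<sigma> borel P) borel snd = distr (distr \<sigma> borel snd) borel snd"
      by (subst (1 2) distr_distr) (auto simp: P_meas bfs m P_def o_def)
    ultimately show ?thesis
      using \<sigma> couplingsD[OF a] couplingsD[OF b] by (simp add: couplings_def)
  qed
  have Ed: "ennreal (D\<^sup>2) \<le> (\<integral>\<^sup>+w. ennreal ((d w)\<^sup>2) \<partial>\<sigma>)"
  proof -
    have "ennreal (D\<^sup>2) \<le> transport_cost (distr \<sigma> borel P)"
      unfolding D_def W2_square[OF P(1,2), symmetric] using Pc by (rule INF_lower)
    also have "\<dots> = (\<integral>\<^sup>+w. ennreal ((d w)\<^sup>2) \<partial>\<sigma>)"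
      unfolding transport_cost_def d_def by (subst nn_integral_distr) (auto simp: P_meas, simp add: P_def)
    finally show ?thesis .
  qed
  have AE0: "AE w in \<sigma>. fst (fst w) \<in> A0"
    using AE_distrD[OF m(1), unfolded \<sigma>(2), OF coupling_AE(1)[OF a conc(1)]] .
  have AE1: "AE w in \<sigma>. snd (snd w) \<in> A1"
    using AE_distrD[OF m(2), unfolded \<sigma>(3), OF coupling_AE(2)[OF b conc(2)]] .
  define E where "E = {z. \<epsilon> + t * L + s < dist x0 z}"
  have [measurable]: "E \<in> sets borel" unfolding E_def by measurable
  have E\<sigma>: "emeasure \<nu> E = (\<integral>\<^sup>+w. indicator E (snd (fst w)) \<partial>\<sigma>)"
  proof -
    have "emeasure \<nu> E = (\<integral>\<^sup>+z. indicator E z \<partial>\<nu>)" using pr(2) by simp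
    also have "\<dots> = (\<integral>\<^sup>+u. indicator E (snd u) \<partial>\<pi>a)" by (subst coupling_nn_integral(2)[OF a]) auto
    also have "\<dots> = (\<integral>\<^sup>+w. indicator E (snd (fst w)) \<partial>\<sigma>)"
      unfolding \<sigma>(2)[symmetric] by (subst nn_integral_distr) auto
    finally show ?thesis .
  qed
  have nn: "0 \<le> 2 * L * \<delta>" using \<open>0 \<le> L\<close> \<open>0 < \<delta>\<close> by simp
  have "ennreal (s\<^sup>2 / 4) * emeasure \<nu> E + ennreal (D\<^sup>2) \<le>
      (\<integral>\<^sup>+w. ennreal (s\<^sup>2 / 4) * indicator E (snd (fst w)) + ennreal ((d w)\<^sup>2) \<partial>\<sigma>)"
    using Ed by (simp add: nn_integral_add nn_integral_cmult E\<sigma> add_left_mono)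
  also have "\<dots> \<le> (\<integral>\<^sup>+w. ennreal (1 / t) * ennreal ((f w)\<^sup>2) + ennreal (1 / (1 - t)) * ennreal ((g w)\<^sup>2) + ennreal (2 * L * \<delta>) \<partial>\<sigma>)"
  proof (rule nn_integral_mono_AE, use AE0 AE1 AE\<delta> in eventually_elim)
    case (elim w)
    have "d w \<le> f w + g w + \<delta>"
      using elim unfolding d_def f_def g_def by metric
    moreover have "d w \<le> L" unfolding d_def using L elim by simp
    ultimately have ex: "(if t * L + s < f w then s\<^sup>2 / 4 else 0) + (d w)\<^sup>2 \<le> (f w)\<^sup>2 / t + (g w)\<^sup>2 / (1 - t) + 2 * L * \<delta>"
      using t \<open>0 < s\<close> \<open>0 < \<delta>\<close> by (intro intermediate_excess) (auto simp: f_def g_def d_def)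
    have "t * L + s < f w" if "snd (fst w) \<in> E"
    proof -
      have "dist x0 (fst (fst w)) \<le> \<epsilon>" using elim A0 by auto
      then show ?thesis using that dist_triangle[of x0 "snd (fst w)" "fst (fst w)"] by (simp add: E_def f_def)
    qed
    then have "ennreal (s\<^sup>2 / 4) * indicator E (snd (fst w)) + ennreal ((d w)\<^sup>2)
      \<le> ennreal ((if t * L + s < f w then s\<^sup>2 / 4 else 0) + (d w)\<^sup>2)"
      by (auto simp: indicator_def ennreal_plus[symmetric] simp del: ennreal_plus)
    also have "\<dots> \<le> ennreal ((f w)\<^sup>2 / t + (g w)\<^sup>2 / (1 - t) + 2 * L * \<delta>)"
      by (rule ennreal_leI[OF ex])
    also have "\<dots> = ennreal (1 / t) * ennreal ((f w)\<^sup>2) + ennreal (1 / (1 - t)) * ennreal ((g w)\<^sup>2) + ennreal (2 * L * \<delta>)"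
      using t nn by (simp add: ennreal_mult[symmetric] ennreal_plus[symmetric] del: ennreal_plus)
    finally show ?case .
  qed
  also have "\<dots> = ennreal (1 / t) * (\<integral>\<^sup>+w. ennreal ((f w)\<^sup>2) \<partial>\<sigma>) + ennreal (1 / (1 - t)) * (\<integral>\<^sup>+w. ennreal ((g w)\<^sup>2) \<partial>\<sigma>) + ennreal (2 * L * \<delta>)"
    by (simp add: nn_integral_add nn_integral_cmult \<sigma>.emeasure_space_1)
  also have "\<dots> \<le> ennreal (1 / t) * ennreal ((t * D)\<^sup>2 + \<delta>) + ennreal (1 / (1 - t)) * ennreal (((1 - t) * D)\<^sup>2 + \<delta>) + ennreal (2 * L * \<delta>)"
    by (intro add_mono mult_left_mono Ef Eg) auto
  also have "\<dots> = ennreal (1 / t * ((t * D)\<^sup>2 + \<delta>) + 1 / (1 - t) * (((1 - t) * D)\<^sup>2 + \<delta>) + 2 * L * \<delta>)"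
    using t nn \<open>0 < \<delta>\<close> by (simp add: ennreal_mult[symmetric] ennreal_plus[symmetric] del: ennreal_plus)
  also have "1 / t * ((t * D)\<^sup>2 + \<delta>) + 1 / (1 - t) * (((1 - t) * D)\<^sup>2 + \<delta>) + 2 * L * \<delta>
      = (\<delta> / t + \<delta> / (1 - t) + 2 * L * \<delta>) + D\<^sup>2"
    using t by (simp add: field_simps power2_eq_square)
  also have "ennreal \<dots> = ennreal (\<delta> / t + \<delta> / (1 - t) + 2 * L * \<delta>) + ennreal (D\<^sup>2)"
    using t nn \<open>0 < \<delta>\<close> by (intro ennreal_plus) auto
  finally show ?thesis unfolding E_def[symmetric] by simp
qed

text \<open>For fixed s the tail bound is independent of \<delta> on the left and vanishes with
  \<delta> on the right; the margins s = 1/(i + 1) then exhaust the complement of the closed ball by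
  null sets.\<close>

lemma intermediate_measure_support:
  fixes \<mu>0 \<mu>1 \<nu> :: "'a::polish_space measure"
  assumes P: "\<mu>0 \<in> P2" "\<mu>1 \<in> P2" "\<nu> \<in> P2" and t: "0 < t" "t < 1"
    and W: "W2 \<mu>0 \<nu> = t * W2 \<mu>0 \<mu>1" "W2 \<nu> \<mu>1 = (1 - t) * W2 \<mu>0 \<mu>1"
    and conc: "AE y in \<mu>0. y \<in> A0" "AE y in \<mu>1. y \<in> A1"
    and L: "\<And>y0 y1. y0 \<in> A0 \<Longrightarrow> y1 \<in> A1 \<Longrightarrow> dist y0 y1 \<le> L" and "0 \<le> L" and A0: "A0 \<subseteq> cball x0 \<epsilon>"
  shows "AE z in \<nu>. z \<in> cball x0 (\<epsilon> + t * L)"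
proof -
  have s\<nu>: "sets \<nu> = sets borel" using P by (auto simp: P2_def)
  have zero: "emeasure \<nu> {z. \<epsilon> + t * L + s < dist x0 z} = 0" if "0 < s" for s
  proof -
    have "ennreal (s\<^sup>2 / 4) * emeasure \<nu> {z. \<epsilon> + t * L + s < dist x0 z} \<le> 0"
    proof (rule tendsto_lowerbound)
      have "((\<lambda>\<delta>. \<delta> / t + \<delta> / (1 - t) + 2 * L * \<delta>) \<longlongrightarrow> 0 / t + 0 / (1 - t) + 2 * L * 0) (at_right 0)"
        using t by (intro tendsto_intros) auto
      then show "((\<lambda>\<delta>. ennreal (\<delta> / t + \<delta> / (1 - t) + 2 * L * \<delta>)) \<longlongrightarrow> 0) (at_right 0)"
        using tendsto_ennrealI by fastforce
      show "\<forall>\<^sub>F \<delta> in at_right 0. ennreal (s\<^sup>2 / 4) * emeasure \<nu> {z. \<epsilon> + t * L + s < dist x0 z}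
          \<le> ennreal (\<delta> / t + \<delta> / (1 - t) + 2 * L * \<delta>)"
        using intermediate_tail_bound[OF P t W conc L \<open>0 \<le> L\<close> A0 that]
        by (auto simp: eventually_at_right_less intro: eventually_mono[OF eventually_at_right_less])
    qed simp
    then show ?thesis using that by (simp add: ennreal_mult_eq_top_iff)
  qed
  have "AE z in \<nu>. \<forall>i::nat. \<not> \<epsilon> + t * L + 1 / Suc i < dist x0 z"
    unfolding AE_all_countable
  proof
    fix i :: nat
    show "AE z in \<nu>. \<not> \<epsilon> + t * L + 1 / Suc i < dist x0 z"
      by (rule AE_I'[of "{z. \<epsilon> + t * L + 1 / Suc i < dist x0 z}"])
        (use zero[of "1 / Suc i"] in \<open>auto simp: null_sets_def s\<nu>\<close>)
  qed
  then show ?thesis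
  proof eventually_elim
    case (elim z)
    have "dist x0 z \<le> \<epsilon> + t * L"
    proof (rule field_le_epsilon)
      fix e :: real assume "0 < e"
      then obtain i where "1 / Suc i < e" using nat_approx_posE by blast
      then show "dist x0 z \<le> \<epsilon> + t * L + e" using elim[rule_format, of i] by linarith
    qed
    then show ?case by simp
  qed
qed

section \<open>Entropy and distortion coefficients\<close>

text \<open>The tangent line of the concave function r to the power 1 - 1/N at r = 1/b, obtained
  from the weighted Young inequality for b r and 1.\<close>

lemma powr_tangent_bound:
  fixes b r N :: real
  assumes "1 \<le> N" "0 < b" "0 < r"
  shows "r * r powr (- 1 / N) \<le> (1 - 1 / N) * b powr (1 / N) * r + b powr (1 / N - 1) / N"
proof -
  have y: "(b * r) powr (1 - 1 / N) * 1 powr (1 / N) \<le> (1 - 1 / N) * (b * r) + 1 / N * 1"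
    using assms by (intro Youngs_inequality_0) auto
  have "r * r powr (- 1 / N) = r powr (1 - 1 / N)"
    using assms powr_add[of r 1 "- 1 / N"] by simp
  also have "\<dots> = b powr (1 / N - 1) * (b * r) powr (1 - 1 / N)"
    using assms by (simp add: powr_mult powr_add[symmetric] flip: mult.assoc)
  also have "\<dots> \<le> b powr (1 / N - 1) * ((1 - 1 / N) * (b * r) + 1 / N)"
    using y by (intro mult_left_mono) auto
  also have "\<dots> = (1 - 1 / N) * (b powr (1 / N - 1) * b powr 1) * r + b powr (1 / N - 1) / N"
    using assms by (simp add: algebra_simps)
  also have "b powr (1 / N - 1) * b powr 1 = b powr (1 / N)"
    by (simp only: powr_add[symmetric]) simp
  finally show ?thesis .
qed

lemma neg_root_tangent_bound:
  fixes \<rho> :: ennreal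
  assumes "1 \<le> N" "0 < b"
  shows "\<rho> * neg_root N \<rho> \<le> ennreal ((1 - 1 / N) * b powr (1 / N)) * \<rho> + ennreal (b powr (1 / N - 1) / N)"
\<comment> \<open>At 0 and at \<infinity> the left-hand side is 0: in the infinite case
  \<open>enn2real\<close> returns 0, the power of 0 is 0, and \<infinity> times 0 is 0.\<close>
proof (cases \<rho>)
  case (real r)
  show ?thesis
  proof (cases "r = 0")
    case False
    then have "0 < r" using real by simp
    have "\<rho> * neg_root N \<rho> = ennreal (r * r powr (- 1 / N))"
      using real by (simp add: neg_root_def ennreal_mult)
    also have "\<dots> \<le> ennreal ((1 - 1 / N) * b powr (1 / N) * r + b powr (1 / N - 1) / N)"
      by (intro ennreal_leI powr_tangent_bound assms \<open>0 < r\<close>)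
    also have "\<dots> = ennreal ((1 - 1 / N) * b powr (1 / N)) * \<rho> + ennreal (b powr (1 / N - 1) / N)"
      using assms real by (subst ennreal_plus) (auto simp: ennreal_mult)
    finally show ?thesis .
  qed (use real in simp)
qed (simp add: neg_root_def)

text \<open>\<open>ac_density\<close> is a choice, so some decomposition must first be exhibited:
  the Radon-Nikodym derivative with singular part 0. Whatever decomposition is chosen, its
  absolutely continuous part is dominated by \<mu>, and domination is the right direction for
  bounding the entropy integral from above.\<close>

lemma ac_density_le:
  fixes m \<mu> :: "'a measure"
  assumes "sigma_finite_measure m" "absolutely_continuous m \<mu>" "sets \<mu> = sets m"
  shows "ac_density m \<mu> \<in> borel_measurable m"
    and "B \<in> sets m \<Longrightarrow> emeasure (density m (ac_density m \<mu>)) B \<le> emeasure \<mu> B"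
proof -
  interpret sigma_finite_measure m by fact
  have "lebesgue_decomposition m \<mu> (RN_deriv m \<mu>) (null_measure m)"
    unfolding lebesgue_decomposition_def
    using density_RN_deriv[OF assms(2,3)] by auto
  then have "\<exists>\<mu>s. lebesgue_decomposition m \<mu> (ac_density m \<mu>) \<mu>s"
    unfolding ac_density_def
    using someI_ex[of "\<lambda>\<rho>. \<exists>\<mu>s. lebesgue_decomposition m \<mu> \<rho> \<mu>s"] by blast
  then obtain \<mu>s where *: "lebesgue_decomposition m \<mu> (ac_density m \<mu>) \<mu>s" ..
  then show "ac_density m \<mu> \<in> borel_measurable m" by (simp add: lebesgue_decomposition_def)
  show "B \<in> sets m \<Longrightarrow> emeasure (density m (ac_density m \<mu>)) B \<le> emeasure \<mu> B"
    using * by (simp add: lebesgue_decomposition_def)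
qed

text \<open>
  Jensen's inequality in disguise: the integrand \<open>\<rho>\<^bsup>1 - 1 / N\<^esup>\<close> lies below its tangent line at
  \<open>\<rho> = 1 / m B\<close>.
\<close>

lemma entropy_integral_le:
  fixes m \<mu> :: "'a measure"
  assumes sf: "sigma_finite_measure m" and ac: "absolutely_continuous m \<mu>" and s: "sets \<mu> = sets m"
    and "prob_space \<mu>" and N: "1 \<le> N" and B: "B \<in> sets m" "0 < emeasure m B" "emeasure m B < \<infinity>"
    and conc: "AE x in \<mu>. x \<in> B"
  shows "(\<integral>\<^sup>+x. neg_root N (ac_density m \<mu> x) \<partial>density m (ac_density m \<mu>)) \<le> ennreal (measure m B powr (1 / N))"
proof -
  interpret \<mu>: prob_space \<mu> by fact
  define \<rho> where "\<rho> = ac_density m \<mu>"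
  note acd = ac_density_le[OF sf ac s, folded \<rho>_def]
  have [measurable]: "\<rho> \<in> borel_measurable m" "B \<in> sets m" by (fact acd B)+
  have [measurable]: "(\<lambda>x. neg_root N (\<rho> x)) \<in> borel_measurable m"
    unfolding neg_root_def by measurable
  define b where "b = measure m B"
  have mB: "emeasure m B = ennreal b" using B by (simp add: b_def emeasure_eq_ennreal_measure)
  then have b: "0 < b" using B by simp
  have "emeasure \<mu> (space m - B) = 0"
    using conc by (subst (asm) AE_iff_measurable[OF _ refl])
      (use s sets_eq_imp_space_eq[OF s] in \<open>auto simp: set_diff_eq\<close>)
  then have out: "emeasure (density m \<rho>) (space m - B) = 0"
    using acd(2)[of "space m - B"] by auto
  have "AE x in density m \<rho>. x \<in> B"
    by (rule AE_I'[of "space m - B"]) (use out in \<open>auto simp: null_sets_def\<close>)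
  then have "(\<integral>\<^sup>+x. neg_root N (\<rho> x) \<partial>density m \<rho>) = (\<integral>\<^sup>+x. neg_root N (\<rho> x) * indicator B x \<partial>density m \<rho>)"
    by (intro nn_integral_cong_AE) (auto elim: eventually_mono)
  also have "\<dots> = (\<integral>\<^sup>+x. (\<rho> x * neg_root N (\<rho> x)) * indicator B x \<partial>m)"
    by (subst nn_integral_density) (auto simp: mult_ac)
  also have "\<dots> \<le> (\<integral>\<^sup>+x. (ennreal ((1 - 1 / N) * b powr (1 / N)) * \<rho> x + ennreal (b powr (1 / N - 1) / N)) * indicator B x \<partial>m)"
    by (intro nn_integral_mono mult_right_mono neg_root_tangent_bound N b) auto
  also have "\<dots> = (\<integral>\<^sup>+x. ennreal ((1 - 1 / N) * b powr (1 / N)) * (\<rho> x * indicator B x) + ennreal (b powr (1 / N - 1) / N) * indicator B x \<partial>m)"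
    by (intro nn_integral_cong) (simp add: algebra_simps)
  also have "\<dots> = ennreal ((1 - 1 / N) * b powr (1 / N)) * emeasure (density m \<rho>) B + ennreal (b powr (1 / N - 1) / N) * ennreal b"
    by (simp add: nn_integral_add nn_integral_cmult emeasure_density mB)
  also have "\<dots> \<le> ennreal ((1 - 1 / N) * b powr (1 / N)) * 1 + ennreal (b powr (1 / N - 1) / N) * ennreal b"
    using acd(2)[OF B(1)] \<mu>.emeasure_le_1[of B] by (intro add_right_mono mult_left_mono) (auto intro: order_trans)
  also have "\<dots> = ennreal ((1 - 1 / N) * b powr (1 / N) + b powr (1 / N - 1) / N * b)"
    using N b by (simp add: ennreal_mult[symmetric] ennreal_plus[symmetric] del: ennreal_plus)
  also have "b powr (1 / N - 1) / N * b = (b powr (1 / N - 1) * b powr 1) / N"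
    using b by simp
  also have "b powr (1 / N - 1) * b powr 1 = b powr (1 / N)"
    by (simp only: powr_add[symmetric]) simp
  also have "(1 - 1 / N) * b powr (1 / N) + b powr (1 / N) / N = b powr (1 / N)"
    using N by (simp add: field_simps)
  finally show ?thesis by (simp add: \<rho>_def b_def)
qed

section \<open>Distortion coefficients for nonnegative curvature\<close>

lemma sin_scaling:
  fixes a t :: real
  assumes "0 \<le> a" "a \<le> pi" "0 \<le> t" "t \<le> 1"
  shows "t * sin a \<le> sin (t * a)"
proof -
  have "convex_on {0..pi} (\<lambda>x. - sin x)"
    by (rule f''_ge0_imp_convex[where f' = "\<lambda>x. - cos x" and f'' = sin])
      (auto intro!: derivative_eq_intros sin_ge_zero)
  from convex_onD[OF this, of t 0 a] assms show ?thesis by simp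
qed

text \<open>Concavity of the sine on [0, pi] makes the coefficients for K \<ge> 0 at least as large
  as the flat coefficient t, so volume comparison can be done with pure powers of the
  radius.\<close>

lemma tau_ge:
  assumes "0 \<le> K" "1 < N" "0 < t" "t < 1" "0 \<le> s"
  shows "ennreal t \<le> tau K N t s"
proof (cases "K * s\<^sup>2 = 0 \<or> K * s\<^sup>2 \<ge> (N - 1) * pi\<^sup>2")
  case True
  then show ?thesis by (auto simp: tau_def)
next
  case False
  define a where "a = sqrt (K / (N - 1)) * s"
  have pos: "0 < K" "0 < s" using False assms by (auto simp: less_le)
  have a0: "0 < a" using pos assms by (simp add: a_def)
  have "a\<^sup>2 = K * s\<^sup>2 / (N - 1)" using assms by (simp add: a_def power_mult_distrib)
  also have "\<dots> < pi\<^sup>2" using False assms by (simp add: field_simps)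
  finally have api: "a < pi" by (rule power_less_imp_less_base) simp
  have sa: "0 < sin a" using a0 api by (rule sin_gt_zero)
  have "t \<le> sin (t * a) / sin a" using sin_scaling[of a t] assms a0 api sa by (simp add: field_simps)
  then have "t powr (1 - 1 / N) \<le> (sin (t * a) / sin a) powr (1 - 1 / N)"
    using assms by (intro powr_mono2) auto
  then have "t powr (1 / N) * t powr (1 - 1 / N) \<le> t powr (1 / N) * (sin (t * a) / sin a) powr (1 - 1 / N)"
    by (intro mult_left_mono) auto
  moreover have "t powr (1 / N) * t powr (1 - 1 / N) = t"
    using assms by (simp add: powr_add[symmetric])
  ultimately have "ennreal t \<le> ennreal (t powr (1 / N) * (sin (t * a) / sin a) powr (1 - 1 / N))"
    by (intro ennreal_leI) simp
  also have "\<dots> = tau K N t s" using False by (simp add: tau_def a_def mult_ac)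
  finally show ?thesis .
qed

text \<open>The threshold is the diameter of the round N-sphere of Ricci curvature K, that is, of
  radius \<open>sqrt ((N - 1) / K)\<close>.\<close>

lemma tau_infinite:
  assumes "0 < K" "1 < N" "pi * sqrt ((N - 1) / K) \<le> s"
  shows "tau K N t s = \<infinity>"
proof -
  have pos: "0 < pi * sqrt ((N - 1) / K)" using assms by simp
  then have "0 < s" using assms by linarith
  have "(pi * sqrt ((N - 1) / K))\<^sup>2 \<le> s\<^sup>2" using pos assms by (intro power_mono) auto
  then have "pi\<^sup>2 * ((N - 1) / K) \<le> s\<^sup>2" using assms by (simp add: power_mult_distrib)
  then have "(N - 1) * pi\<^sup>2 \<le> K * s\<^sup>2" using assms by (simp add: field_simps)
  then show ?thesis using assms \<open>0 < s\<close> by (simp add: tau_def)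
qed

section \<open>Brunn--Minkowski, Bishop--Gromov and Bonnet--Myers\<close>

lemma uniform_measure_absolutely_continuous:
  assumes [measurable]: "A \<in> sets m"
  shows "absolutely_continuous m (uniform_measure m A)"
  unfolding uniform_measure_def by (intro absolutely_continuousI_density) measurable

section \<open>Volumes in a proper metric measure space\<close>

locale proper_mms =
  fixes m :: "'a::polish_space measure"
  assumes mms: "metric_measure_space m"
    and proper: "\<And>S :: 'a set. closed S \<Longrightarrow> bounded S \<Longrightarrow> compact S"
begin

lemma sets_m[measurable_cong, simp]: "sets m = sets borel"
  using mms by (simp add: metric_measure_space_def)

lemma space_m[simp]: "space m = UNIV"
  using sets_eq_imp_space_eq[OF sets_m] by simp

text \<open>Properness upgrades local finiteness: the compact closure is covered by finitely many
  balls of finite mass.\<close>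

lemma emeasure_bounded_finite:
  assumes "bounded S"
  shows "emeasure m S < \<infinity>"
proof -
  have "\<forall>x. \<exists>r>0. emeasure m (ball x r) < \<infinity>"
    using mms by (simp add: metric_measure_space_def locally_finite_measure_def)
  then obtain r where r: "\<And>x. 0 < r x" "\<And>x. emeasure m (ball x (r x)) < \<infinity>" by metis
  have comp: "compact (closure S)" using assms by (intro proper) auto
  have cover: "closure S \<subseteq> (\<Union>x\<in>UNIV. ball x (r x))" using centre_in_ball r(1) by blast
  obtain I where I: "finite I" "closure S \<subseteq> (\<Union>x\<in>I. ball x (r x))"
    by (rule compactE_image[OF comp _ cover]) auto
  have "emeasure m S \<le> emeasure m (\<Union>x\<in>I. ball x (r x))"
    using I closure_subset[of S] by (intro emeasure_mono) auto
  also have "\<dots> \<le> (\<Sum>x\<in>I. emeasure m (ball x (r x)))"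
    using I by (intro emeasure_subadditive_finite) auto
  also have "\<dots> < \<infinity>" using r(2) I by (simp add: ennreal_sum_less_top less_top)
  finally show ?thesis .
qed

lemma emeasure_eq_measure_bounded: "bounded S \<Longrightarrow> emeasure m S = ennreal (measure m S)"
  using emeasure_bounded_finite[of S] by (intro emeasure_eq_ennreal_measure) simp

lemma emeasure_ball_pos: "0 < r \<Longrightarrow> 0 < emeasure m (ball x r)"
proof -
  assume "0 < r"
  have "x \<in> measure_support m" using mms by (simp add: metric_measure_space_def)
  then show ?thesis using \<open>0 < r\<close> by (auto simp: measure_support_def)
qed

lemma measure_ball_pos: "0 < r \<Longrightarrow> 0 < measure m (ball x r)"
  using emeasure_ball_pos[of r x] emeasure_eq_measure_bounded[of "ball x r"] by simp

lemma sigma_finite: "sigma_finite_measure m"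
proof
  obtain x :: 'a where True by simp
  show "\<exists>A. countable A \<and> A \<subseteq> sets m \<and> \<Union> A = space m \<and> (\<forall>a\<in>A. emeasure m a \<noteq> \<infinity>)"
  proof (intro exI conjI)
    show "countable (range (\<lambda>i::nat. ball x (real i)))" by simp
    have "z \<in> (\<Union>i::nat. ball x (real i))" for z
      using reals_Archimedean2[of "dist x z"] by auto
    then show "\<Union> (range (\<lambda>i::nat. ball x (real i))) = space m" by auto
    show "\<forall>a\<in>range (\<lambda>i::nat. ball x (real i)). emeasure m a \<noteq> \<infinity>"
      using emeasure_bounded_finite[OF bounded_ball] by (auto simp: less_top[symmetric])
  qed auto
qed

lemma measure_mono_bounded: "A \<subseteq> B \<Longrightarrow> A \<in> sets borel \<Longrightarrow> B \<in> sets borel \<Longrightarrow> bounded B \<Longrightarrow> measure m A \<le> measure m B"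
  using emeasure_bounded_finite by (intro measure_mono_fmeasurable) (auto simp: fmeasurable_def)

lemma uniform_measure_P2_ac:
  assumes "A \<in> sets borel" "bounded A" "0 < emeasure m A"
  shows "uniform_measure m A \<in> P2_ac m"
proof -
  have fin: "emeasure m A < \<infinity>" by (rule emeasure_bounded_finite[OF assms(2)])
  interpret \<mu>: prob_space "uniform_measure m A"
    using assms fin by (intro prob_space_uniform_measure) auto
  obtain x e where xe: "\<And>y. y \<in> A \<Longrightarrow> dist x y \<le> e" using assms(2) by (auto simp: bounded_def)
  have "AE y in uniform_measure m A. dist x y \<le> e"
    using assms xe by (intro AE_uniform_measureI) auto
  then have "(\<integral>\<^sup>+ y. ennreal ((dist x y)\<^sup>2) \<partial>uniform_measure m A) \<le> (\<integral>\<^sup>+ y. ennreal (e\<^sup>2) \<partial>uniform_measure m A)"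
    by (intro nn_integral_mono_AE) (auto elim!: eventually_mono intro!: ennreal_leI power_mono)
  also have "\<dots> < \<infinity>" using \<mu>.emeasure_space_1 by simp
  finally show ?thesis
    using assms \<mu>.prob_space_axioms uniform_measure_absolutely_continuous[of A m]
    by (auto simp: P2_ac_def P2_def)
qed

text \<open>On \<open>A\<close> the density of the uniform measure is 1/m(A), so its power -1/N is
  the constant m(A) to the power 1/N. With uniform endpoints the right-hand side of the
  curvature-dimension inequality thus depends on volumes and distances only.\<close>

lemma neg_root_uniform_density:
  assumes A: "A \<in> sets borel" "bounded A" "0 < emeasure m A"
  shows "AE x in uniform_measure m A.
    x \<in> A \<and> neg_root N (RN_deriv m (uniform_measure m A) x) = ennreal (measure m A powr (1 / N))"
proof -
  interpret sigma_finite_measure m by (rule sigma_finite)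
  have a: "emeasure m A = ennreal (measure m A)" by (rule emeasure_eq_measure_bounded[OF A(2)])
  then have pos: "0 < measure m A" using A(3) by simp
  have "AE x in m. indicator A x / emeasure m A = RN_deriv m (uniform_measure m A) x"
    using A by (intro RN_deriv_unique) (auto simp: uniform_measure_def)
  then have "AE x in uniform_measure m A. indicator A x / emeasure m A = RN_deriv m (uniform_measure m A) x"
    using A by (intro absolutely_continuous_AE[OF _ uniform_measure_absolutely_continuous]) auto
  moreover have "AE x in uniform_measure m A. x \<in> A"
    using A by (intro AE_uniform_measureI) auto
  ultimately show ?thesis
  proof eventually_elim
    case (elim x)
    then have "RN_deriv m (uniform_measure m A) x = ennreal (1 / measure m A)"
      using pos by (simp add: a divide_ennreal[symmetric] elim(1)[symmetric])
    then show ?case using elim pos by (simp add: neg_root_def powr_minus powr_divide divide_simps)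
  qed
qed

text \<open>The entropy of the intermediate measure is squeezed between the curvature-dimension
  bound and Jensen's bound by the volume of a ball carrying it. The set \<open>A0\<close> lies in a
  small ball so that all intermediate points are near one centre. The coupling stays visible in the
  conclusion because the distortion coefficients are estimated in two ways: by t for Bishop-Gromov
  and by \<infinity> for Bonnet-Myers.\<close>

lemma CD_brunn_minkowski:
  assumes CD: "CD m K N" "1 \<le> N" and t: "0 < t" "t < 1"
    and A0: "A0 \<in> sets borel" "0 < emeasure m A0" "A0 \<subseteq> cball x \<epsilon>"
    and A1: "A1 \<in> sets borel" "0 < emeasure m A1" "bounded A1"
    and L: "\<And>y0 y1. y0 \<in> A0 \<Longrightarrow> y1 \<in> A1 \<Longrightarrow> dist y0 y1 \<le> L" "0 \<le> L" and "0 < \<epsilon>"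
  obtains \<pi> where "\<pi> \<in> couplings (uniform_measure m A0) (uniform_measure m A1)" "prob_space \<pi>"
    "AE y in \<pi>. fst y \<in> A0 \<and> snd y \<in> A1"
    "(\<integral>\<^sup>+y. tau K N (1 - t) (dist (fst y) (snd y)) * ennreal (measure m A0 powr (1 / N))
            + tau K N t (dist (fst y) (snd y)) * ennreal (measure m A1 powr (1 / N)) \<partial>\<pi>)
      \<le> ennreal (measure m (cball x (\<epsilon> + t * L)) powr (1 / N))"
proof -
  define \<mu>0 where "\<mu>0 = uniform_measure m A0"
  define \<mu>1 where "\<mu>1 = uniform_measure m A1"
  have bA0: "bounded A0" using A0(3) bounded_subset bounded_cball by blast
  have P: "\<mu>0 \<in> P2_ac m" "\<mu>1 \<in> P2_ac m"
    unfolding \<mu>0_def \<mu>1_def using A0 A1 bA0 by (auto intro: uniform_measure_P2_ac)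
  obtain \<pi> \<Gamma> where opt: "optimal_coupling \<mu>0 \<mu>1 \<pi>" and geo: "geodesic_P2_ac m \<mu>0 \<mu>1 \<Gamma>"
    and ent: "\<forall>t\<in>{0..1}. \<forall>N'\<ge>N. renyi_entropy N' (\<Gamma> t) m \<le>
           - enn2ereal (\<integral>\<^sup>+ y. tau K N' (1 - t) (dist (fst y) (snd y)) * neg_root N' (RN_deriv m \<mu>0 (fst y))
                              + tau K N' t (dist (fst y) (snd y)) * neg_root N' (RN_deriv m \<mu>1 (snd y)) \<partial>\<pi>)"
    using bspec[OF bspec[OF CD(1)[unfolded CD_def] P(1)] P(2)] by blast
  have \<pi>: "\<pi> \<in> couplings \<mu>0 \<mu>1" using opt by (simp add: optimal_coupling_def)
  have \<Gamma>: "\<Gamma> t \<in> P2_ac m" "\<Gamma> 0 = \<mu>0" "\<Gamma> 1 = \<mu>1"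
    and W: "\<And>s t. s \<in> {0..1} \<Longrightarrow> t \<in> {0..1} \<Longrightarrow> W2 (\<Gamma> s) (\<Gamma> t) = \<bar>s - t\<bar> * W2 \<mu>0 \<mu>1"
    using geo t by (auto simp: geodesic_P2_ac_def)
  have W': "W2 \<mu>0 (\<Gamma> t) = t * W2 \<mu>0 \<mu>1" "W2 (\<Gamma> t) \<mu>1 = (1 - t) * W2 \<mu>0 \<mu>1"
    using W[of 0 t] W[of t 1] t \<Gamma> by auto
  note n0 = neg_root_uniform_density[OF A0(1) bA0 A0(2), folded \<mu>0_def]
  note n1 = neg_root_uniform_density[OF A1(1) A1(3) A1(2), folded \<mu>1_def]
  have conc: "AE z in \<Gamma> t. z \<in> cball x (\<epsilon> + t * L)"
    using P \<Gamma>(1) n0[of N] n1[of N]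
    by (intro intermediate_measure_support[OF _ _ _ t W' _ _ L A0(3)]) (auto simp: P2_ac_def elim: eventually_mono)
  define B where "B = cball x (\<epsilon> + t * L)"
  have "0 < \<epsilon> + t * L" using t L(2) \<open>0 < \<epsilon>\<close> by (simp add: add_pos_nonneg)
  then have "0 < emeasure m (ball x (\<epsilon> + t * L))" by (rule emeasure_ball_pos)
  also have "\<dots> \<le> emeasure m B" unfolding B_def by (intro emeasure_mono) auto
  finally have Bpos: "0 < emeasure m B" .
  have "(\<integral>\<^sup>+z. neg_root N (ac_density m (\<Gamma> t) z) \<partial>density m (ac_density m (\<Gamma> t))) \<le> ennreal (measure m B powr (1 / N))"
    using \<Gamma>(1) CD(2) Bpos conc emeasure_bounded_finite[of B]
    by (intro entropy_integral_le sigma_finite) (auto simp: P2_ac_def P2_def B_def)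
  then have "- enn2ereal (ennreal (measure m B powr (1 / N))) \<le> renyi_entropy N (\<Gamma> t) m"
    unfolding renyi_entropy_def ereal_minus_le_minus less_eq_ennreal.rep_eq[symmetric] .
  also have "\<dots> \<le> - enn2ereal (\<integral>\<^sup>+ y. tau K N (1 - t) (dist (fst y) (snd y)) * neg_root N (RN_deriv m \<mu>0 (fst y))
                              + tau K N t (dist (fst y) (snd y)) * neg_root N (RN_deriv m \<mu>1 (snd y)) \<partial>\<pi>)"
    using ent t by auto
  finally have le: "(\<integral>\<^sup>+ y. tau K N (1 - t) (dist (fst y) (snd y)) * neg_root N (RN_deriv m \<mu>0 (fst y))
                              + tau K N t (dist (fst y) (snd y)) * neg_root N (RN_deriv m \<mu>1 (snd y)) \<partial>\<pi>)
      \<le> ennreal (measure m B powr (1 / N))"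
    unfolding ereal_minus_le_minus less_eq_ennreal.rep_eq[symmetric] .
  have eq:  "(\<integral>\<^sup>+y. tau K N (1 - t) (dist (fst y) (snd y)) * neg_root N (RN_deriv m \<mu>0 (fst y))
                              + tau K N t (dist (fst y) (snd y)) * neg_root N (RN_deriv m \<mu>1 (snd y)) \<partial>\<pi>)
    = (\<integral>\<^sup>+y. tau K N (1 - t) (dist (fst y) (snd y)) * ennreal (measure m A0 powr (1 / N))
            + tau K N t (dist (fst y) (snd y)) * ennreal (measure m A1 powr (1 / N)) \<partial>\<pi>)"
    using coupling_AE(1)[OF \<pi> n0[of N]] coupling_AE(2)[OF \<pi> n1[of N]]
    by (intro nn_integral_cong_AE) (auto elim: eventually_elim2)
  have conc\<pi>: "AE y in \<pi>. fst y \<in> A0 \<and> snd y \<in> A1"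
    using coupling_AE(1)[OF \<pi> n0[of N]] coupling_AE(2)[OF \<pi> n1[of N]] by (auto elim: eventually_elim2)
  have "prob_space \<pi>" using coupling_prob_space[OF \<pi>] P(1) by (simp add: P2_ac_def P2_def)
  from that[OF \<pi>[unfolded \<mu>0_def \<mu>1_def] this conc\<pi> le[unfolded eq B_def]] show ?thesis .
qed

text \<open>This is contraction of a ball towards its centre. The centre may have mass 0, so it is
  replaced by a ball of radius \<epsilon>, whose nonnegative contribution is dropped.\<close>

lemma CD_ball_scaling_eps:
  assumes CD: "CD m K N" "1 < N" "0 \<le> K" and t: "0 < t" "t < 1" and "0 < R" "0 < \<epsilon>"
  shows "t powr N * measure m (ball x R) \<le> measure m (cball x (\<epsilon> + t * (R + \<epsilon>)))"
proof -
  have L: "dist y0 y1 \<le> R + \<epsilon>" if "y0 \<in> ball x \<epsilon>" "y1 \<in> ball x R" for y0 y1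
    using that dist_triangle3[of y0 y1 x] by simp
  have balls: "ball x \<epsilon> \<in> sets borel" "0 < emeasure m (ball x \<epsilon>)" "ball x \<epsilon> \<subseteq> cball x \<epsilon>"
    "ball x R \<in> sets borel" "0 < emeasure m (ball x R)" "bounded (ball x R)" "0 \<le> R + \<epsilon>"
    using emeasure_ball_pos assms by auto
  obtain \<pi> where "\<pi> \<in> couplings (uniform_measure m (ball x \<epsilon>)) (uniform_measure m (ball x R))" and "prob_space \<pi>"
    and "AE y in \<pi>. fst y \<in> ball x \<epsilon> \<and> snd y \<in> ball x R" and
    le: "(\<integral>\<^sup>+y. tau K N (1 - t) (dist (fst y) (snd y)) * ennreal (measure m (ball x \<epsilon>) powr (1 / N))
            + tau K N t (dist (fst y) (snd y)) * ennreal (measure m (ball x R) powr (1 / N)) \<partial>\<pi>)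
      \<le> ennreal (measure m (cball x (\<epsilon> + t * (R + \<epsilon>))) powr (1 / N))"
    by (rule CD_brunn_minkowski[OF CD(1) less_imp_le[OF CD(2)] t balls(1-6) L balls(7) \<open>0 < \<epsilon>\<close>])
  interpret prob_space \<pi> by fact
  have "ennreal (t * measure m (ball x R) powr (1 / N)) = (\<integral>\<^sup>+y. ennreal t * ennreal (measure m (ball x R) powr (1 / N)) \<partial>\<pi>)"
    using t by (simp add: emeasure_space_1 ennreal_mult)
  also have "\<dots> \<le> (\<integral>\<^sup>+y. tau K N (1 - t) (dist (fst y) (snd y)) * ennreal (measure m (ball x \<epsilon>) powr (1 / N))
            + tau K N t (dist (fst y) (snd y)) * ennreal (measure m (ball x R) powr (1 / N)) \<partial>\<pi>)"
    using tau_ge[OF CD(3,2) t] by (intro nn_integral_mono add_increasing mult_right_mono) auto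
  also note le
  finally have "t * measure m (ball x R) powr (1 / N) \<le> measure m (cball x (\<epsilon> + t * (R + \<epsilon>))) powr (1 / N)"
    by simp
  then have "(t * measure m (ball x R) powr (1 / N)) powr N \<le> (measure m (cball x (\<epsilon> + t * (R + \<epsilon>))) powr (1 / N)) powr N"
    using t CD(2) by (intro powr_mono2) auto
  then show ?thesis using t CD(2) by (simp add: powr_mult powr_powr)
qed

text \<open>As \<epsilon> decreases to 0, the closed balls of the preceding estimate decrease to the
  closed ball of radius t R; they have finite measure, so continuity from above applies.\<close>

lemma CD_cball_scaling:
  assumes CD: "CD m K N" "1 < N" "0 \<le> K" and t: "0 < t" "t < 1" and "0 < R"
  shows "t powr N * measure m (ball x R) \<le> measure m (cball x (t * R))"
proof -
  define A where "A i = cball x (inverse (Suc i) + t * (R + inverse (Suc i)))" for i :: nat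
  have "decseq A"
    unfolding A_def using t by (intro antimonoI subset_cball add_mono mult_left_mono) (auto simp: field_simps)
  moreover have "range A \<subseteq> sets m" "\<And>i. emeasure m (A i) \<noteq> \<infinity>"
    using emeasure_bounded_finite[OF bounded_cball] by (auto simp: A_def less_top[symmetric])
  ultimately have "(\<lambda>i. measure m (A i)) \<longlonglongrightarrow> measure m (\<Inter>i. A i)" by (intro Lim_measure_decseq)
  moreover have "(\<Inter>i. A i) = cball x (t * R)"
  proof safe
    fix z assume "z \<in> (\<Inter>i. A i)"
    then have le: "dist x z \<le> inverse (Suc i) + t * (R + inverse (Suc i))" for i by (auto simp: A_def)
    have "(\<lambda>i. inverse (Suc i) + t * (R + inverse (Suc i))) \<longlonglongrightarrow> 0 + t * (R + 0)"
      by (intro tendsto_intros LIMSEQ_inverse_real_of_nat)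
    then have "dist x z \<le> 0 + t * (R + 0)" by (rule LIMSEQ_le_const) (use le in auto)
    then show "z \<in> cball x (t * R)" by simp
  next
    fix z i assume "z \<in> cball x (t * R)"
    moreover have "0 \<le> inverse (real (Suc i))" "0 \<le> t * inverse (real (Suc i))" using t by auto
    ultimately have "dist x z \<le> inverse (real (Suc i)) + t * (R + inverse (real (Suc i)))"
      by (simp only: mem_cball distrib_left)
    then show "z \<in> A i" by (simp add: A_def)
  qed
  ultimately have "(\<lambda>i. measure m (A i)) \<longlonglongrightarrow> measure m (cball x (t * R))" by simp
  then show ?thesis
    by (rule LIMSEQ_le_const) (use CD_ball_scaling_eps[OF CD t \<open>0 < R\<close>] in \<open>auto simp: A_def\<close>)
qed

text \<open>The scaling estimate has a closed ball on its larger side. It is used at radii s < r,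
  where the closed ball lies inside \<open>ball x r\<close>, and s then tends to r from the
  left.\<close>

lemma bishop_gromov:
  assumes CD: "CD m K N" "1 < N" "0 \<le> K" and r: "0 < r" "r \<le> R"
  shows "measure m (ball x R) / R powr N \<le> measure m (ball x r) / r powr N"
proof (cases "r = R")
  case False
  have "0 < R" using r by simp
  have "((\<lambda>s. s powr N * (measure m (ball x R) / R powr N)) \<longlongrightarrow> r powr N * (measure m (ball x R) / R powr N)) (at_left r)"
    using r by (intro tendsto_intros) auto
  moreover have "\<forall>\<^sub>F s in at_left r. s powr N * (measure m (ball x R) / R powr N) \<le> measure m (ball x r)"
    unfolding eventually_at_left_field
  proof (intro exI conjI allI impI)
    fix s assume s: "0 < s" "s < r"
    have "(s / R) powr N * measure m (ball x R) \<le> measure m (cball x (s / R * R))"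
      using s r by (intro CD_cball_scaling[OF CD]) (auto simp: field_simps)
    also have "\<dots> \<le> measure m (ball x r)"
      using s \<open>0 < R\<close> by (intro measure_mono_bounded) auto
    finally show "s powr N * (measure m (ball x R) / R powr N) \<le> measure m (ball x r)"
      using s \<open>0 < R\<close> by (simp add: powr_divide)
  qed (use r in auto)
  ultimately have "r powr N * (measure m (ball x R) / R powr N) \<le> measure m (ball x r)"
    by (intro tendsto_upperbound[where F = "at_left r"]) auto
  then show ?thesis using r by (simp add: field_simps)
qed simp

text \<open>If d(x, y) exceeded the critical length by 2 e, then the balls of radius e about x and y
  would still have mutual distances at least that length. The distortion coefficient would be
  infinite on the whole coupling, and the Brunn-Minkowski inequality would bound \<infinity> by a
  finite volume. Boundedness and properness give compactness.\<close>

lemma bonnet_myers: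
  assumes CD: "CD m K N" "1 < N" and "0 < K"
  shows "compact (UNIV :: 'a set)"
proof -
  define L where "L = pi * sqrt ((N - 1) / K)"
  have "0 < L" using assms by (simp add: L_def)
  obtain x :: 'a where True by simp
  have "dist x y \<le> L" for y
  proof (rule ccontr)
    assume far: "\<not> dist x y \<le> L"
    define e where "e = (dist x y - L) / 2"
    have e: "0 < e" "L = dist x y - 2 * e" using far by (auto simp: e_def field_simps)
    have up: "dist y0 y1 \<le> dist x y + 2 * e" and lo: "L \<le> dist y0 y1"
      if "y0 \<in> ball x e" "y1 \<in> ball y e" for y0 y1
      using that e(2) unfolding mem_ball by metric+
    have balls: "ball x e \<in> sets borel" "0 < emeasure m (ball x e)" "ball x e \<subseteq> cball x e"
      "ball y e \<in> sets borel" "0 < emeasure m (ball y e)" "bounded (ball y e)" "0 \<le> dist x y + 2 * e"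
      using emeasure_ball_pos e by auto
    have half: "0 < (1 / 2 :: real)" "1 / 2 < (1 :: real)" by auto
    obtain \<pi> where "\<pi> \<in> couplings (uniform_measure m (ball x e)) (uniform_measure m (ball y e))" and "prob_space \<pi>"
      and conc: "AE z in \<pi>. fst z \<in> ball x e \<and> snd z \<in> ball y e" and
      le: "(\<integral>\<^sup>+z. tau K N (1 - 1 / 2) (dist (fst z) (snd z)) * ennreal (measure m (ball x e) powr (1 / N))
              + tau K N (1 / 2) (dist (fst z) (snd z)) * ennreal (measure m (ball y e) powr (1 / N)) \<partial>\<pi>)
        \<le> ennreal (measure m (cball x (e + 1 / 2 * (dist x y + 2 * e))) powr (1 / N))"
      by (rule CD_brunn_minkowski[OF CD(1) less_imp_le[OF CD(2)] half balls(1-6) up balls(7) e(1)])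
    interpret prob_space \<pi> by fact
    have "(\<integral>\<^sup>+z. \<infinity> \<partial>\<pi>) \<le> (\<integral>\<^sup>+z. tau K N (1 - 1 / 2) (dist (fst z) (snd z)) * ennreal (measure m (ball x e) powr (1 / N))
              + tau K N (1 / 2) (dist (fst z) (snd z)) * ennreal (measure m (ball y e) powr (1 / N)) \<partial>\<pi>)"
    proof (rule nn_integral_mono_AE, use conc in eventually_elim)
      case (elim z)
      have "tau K N (1 / 2) (dist (fst z) (snd z)) = \<infinity>"
        using lo elim by (intro tau_infinite \<open>0 < K\<close> CD(2)) (auto simp: L_def)
      then show ?case using measure_ball_pos[OF e(1), of y] by (simp add: ennreal_top_mult)
    qed
    also note le
    finally show False by (simp add: emeasure_space_1 top_unique)
  qed
  then have "bounded (UNIV :: 'a set)" unfolding bounded_def by blast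
  then show ?thesis by (intro proper) auto
qed

end

section \<open>Radial functions\<close>

text \<open>A bound on the pointwise Lipschitz constant at \<open>r\<close>, tested on nonnegative
  arguments only because the profile is evaluated at distances. In contrast to a derivative it
  tolerates corners, which truncated profiles have.\<close>

definition slope_le :: "(real \<Rightarrow> real) \<Rightarrow> real \<Rightarrow> real \<Rightarrow> bool" where
  "slope_le g r b \<longleftrightarrow> (\<forall>e>0. \<exists>d>0. \<forall>s\<ge>0. \<bar>s - r\<bar> < d \<longrightarrow> \<bar>g s - g r\<bar> \<le> (b + e) * \<bar>s - r\<bar>)"

lemma slope_le_deriv:
  assumes "(f has_real_derivative D) (at r within {0..})"
  shows "slope_le f r \<bar>D\<bar>"
  unfolding slope_le_def
proof (intro allI impI)
  fix e :: real assume "0 < e"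
  have "(f has_derivative (\<lambda>h. D * h)) (at r within {0..})"
    using assms by (simp add: has_field_derivative_def)
  then obtain d where d: "0 < d"
    "\<forall>s\<in>{0..}. norm (s - r) < d \<longrightarrow> norm (f s - f r - D * (s - r)) \<le> e * norm (s - r)"
    unfolding has_derivative_within_alt using \<open>0 < e\<close> by blast
  show "\<exists>d>0. \<forall>s\<ge>0. \<bar>s - r\<bar> < d \<longrightarrow> \<bar>f s - f r\<bar> \<le> (\<bar>D\<bar> + e) * \<bar>s - r\<bar>"
  proof (intro exI conjI allI impI)
    fix s :: real assume "0 \<le> s" "\<bar>s - r\<bar> < d"
    then have "\<bar>f s - f r - D * (s - r)\<bar> \<le> e * \<bar>s - r\<bar>" using d(2) by simp
    moreover have "\<bar>D * (s - r)\<bar> = \<bar>D\<bar> * \<bar>s - r\<bar>" by (rule abs_mult)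
    ultimately show "\<bar>f s - f r\<bar> \<le> (\<bar>D\<bar> + e) * \<bar>s - r\<bar>" by (simp add: distrib_right)
  qed (rule d(1))
qed

text \<open>Intended for truncations \<open>max 0 (f r - f T)\<close>, which never increase
  differences.\<close>

lemma slope_le_contraction:
  assumes "slope_le f r b" and "\<And>s. \<bar>g s - g r\<bar> \<le> \<bar>f s - f r\<bar>"
  shows "slope_le g r b"
  using assms unfolding slope_le_def by (meson order_trans)

lemma slope_le_locally_constant:
  assumes "0 < d" "\<And>s. \<bar>s - r\<bar> < d \<Longrightarrow> g s = g r"
  shows "slope_le g r 0"
  using assms unfolding slope_le_def by (metis abs_zero cancel_comm_monoid_add_class.diff_cancel abs_ge_zero add_0 less_imp_le mult_nonneg_nonneg)

lemma slope_le_lipschitz: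
  assumes "L-lipschitz_on {0..} g" "0 \<le> r"
  shows "slope_le g r L"
  unfolding slope_le_def
proof (intro allI impI exI conjI)
  fix e s :: real assume "0 < e" "0 \<le> s"
  have "\<bar>g s - g r\<bar> \<le> L * \<bar>s - r\<bar>"
    using lipschitz_onD[OF assms(1), of s r] \<open>0 \<le> s\<close> \<open>0 \<le> r\<close> by (simp add: dist_real_def)
  also have "\<dots> \<le> (L + e) * \<bar>s - r\<bar>" using \<open>0 < e\<close> by (intro mult_right_mono) auto
  finally show "\<bar>g s - g r\<bar> \<le> (L + e) * \<bar>s - r\<bar>" .
qed (rule zero_less_one)

lemma abs_dist_diff_le: "\<bar>dist z y - dist z x\<bar> \<le> dist x y" for x y z :: "'a::metric_space"
  by metric

text \<open>The distance to a point is 1-Lipschitz, so the chain rule survives as an inequality; the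
  dilation contributes the factor 1/R.\<close>

lemma local_lip_radial_le:
  fixes x0 x :: "'a::metric_space"
  assumes sl: "slope_le g (dist x0 x / R) b" and "0 \<le> b" and R: "0 < R"
  shows "local_lip (\<lambda>y. g (dist x0 y / R)) x \<le> b / R"
proof (rule field_le_epsilon)
  fix e' :: real assume "0 < e'"
  define e where "e = e' * R"
  have "0 < e" using \<open>0 < e'\<close> R by (simp add: e_def)
  then obtain d where d: "0 < d"
    "\<And>s. 0 \<le> s \<Longrightarrow> \<bar>s - dist x0 x / R\<bar> < d \<Longrightarrow> \<bar>g s - g (dist x0 x / R)\<bar> \<le> (b + e) * \<bar>s - dist x0 x / R\<bar>"
    using sl unfolding slope_le_def by metis
  have "\<forall>\<^sub>F y in at x. ennreal (\<bar>g (dist x0 y / R) - g (dist x0 x / R)\<bar> / dist x y) \<le> ennreal ((b + e) / R)"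
    unfolding eventually_at
  proof (intro exI conjI ballI impI)
    show "0 < d * R" using d R by simp
    fix y assume y: "y \<noteq> x \<and> dist y x < d * R"
    then have pos: "0 < dist x y" by auto
    have le: "\<bar>dist x0 y / R - dist x0 x / R\<bar> \<le> dist x y / R"
      using abs_dist_diff_le[of x0 y x] R by (simp add: diff_divide_distrib[symmetric] divide_right_mono)
    also have "\<dots> < d" using y R by (simp add: dist_commute field_simps)
    finally have "\<bar>g (dist x0 y / R) - g (dist x0 x / R)\<bar> \<le> (b + e) * \<bar>dist x0 y / R - dist x0 x / R\<bar>"
      using R by (intro d(2)) auto
    also have "\<dots> \<le> (b + e) * (dist x y / R)"
      using le \<open>0 \<le> b\<close> \<open>0 < e\<close> by (intro mult_left_mono) auto
    finally show "ennreal (\<bar>g (dist x0 y / R) - g (dist x0 x / R)\<bar> / dist x y) \<le> ennreal ((b + e) / R)"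
      using pos by (intro ennreal_leI) (simp add: field_simps)
  qed
  then have "Limsup (at x) (\<lambda>y. ennreal (\<bar>g (dist x0 y / R) - g (dist x0 x / R)\<bar> / dist x y)) \<le> ennreal ((b + e) / R)"
    by (rule Limsup_bounded)
  then have "local_lip (\<lambda>y. g (dist x0 y / R)) x \<le> (b + e) / R"
    unfolding local_lip_def using \<open>0 \<le> b\<close> \<open>0 < e\<close> R by (intro enn2real_leI) auto
  also have "\<dots> = b / R + e'" using R by (simp add: e_def field_simps)
  finally show "local_lip (\<lambda>y. g (dist x0 y / R)) x \<le> b / R + e'" .
qed

lemma local_lip_const: "local_lip (\<lambda>y. c) x = 0"
proof -
  have "Limsup (at x) (\<lambda>y. 0::ennreal) \<le> 0" by (rule Limsup_bounded) simp
  then show ?thesis by (simp add: local_lip_def)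
qed

context proper_mms
begin

lemma radial_Lip0:
  fixes x0 :: 'a
  assumes L: "L-lipschitz_on {0..} g" and z: "\<And>r. T \<le> r \<Longrightarrow> g r = 0" and R: "0 < R"
  shows "(\<lambda>y. g (dist x0 y / R)) \<in> Lip0"
proof -
  have "0 \<le> L" by (rule lipschitz_on_nonneg[OF L])
  have "(L / R)-lipschitz_on UNIV (\<lambda>y. g (dist x0 y / R))"
  proof (rule lipschitz_onI)
    fix x y
    have "dist (g (dist x0 x / R)) (g (dist x0 y / R)) \<le> L * dist (dist x0 x / R) (dist x0 y / R)"
      using R by (intro lipschitz_onD[OF L]) auto
    also have "\<dots> = L * (\<bar>dist x0 x - dist x0 y\<bar> / R)"
      using R by (simp add: dist_real_def diff_divide_distrib[symmetric])
    also have "\<dots> \<le> L * (dist x y / R)"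
      using R \<open>0 \<le> L\<close> abs_dist_diff_le[of x0 x y] by (intro mult_left_mono divide_right_mono) (auto simp: dist_commute)
    finally show "dist (g (dist x0 x / R)) (g (dist x0 y / R)) \<le> L / R * dist x y" by simp
  qed (use R \<open>0 \<le> L\<close> in auto)
  moreover have "{x. g (dist x0 x / R) \<noteq> 0} \<subseteq> cball x0 (T * R)"
  proof
    fix x assume "x \<in> {x. g (dist x0 x / R) \<noteq> 0}"
    then have "\<not> T \<le> dist x0 x / R" using z by auto
    then show "x \<in> cball x0 (T * R)" using R by (simp add: field_simps)
  qed
  then have "bounded {x. g (dist x0 x / R) \<noteq> 0}" using bounded_cball bounded_subset by blast
  then have "compact (closure {x. g (dist x0 x / R) \<noteq> 0})" by (intro proper) auto
  ultimately show ?thesis by (auto simp: Lip0_def)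
qed

lemma radial_measurable:
  assumes [measurable]: "\<phi> \<in> borel_measurable borel"
  shows "(\<lambda>x. \<phi> (dist x0 x / R)) \<in> borel_measurable m"
  by measurable

lemma radial_integrable:
  fixes \<phi> :: "real \<Rightarrow> real"
  assumes [measurable]: "\<phi> \<in> borel_measurable borel" and bd: "\<And>r. \<bar>\<phi> r\<bar> \<le> c" and z: "\<And>r. T \<le> r \<Longrightarrow> \<phi> r = 0"
    and R: "0 < R"
  shows "integrable m (\<lambda>x. \<phi> (dist x0 x / R))"
proof (rule Bochner_Integration.integrable_bound)
  show "integrable m (\<lambda>x. c * indicator (ball x0 (T * R)) x :: real)"
    using emeasure_bounded_finite[OF bounded_ball] by (intro integrable_mult_right integrable_real_indicator) auto
  have "\<bar>\<phi> (dist x0 x / R)\<bar> \<le> c * indicator (ball x0 (T * R)) x" for x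
    using bd[of "dist x0 x / R"] z[of "dist x0 x / R"] R by (auto simp: indicator_def field_simps)
  then show "AE x in m. norm (\<phi> (dist x0 x / R)) \<le> norm (c * indicator (ball x0 (T * R)) x)"
    by (intro AE_I2) (metis abs_ge_self order_trans real_norm_def)
qed (rule radial_measurable, fact)

lemma Lnorm_powr_int: "Lnorm m q u powr q' = (\<integral>x. \<bar>u x\<bar> powr q \<partial>m) powr (q' / q)"
  by (simp add: Lnorm_def powr_powr)

text \<open>By the scaling relation between the exponents all powers of \<open>R\<close> cancel.\<close>

lemma scaled_radial_inequality:
  fixes n :: nat and g h :: "real \<Rightarrow> real"
  assumes ineq: "\<And>u. u \<in> Lip0 \<Longrightarrow> Lnorm m s u \<le> C * Lnorm m p (local_lip u) powr \<theta> * Lnorm m s' u powr (1 - \<theta>)"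
    and pos: "0 < s" "0 < p" "0 < s'" "0 \<le> \<theta>" "0 \<le> C"
    and scale: "1 / s = \<theta> * (1 / p - 1 / n) + (1 - \<theta>) / s'" and "0 < n"
    and g: "L-lipschitz_on {0..} g" "\<And>r. 0 \<le> g r" "\<And>r. T \<le> r \<Longrightarrow> g r = 0"
    and h: "\<And>r. 0 \<le> r \<Longrightarrow> slope_le g r (h r)" "\<And>r. 0 \<le> h r" "\<And>r. h r \<le> c" "\<And>r. T \<le> r \<Longrightarrow> h r = 0"
    and [measurable]: "h \<in> borel_measurable borel"
    and R: "0 < R"
  shows "((\<integral>x. g (dist x0 x / R) powr s \<partial>m) / R ^ n) powr (1 / s) \<le>
    C * ((\<integral>x. h (dist x0 x / R) powr p \<partial>m) / R ^ n) powr (\<theta> / p) * ((\<integral>x. g (dist x0 x / R) powr s' \<partial>m) / R ^ n) powr ((1 - \<theta>) / s')"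
proof -
  define u where "u = (\<lambda>y. g (dist x0 y / R))"
  have u: "u \<in> Lip0" unfolding u_def by (rule radial_Lip0[OF g(1,3) R])
  define Is where "Is = (\<integral>x. g (dist x0 x / R) powr s \<partial>m)"
  define It where "It = (\<integral>x. g (dist x0 x / R) powr s' \<partial>m)"
  define Ih where "Ih = (\<integral>x. h (dist x0 x / R) powr p \<partial>m)"
  have nn: "0 \<le> Is" "0 \<le> It" "0 \<le> Ih" by (auto simp: Is_def It_def Ih_def)
  have int: "integrable m (\<lambda>x. h (dist x0 x / R) powr p)"
    by (rule radial_integrable[where c = "c powr p" and T = T])
      (use h R pos in \<open>auto intro!: powr_mono2\<close>)
  \<comment> \<open>\<open>integral_mono'\<close> asks for integrability of the dominating side; a
    left-hand integrand that failed to be integrable would have integral 0.\<close>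
  have "(\<integral>x. \<bar>local_lip u x\<bar> powr p \<partial>m) \<le> (\<integral>x. R powr (- p) * h (dist x0 x / R) powr p \<partial>m)"
  proof (rule integral_mono')
    fix x
    have "local_lip u x \<le> h (dist x0 x / R) / R"
      unfolding u_def using h R by (intro local_lip_radial_le) auto
    moreover have "0 \<le> local_lip u x" by (simp add: local_lip_def)
    ultimately have "\<bar>local_lip u x\<bar> powr p \<le> (h (dist x0 x / R) / R) powr p"
      using pos by (intro powr_mono2) auto
    then show "\<bar>local_lip u x\<bar> powr p \<le> R powr (- p) * h (dist x0 x / R) powr p"
      using R h(2) by (simp add: powr_divide powr_minus field_simps)
  qed (use int in auto)
  then have "(\<integral>x. \<bar>local_lip u x\<bar> powr p \<partial>m) \<le> R powr (- p) * Ih" by (simp add: Ih_def)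
  then have "Lnorm m p (local_lip u) powr \<theta> \<le> (R powr (- p) * Ih) powr (\<theta> / p)"
    unfolding Lnorm_powr_int using pos by (intro powr_mono2) auto
  then have grad: "Lnorm m p (local_lip u) powr \<theta> \<le> R powr (- \<theta>) * Ih powr (\<theta> / p)"
    using R nn pos by (simp add: powr_mult powr_powr)
  have "Is powr (1 / s) = Lnorm m s u" by (simp add: Lnorm_def u_def Is_def g(2))
  also have "\<dots> \<le> C * Lnorm m p (local_lip u) powr \<theta> * Lnorm m s' u powr (1 - \<theta>)" by (rule ineq[OF u])
  also have "\<dots> \<le> C * (R powr (- \<theta>) * Ih powr (\<theta> / p)) * Lnorm m s' u powr (1 - \<theta>)"
    using grad pos by (intro mult_right_mono mult_left_mono) auto
  also have "Lnorm m s' u powr (1 - \<theta>) = It powr ((1 - \<theta>) / s')"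
    unfolding Lnorm_powr_int by (simp add: u_def It_def g(2))
  finally have main: "Is powr (1 / s) \<le> C * (R powr (- \<theta>) * Ih powr (\<theta> / p)) * It powr ((1 - \<theta>) / s')" .
  have Rn: "R ^ n = R powr n" using R by (simp add: powr_realpow)
  have dv: "(I / R ^ n) powr b = I powr b * R powr (- (n * b))" if "0 \<le> I" for I b :: real
    using that R by (simp add: Rn powr_divide powr_powr powr_minus field_simps)
  have "(Is / R ^ n) powr (1 / s) = Is powr (1 / s) * R powr (- (n * (1 / s)))"
    by (rule dv[OF nn(1)])
  also have "\<dots> \<le> C * (R powr (- \<theta>) * Ih powr (\<theta> / p)) * It powr ((1 - \<theta>) / s') * R powr (- (n * (1 / s)))"
    using main by (intro mult_right_mono) auto
  also have "\<dots> = C * Ih powr (\<theta> / p) * It powr ((1 - \<theta>) / s') * (R powr (- \<theta>) * R powr (- (n * (1 / s))))"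
    by (simp add: mult_ac)
  also have "R powr (- \<theta>) * R powr (- (n * (1 / s))) = R powr (- (n * (\<theta> / p))) * R powr (- (n * ((1 - \<theta>) / s')))"
  proof -
    have "n * (\<theta> * (1 / p - 1 / n)) = n * (\<theta> / p) - \<theta>" using \<open>0 < n\<close> by (simp add: field_simps)
    then have "- \<theta> + - (n * (1 / s)) = - (n * (\<theta> / p)) + - (n * ((1 - \<theta>) / s'))"
      unfolding scale by (simp only: distrib_left)
    then show ?thesis unfolding powr_add[symmetric] by simp
  qed
  also have "C * Ih powr (\<theta> / p) * It powr ((1 - \<theta>) / s') * \<dots>
     = C * (Ih powr (\<theta> / p) * R powr (- (n * (\<theta> / p)))) * (It powr ((1 - \<theta>) / s') * R powr (- (n * ((1 - \<theta>) / s'))))"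
    by (simp add: mult_ac)
  also have "\<dots> = C * (Ih / R ^ n) powr (\<theta> / p) * (It / R ^ n) powr ((1 - \<theta>) / s')"
    by (simp only: dv[OF nn(2)] dv[OF nn(3)])
  finally show ?thesis by (simp only: Is_def It_def Ih_def)
qed

end

section \<open>Asymptotics of radial integrals\<close>

text \<open>The law of the radius of a point that is uniform in an \<open>n\<close>-dimensional ball of radius \<open>T\<close>.\<close>

definition radial_law :: "nat \<Rightarrow> real \<Rightarrow> real measure" where
  "radial_law n T = density lborel (\<lambda>r. ennreal (n * r ^ (n - 1) / T ^ n * indicator {0..T} r))"

lemma sets_radial_law[simp, measurable_cong]: "sets (radial_law n T) = sets borel"
  by (simp add: radial_law_def)

lemma space_radial_law[simp]: "space (radial_law n T) = UNIV"
  by (simp add: radial_law_def)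

lemma emeasure_radial_law_atMost:
  assumes "0 \<le> r" "r \<le> T" "0 < T" "0 < n"
  shows "emeasure (radial_law n T) {..r} = ennreal ((r / T) ^ n)"
proof -
  have "emeasure (radial_law n T) {..r} = (\<integral>\<^sup>+x. ennreal (n * x ^ (n - 1) / T ^ n * indicator {0..T} x) * indicator {..r} x \<partial>lborel)"
    unfolding radial_law_def by (subst emeasure_density) auto
  also have "\<dots> = (\<integral>\<^sup>+x. ennreal (n * x ^ (n - 1) / T ^ n) * indicator {0..r} x \<partial>lborel)"
    using assms by (intro nn_integral_cong) (auto simp: indicator_def)
  also have "\<dots> = ennreal (r ^ n / T ^ n - 0 ^ n / T ^ n)"
    using assms by (intro nn_integral_FTC_Icc) (auto intro!: derivative_eq_intros)
  finally show ?thesis using assms by (simp add: power_divide zero_power)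
qed

lemma real_distribution_radial_law:
  assumes "0 < T" "0 < n"
  shows "real_distribution (radial_law n T)"
proof -
  have "emeasure (radial_law n T) UNIV = emeasure (radial_law n T) {..T}"
    unfolding radial_law_def by (subst (1 2) emeasure_density) (auto intro!: nn_integral_cong simp: indicator_def)
  also have "\<dots> = 1" using assms by (subst emeasure_radial_law_atMost) auto
  finally have "prob_space (radial_law n T)" by (intro prob_spaceI) simp
  then show ?thesis by (simp add: real_distribution_def real_distribution_axioms_def)
qed

text \<open>The set on which a test profile is allowed to be discontinuous: nonpositive radii have
  density 0 almost everywhere, and a finite set is Lebesgue-null.\<close>

lemma null_radial_law:
  assumes "finite D"
  shows "emeasure (radial_law n T) ({..0} \<union> D) = 0"
proof -
  have D[measurable]: "D \<in> sets borel" using assms by (simp add: finite_imp_closed borel_closed)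
  have "AE r in lborel. r \<noteq> (0::real)" by (rule AE_lborel_singleton)
  moreover have "AE r in lborel. r \<notin> D" using AE_not_in[OF finite_imp_null_set_lborel[OF assms]] .
  ultimately have "AE r in lborel. ennreal (n * r ^ (n - 1) / T ^ n * indicator {0..T} r) * indicator ({..0} \<union> D) r = 0"
    by eventually_elim (auto simp: indicator_def)
  then show ?thesis unfolding radial_law_def
    by (subst emeasure_density) (auto simp: nn_integral_0_iff_AE)
qed

lemma cdf_radial_law:
  assumes "0 < T" "0 < n"
  shows "cdf (radial_law n T) r = (if r < 0 then 0 else if r \<le> T then (r / T) ^ n else 1)"
proof -
  interpret real_distribution "radial_law n T" by (rule real_distribution_radial_law[OF assms])
  consider "r < 0" | "0 \<le> r" "r \<le> T" | "T < r" by linarith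
  then show ?thesis
  proof cases
    case 1
    have "cdf (radial_law n T) r \<le> cdf (radial_law n T) 0" using 1 by (intro cdf_nondecreasing) auto
    also have "\<dots> = 0" using assms emeasure_radial_law_atMost[of 0 T n] by (simp add: cdf_def2 measure_def zero_power)
    finally show ?thesis using 1 cdf_nonneg[of r] by simp
  next
    case 2
    then show ?thesis using assms emeasure_radial_law_atMost[of r T n] by (simp add: cdf_def2 measure_def)
  next
    case 3
    have "1 = cdf (radial_law n T) T" using assms emeasure_radial_law_atMost[of T T n] by (simp add: cdf_def2 measure_def)
    also have "\<dots> \<le> cdf (radial_law n T) r" using 3 by (intro cdf_nondecreasing) auto
    finally show ?thesis using 3 assms cdf_bounded_prob[of r] by simp
  qed
qed

lemma integral_radial_law:
  fixes \<phi> :: "real \<Rightarrow> real"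
  assumes [measurable]: "\<phi> \<in> borel_measurable borel" and "0 < T" "\<And>r. T \<le> r \<Longrightarrow> \<phi> r = 0"
  shows "(\<integral>r. \<phi> r \<partial>radial_law n T) = n / T ^ n * (\<integral>r. indicator {0<..} r * (\<phi> r * r ^ (n - 1)) \<partial>lborel)"
proof -
  have nn: "0 \<le> n * r ^ (n - 1) / T ^ n * indicator {0..T} r" for r :: real
  proof (cases "r \<in> {0..T}")
    case True
    then have "0 \<le> r" by simp
    then show ?thesis using less_imp_le[OF \<open>0 < T\<close>]
      by (intro mult_nonneg_nonneg divide_nonneg_nonneg zero_le_power indicator_pos_le of_nat_0_le_iff)
  qed simp
  have "(\<integral>r. \<phi> r \<partial>radial_law n T) = (\<integral>r. (n * r ^ (n - 1) / T ^ n * indicator {0..T} r) *\<^sub>R \<phi> r \<partial>lborel)"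
    unfolding radial_law_def
  proof (rule integral_density)
    show "AE r in lborel. 0 \<le> n * r ^ (n - 1) / T ^ n * indicator {0..T} r" using nn by (intro AE_I2)
  qed measurable
  also have "\<dots> = (\<integral>r. n / T ^ n * (indicator {0<..} r * (\<phi> r * r ^ (n - 1))) \<partial>lborel)"
  proof (rule integral_cong_AE)
    have "AE r in lborel. r \<noteq> (0::real)" by (rule AE_lborel_singleton)
    then show "AE r in lborel. (n * r ^ (n - 1) / T ^ n * indicator {0..T} r) *\<^sub>R \<phi> r = n / T ^ n * (indicator {0<..} r * (\<phi> r * r ^ (n - 1)))"
    proof eventually_elim
      case (elim r)
      then consider "r < 0" | "0 < r" "r \<le> T" | "T < r" by linarith
      then show ?case by cases (use assms in auto)
    qed
  qed measurable
  finally show ?thesis by simp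
qed

section \<open>Weak convergence of rescaled distances\<close>

context proper_mms
begin

text \<open>A closed ball of radius s lies in the open ball of radius s + 1, and ((s + 1)/s)^n tends
  to 1. Closed balls are the ones that appear in distribution functions.\<close>

lemma cball_growth:
  fixes n :: nat
  assumes lim: "((\<lambda>s. measure m (ball x s) / s ^ n) \<longlongrightarrow> a) at_top"
  shows "((\<lambda>s. measure m (cball x s) / s ^ n) \<longlongrightarrow> a) at_top"
proof (rule tendsto_sandwich[OF _ _ lim])
  show "\<forall>\<^sub>F s in at_top. measure m (ball x s) / s ^ n \<le> measure m (cball x s) / s ^ n"
    using eventually_gt_at_top[of 0]
    by eventually_elim (intro divide_right_mono measure_mono_bounded, auto)
  show "\<forall>\<^sub>F s in at_top. measure m (cball x s) / s ^ n \<le> measure m (ball x (s + 1)) / (s + 1) ^ n * ((s + 1) / s) ^ n"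
    using eventually_gt_at_top[of 0]
  proof eventually_elim
    case (elim s)
    have "measure m (cball x s) \<le> measure m (ball x (s + 1))" by (intro measure_mono_bounded) auto
    moreover have "measure m (ball x (s + 1)) / (s + 1) ^ n * ((s + 1) / s) ^ n = measure m (ball x (s + 1)) / s ^ n"
      using elim by (simp add: power_divide)
    ultimately show ?case using elim by (simp add: divide_right_mono)
  qed
  have "filterlim (\<lambda>s::real. s + 1) at_top at_top"
    by (rule filterlim_at_top_mono[OF filterlim_ident]) auto
  from filterlim_compose[OF lim this]
  have "((\<lambda>s. measure m (ball x (s + 1)) / (s + 1) ^ n) \<longlongrightarrow> a) at_top" .
  moreover have "((\<lambda>s::real. (s + 1) / s) \<longlongrightarrow> 1) at_top"
  proof (rule Lim_transform_eventually)
    show "((\<lambda>s::real. 1 + inverse s) \<longlongrightarrow> 1) at_top"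
      using tendsto_add[OF tendsto_const tendsto_inverse_0_at_top[OF filterlim_ident], of "1 :: real"] by simp
    show "\<forall>\<^sub>F s::real in at_top. 1 + inverse s = (s + 1) / s"
      using eventually_gt_at_top[of 0] by eventually_elim (simp add: field_simps)
  qed
  ultimately have "((\<lambda>s. measure m (ball x (s + 1)) / (s + 1) ^ n * ((s + 1) / s) ^ n) \<longlongrightarrow> a * 1 ^ n) at_top"
    by (intro tendsto_intros)
  then show "((\<lambda>s. measure m (ball x (s + 1)) / (s + 1) ^ n * ((s + 1) / s) ^ n) \<longlongrightarrow> a) at_top" by simp
qed

lemma scaled_cball_growth:
  fixes n :: nat
  assumes lim: "((\<lambda>s. measure m (ball x s) / s ^ n) \<longlongrightarrow> a) at_top" and "0 \<le> r" "0 < n"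
  shows "((\<lambda>R. measure m (cball x (r * R)) / R ^ n) \<longlongrightarrow> a * r ^ n) at_top"
proof (cases "r = 0")
  \<comment> \<open>Here the radius r R does not tend to infinity, so the growth hypothesis says
    nothing; instead a fixed finite mass is divided by R^n.\<close>
  case True
  have "filterlim (\<lambda>R::real. R ^ n) at_top at_top" using \<open>0 < n\<close> by (intro filterlim_pow_at_top filterlim_ident)
  then have "((\<lambda>R::real. inverse (R ^ n)) \<longlongrightarrow> 0) at_top" by (rule tendsto_inverse_0_at_top)
  then have "((\<lambda>R. measure m (cball x 0) * inverse (R ^ n)) \<longlongrightarrow> measure m (cball x 0) * 0) at_top"
    by (intro tendsto_mult tendsto_const)
  then show ?thesis using True \<open>0 < n\<close> by (simp add: divide_inverse zero_power)
next
  case False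
  then have r: "0 < r" using \<open>0 \<le> r\<close> by simp
  have "filterlim (\<lambda>R. r * R) at_top at_top"
    using r by (intro filterlim_tendsto_pos_mult_at_top[OF tendsto_const _ filterlim_ident])
  from filterlim_compose[OF cball_growth[OF lim] this]
  have "((\<lambda>R. measure m (cball x (r * R)) / (r * R) ^ n * r ^ n) \<longlongrightarrow> a * r ^ n) at_top"
    by (rule tendsto_mult) (rule tendsto_const)
  then show ?thesis using r by (simp add: power_mult_distrib)
qed

text \<open>Take a uniform random point of the ball of radius T R and divide its distance to x by R.
  The distribution function of this radius is a quotient of ball volumes, so volume growth alone
  yields weak convergence to \<open>radial_law n T\<close>. Bounded profiles that are continuous
  almost everywhere can then be integrated in the limit. Undoing the normalisation contributes
  m(B)/R^n, which tends to a T^n and cancels the T^n in the density of the limit law.\<close>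

lemma radial_integral_limit:
  fixes n :: nat and \<phi> :: "real \<Rightarrow> real"
  assumes lim: "((\<lambda>s. measure m (ball x s) / s ^ n) \<longlongrightarrow> a) at_top" and "0 < a" "0 < n"
    and \<phi>[measurable]: "\<phi> \<in> borel_measurable borel" and bd: "\<And>r. \<bar>\<phi> r\<bar> \<le> c"
    and T: "0 < T" "\<And>r. T \<le> r \<Longrightarrow> \<phi> r = 0"
    and D: "finite D" "\<And>r. 0 < r \<Longrightarrow> r \<notin> D \<Longrightarrow> isCont \<phi> r"
  shows "(\<lambda>i. (\<integral>y. \<phi> (dist x y / Suc i) \<partial>m) / real (Suc i) ^ n)
     \<longlonglongrightarrow> a * (n * (\<integral>r. indicator {0<..} r * (\<phi> r * r ^ (n - 1)) \<partial>lborel))"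
proof -
  define R where "R i = real (Suc i)" for i
  define B where "B i = ball x (T * R i)" for i
  define b where "b i = measure m (B i)" for i
  define \<mu> where "\<mu> i = distr (uniform_measure m (B i)) borel (\<lambda>y. dist x y / R i)" for i
  have R: "0 < R i" for i by (simp add: R_def)
  have Rlim: "filterlim R at_top sequentially"
    unfolding R_def using filterlim_compose[OF filterlim_real_sequentially filterlim_Suc] .
  have TR: "0 < T * R i" for i using T R by simp
  have b: "0 < b i" for i unfolding b_def B_def by (rule measure_ball_pos[OF TR])
  have eb: "emeasure m (B i) = ennreal (b i)" for i
    unfolding b_def B_def by (intro emeasure_eq_measure_bounded bounded_ball)
  have B[measurable]: "B i \<in> sets borel" for i by (simp add: B_def)
  have blim: "(\<lambda>i. b i / R i ^ n) \<longlonglongrightarrow> a * T ^ n"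
  proof -
    have "filterlim (\<lambda>i. T * R i) at_top sequentially"
      using T by (intro filterlim_tendsto_pos_mult_at_top[OF tendsto_const _ Rlim])
    from filterlim_compose[OF lim this]
    have "(\<lambda>i. measure m (ball x (T * R i)) / (T * R i) ^ n * T ^ n) \<longlonglongrightarrow> a * T ^ n"
      by (rule tendsto_mult) (rule tendsto_const)
    then show ?thesis using T by (simp add: power_mult_distrib b_def B_def)
  qed
  have ps: "prob_space (uniform_measure m (B i))" for i
    using b[of i] by (intro prob_space_uniform_measure) (auto simp: eb)
  have rd: "real_distribution (\<mu> i)" for i
    unfolding \<mu>_def by (intro prob_space.real_distribution_distr ps) measurable
  have rdr: "real_distribution (radial_law n T)" using T \<open>0 < n\<close> by (intro real_distribution_radial_law)
  have cdf\<mu>: "cdf (\<mu> i) r = (if r < 0 then 0 else if r < T then measure m (cball x (r * R i)) / b i else 1)" for i r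
  proof -
    have "cdf (\<mu> i) r = measure (uniform_measure m (B i)) {y. dist x y / R i \<le> r}"
      unfolding cdf_def2 \<mu>_def by (subst measure_distr) (auto simp: vimage_def)
    also have "\<dots> = measure m (B i \<inter> {y. dist x y / R i \<le> r}) / b i"
      using b[of i] by (subst measure_uniform_measure) (auto simp: eb b_def)
    also have "\<dots> = (if r < 0 then 0 else if r < T then measure m (cball x (r * R i)) / b i else 1)"
    proof -
      consider "r < 0" | "0 \<le> r" "r < T" | "T \<le> r" by linarith
      then show ?thesis
      proof cases
        case 1
        then have "B i \<inter> {y. dist x y / R i \<le> r} = {}"
          using R[of i] by (auto simp: field_simps) (metis mult_pos_neg not_less order_trans zero_le_dist less_le_trans not_le mult.commute)
        then show ?thesis using 1 by simp
      next
        case 2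
        have *: "r * R i < T * R i" using 2 R by (intro mult_strict_right_mono) auto
        have "B i \<inter> {y. dist x y / R i \<le> r} = cball x (r * R i)"
          by (auto simp: B_def pos_divide_le_eq[OF R] dest: le_less_trans[OF _ *])
        then show ?thesis using 2 by simp
      next
        case 3
        have *: "T * R i \<le> r * R i" using 3 R[of i] by (intro mult_right_mono) auto
        have "B i \<inter> {y. dist x y / R i \<le> r} = B i"
          by (auto simp: B_def pos_divide_le_eq[OF R] intro: order_trans[OF less_imp_le *])
        then show ?thesis using 3 T b[of i] by (simp add: b_def)
      qed
    qed
    finally show ?thesis .
  qed
  have weak: "weak_conv_m \<mu> (radial_law n T)"
    unfolding weak_conv_m_def weak_conv_def
  proof (intro allI impI)
    fix r
    consider "r < 0" | "0 \<le> r" "r < T" | "T \<le> r" by linarith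
    then show "(\<lambda>i. cdf (\<mu> i) r) \<longlonglongrightarrow> cdf (radial_law n T) r"
    proof cases
      case 2
      have "(\<lambda>i. (measure m (cball x (r * R i)) / R i ^ n) / (b i / R i ^ n)) \<longlonglongrightarrow> a * r ^ n / (a * T ^ n)"
        using T \<open>0 < a\<close> 2
        by (intro tendsto_divide blim filterlim_compose[OF scaled_cball_growth[OF lim _ \<open>0 < n\<close>] Rlim]) auto
      moreover have "(measure m (cball x (r * R i)) / R i ^ n) / (b i / R i ^ n) = cdf (\<mu> i) r" for i
        using 2 R[of i] by (simp add: cdf\<mu>)
      ultimately show ?thesis using 2 \<open>0 < a\<close> T \<open>0 < n\<close> by (simp add: cdf_radial_law power_divide)
    qed (use T \<open>0 < n\<close> in \<open>auto simp: cdf\<mu> cdf_radial_law\<close>)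
  qed
  \<comment> \<open>Nonpositive radii are simply counted among the possible discontinuities, so
    continuity has to be known for r > 0 only.\<close>
  have "{r. \<not> isCont \<phi> r} \<subseteq> {..0} \<union> D" using D(2) by (auto simp: not_less[symmetric])
  then have "emeasure (radial_law n T) {r. \<not> isCont \<phi> r} \<le> emeasure (radial_law n T) ({..0} \<union> D)"
    using D(1) by (intro emeasure_mono) (auto simp: finite_imp_closed borel_closed)
  then have disc: "emeasure (radial_law n T) {r. \<not> isCont \<phi> r} = 0"
    using null_radial_law[OF D(1)] by simp
  have "(\<lambda>i. \<integral>r. \<phi> r \<partial>\<mu> i) \<longlonglongrightarrow> (\<integral>r. \<phi> r \<partial>radial_law n T)"
    using bd by (intro weak_conv_imp_bdd_ae_continuous_conv[OF rd rdr weak disc, of c]) auto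
  then have "(\<lambda>i. b i / R i ^ n * (\<integral>r. \<phi> r \<partial>\<mu> i)) \<longlonglongrightarrow> a * T ^ n * (\<integral>r. \<phi> r \<partial>radial_law n T)"
    by (intro tendsto_mult blim)
  moreover have "b i / R i ^ n * (\<integral>r. \<phi> r \<partial>\<mu> i) = (\<integral>y. \<phi> (dist x y / R i) \<partial>m) / R i ^ n" for i
  proof -
    have u: "uniform_measure m (B i) = density m (\<lambda>y. ennreal (indicator (B i) y / b i))"
      unfolding uniform_measure_def eb using b[of i]
      by (intro density_cong) (auto simp: indicator_def divide_ennreal[symmetric])
    have "(\<integral>r. \<phi> r \<partial>\<mu> i) = (\<integral>y. \<phi> (dist x y / R i) \<partial>uniform_measure m (B i))"
      unfolding \<mu>_def by (subst integral_distr) auto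
    also have "\<dots> = (\<integral>y. (indicator (B i) y / b i) *\<^sub>R \<phi> (dist x y / R i) \<partial>m)"
      unfolding u using b[of i] by (subst integral_density) (auto simp: less_imp_le)
    also have "\<dots> = (\<integral>y. \<phi> (dist x y / R i) / b i \<partial>m)"
    proof (intro Bochner_Integration.integral_cong refl)
      fix y
      show "(indicator (B i) y / b i) *\<^sub>R \<phi> (dist x y / R i) = \<phi> (dist x y / R i) / b i"
        using R[of i] T(2)[of "dist x y / R i"] by (auto simp: indicator_def B_def field_simps)
    qed
    finally show ?thesis using b[of i] by simp
  qed
  ultimately have "(\<lambda>i. (\<integral>y. \<phi> (dist x y / R i) \<partial>m) / R i ^ n) \<longlonglongrightarrow> a * T ^ n * (\<integral>r. \<phi> r \<partial>radial_law n T)"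
    by (simp only:)
  also have "a * T ^ n * (\<integral>r. \<phi> r \<partial>radial_law n T) = a * (n * (\<integral>r. indicator {0<..} r * (\<phi> r * r ^ (n - 1)) \<partial>lborel))"
    using T by (subst integral_radial_law[OF \<phi> T]) auto
  finally show ?thesis by (simp add: R_def)
qed

end

section \<open>The asymptotic volume ratio\<close>

context proper_mms
begin

text \<open>
  A profile supported in \<open>[0, 1]\<close> compares the volumes of the balls of radii \<open>R / 2\<close> and \<open>2 R\<close>;
  by monotonicity of the volume ratio \<open>v\<close> this reads \<open>v\<^bsup>1/s\<^esup> \<le> c v\<^bsup>1/s + \<theta>/n\<^esup>\<close>.
\<close>

lemma volume_ratio_lower_bound:
  fixes n :: nat
  assumes ineq: "\<And>u. u \<in> Lip0 \<Longrightarrow> Lnorm m s u \<le> C * Lnorm m p (local_lip u) powr \<theta> * Lnorm m s' u powr (1 - \<theta>)"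
    and pos: "0 < s" "0 < p" "0 < s'" "0 < \<theta>" "\<theta> \<le> 1" "0 < C"
    and scale: "1 / s = \<theta> * (1 / p - 1 / n) + (1 - \<theta>) / s'" and "0 < n"
    and bg: "\<And>r R. 0 < r \<Longrightarrow> r \<le> R \<Longrightarrow> measure m (ball x R) / R ^ n \<le> measure m (ball x r) / r ^ n"
  shows "\<exists>w>0. \<forall>R>0. w \<le> measure m (ball x R) / R ^ n"
proof -
  define g :: "real \<Rightarrow> real" where "g r = max 0 (1 - r)" for r
  define h :: "real \<Rightarrow> real" where "h r = (if r \<le> 1 then 1 else 0)" for r
  have L: "1-lipschitz_on {0..} g" by (rule lipschitz_onI) (auto simp: g_def dist_real_def)
  have sl: "slope_le g r (h r)" if "0 \<le> r" for r
  proof (cases "r \<le> 1")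
    case False
    then have "slope_le g r 0" by (intro slope_le_locally_constant[of "r - 1"]) (auto simp: g_def)
    then show ?thesis using False by (simp add: h_def)
  qed (use slope_le_lipschitz[OF L that] in \<open>simp add: h_def\<close>)
  have g_meas[measurable]: "g \<in> borel_measurable borel" unfolding g_def by measurable
  have h_meas[measurable]: "h \<in> borel_measurable borel" unfolding h_def by measurable
  define e where "e = \<theta> / n"
  have e: "0 < e" using pos \<open>0 < n\<close> by (simp add: e_def)
  have sc: "\<theta> / p + (1 - \<theta>) / s' = 1 / s + e" using scale by (simp add: e_def right_diff_distrib)
  \<comment> \<open>This is what remains of the inequality after division by w to the power 1/s: the
    hat function is at least 1/2 up to radius 1/2, and (1/4)^n compares the radii R/2 and 2 R by
    monotonicity.\<close>
  define c0 where "c0 = ((1 / 2) powr s * (1 / 4) ^ n) powr (1 / s) / C"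
  have c0: "0 < c0" using pos by (simp add: c0_def)
  have key: "c0 powr (1 / e) \<le> measure m (ball x (2 * R)) / R ^ n" if R: "0 < R" for R
  proof -
    define w where "w = measure m (ball x (2 * R)) / R ^ n"
    have w: "0 < w" using R measure_ball_pos[of "2 * R" x] by (simp add: w_def)
    have upper: "(\<integral>y. \<phi> (dist x y / R) powr q \<partial>m) / R ^ n \<le> w"
      if \<phi>: "\<And>r. 0 \<le> r \<Longrightarrow> 0 \<le> \<phi> r \<and> \<phi> r \<le> 1" "\<And>r. 1 < r \<Longrightarrow> \<phi> r = 0" and "0 < q" for \<phi> :: "real \<Rightarrow> real" and q
    proof -
      have "(\<integral>y. \<phi> (dist x y / R) powr q \<partial>m) \<le> (\<integral>y. indicator (ball x (2 * R)) y \<partial>m)"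
      proof (rule integral_mono')
        show "integrable m (\<lambda>y. indicator (ball x (2 * R)) y :: real)"
          using emeasure_bounded_finite[OF bounded_ball] by (intro integrable_real_indicator) auto
        fix y
        show "\<phi> (dist x y / R) powr q \<le> indicator (ball x (2 * R)) y"
        proof (cases "dist x y / R \<le> 1")
          case True
          then have "dist x y < 2 * R" using R by (simp add: field_simps)
          moreover have "\<phi> (dist x y / R) powr q \<le> 1 powr q" using \<phi>(1)[of "dist x y / R"] R \<open>0 < q\<close> by (intro powr_mono2) auto
          ultimately show ?thesis by simp
        qed (use \<phi>(2) in simp)
      qed simp
      also have "\<dots> = measure m (ball x (2 * R))" by simp
      finally show ?thesis using R by (simp add: w_def divide_right_mono)
    qed
    have "(1 / 2) powr s * (measure m (ball x (R / 2)) / R ^ n) \<le> (\<integral>y. g (dist x y / R) powr s \<partial>m) / R ^ n"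
    proof -
      have "(\<integral>y. (1 / 2) powr s * indicator (ball x (R / 2)) y \<partial>m) \<le> (\<integral>y. g (dist x y / R) powr s \<partial>m)"
      proof (rule integral_mono')
        \<comment> \<open>The hat function is unbounded on negative arguments, so the boundedness
          criterion is applied to its version with \<open>max 0 r\<close>, which agrees with it on
          distances.\<close>
        have "integrable m (\<lambda>y. g (max 0 (dist x y / R)) powr s)"
        proof (rule radial_integrable[of "\<lambda>r. g (max 0 r) powr s"])
          show "\<bar>g (max 0 r) powr s\<bar> \<le> 1" for r
            using powr_mono2[of s "g (max 0 r)" 1] pos by (simp add: g_def)
          show "g (max 0 r) powr s = 0" if "1 \<le> r" for r using that by (simp add: g_def)
        qed (use R in auto)
        then show "integrable m (\<lambda>y. g (dist x y / R) powr s)" using R by simp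
        fix y
        show "(1 / 2) powr s * indicator (ball x (R / 2)) y \<le> g (dist x y / R) powr s"
        proof (cases "y \<in> ball x (R / 2)")
          case True
          then have "1 / 2 \<le> g (dist x y / R)" using R by (simp add: g_def field_simps)
          then show ?thesis using True pos by (auto intro!: powr_mono2)
        qed simp
      qed simp
      then show ?thesis using R by (simp add: divide_right_mono)
    qed
    moreover have "(1 / 4) ^ n * w \<le> measure m (ball x (R / 2)) / R ^ n"
    proof -
      have "measure m (ball x (2 * R)) / (2 * R) ^ n \<le> measure m (ball x (R / 2)) / (R / 2) ^ n"
        using R by (intro bg) auto
      then have "(1 / 2) ^ n * (measure m (ball x (2 * R)) / (2 * R) ^ n) \<le> (1 / 2) ^ n * (measure m (ball x (R / 2)) / (R / 2) ^ n)"
        by (intro mult_left_mono) auto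
      moreover have "(1 / 2) ^ n * (measure m (ball x (2 * R)) / (2 * R) ^ n) = (1 / 4) ^ n * w"
      proof -
        have "(1 / 2) ^ n * (1 / 2) ^ n = (1 / 4 :: real) ^ n" by (simp flip: power_mult_distrib)
        moreover have "(1 / 2) ^ n * (measure m (ball x (2 * R)) / (2 * R) ^ n) = ((1 / 2) ^ n * (1 / 2) ^ n) * w"
          using R by (simp add: w_def power_mult_distrib power_divide)
        ultimately show ?thesis by simp
      qed
      moreover have "(1 / 2) ^ n * (measure m (ball x (R / 2)) / (R / 2) ^ n) = measure m (ball x (R / 2)) / R ^ n"
        using R by (simp add: power_divide)
      ultimately show ?thesis by simp
    qed
    ultimately have lower: "(1 / 2) powr s * ((1 / 4) ^ n * w) \<le> (\<integral>y. g (dist x y / R) powr s \<partial>m) / R ^ n"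
      by (meson mult_left_mono order_trans powr_ge_zero)
    have "((1 / 2) powr s * ((1 / 4) ^ n * w)) powr (1 / s) \<le> ((\<integral>y. g (dist x y / R) powr s \<partial>m) / R ^ n) powr (1 / s)"
      using lower w pos by (intro powr_mono2) auto
    \<comment> \<open>The support bound is T = 2 because \<open>h\<close> still equals 1 at the
      corner r = 1.\<close>
    also have "\<dots> \<le> C * ((\<integral>y. h (dist x y / R) powr p \<partial>m) / R ^ n) powr (\<theta> / p) * ((\<integral>y. g (dist x y / R) powr s' \<partial>m) / R ^ n) powr ((1 - \<theta>) / s')"
      by (rule scaled_radial_inequality[OF ineq _ _ _ _ _ scale \<open>0 < n\<close> L, where T = 2 and c = 1])
        (use pos sl R in \<open>auto simp: g_def h_def\<close>)
    also have "\<dots> \<le> C * w powr (\<theta> / p) * w powr ((1 - \<theta>) / s')"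
      using pos R by (intro mult_mono powr_mono2 upper) (auto simp: g_def h_def)
    also have "\<dots> = C * w powr (1 / s + e)"
      by (simp only: sc[symmetric] powr_add mult.assoc)
    finally have "((1 / 2) powr s * (1 / 4) ^ n) powr (1 / s) * w powr (1 / s) \<le> C * (w powr (1 / s) * w powr e)"
      using w by (simp add: powr_mult powr_add mult_ac)
    then have "c0 \<le> w powr e" using w pos by (simp add: c0_def field_simps)
    then have "c0 powr (1 / e) \<le> (w powr e) powr (1 / e)" using c0 e by (intro powr_mono2) auto
    also have "\<dots> = w" using w e by (simp add: powr_powr)
    finally show ?thesis by (simp add: w_def)
  qed
  show ?thesis
  proof (intro exI conjI allI impI)
    show "0 < c0 powr (1 / e) / 2 ^ n" using c0 by simp
    fix R :: real assume "0 < R"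
    then show "c0 powr (1 / e) / 2 ^ n \<le> measure m (ball x R) / R ^ n"
      using key[of "R / 2"] by (simp add: power_divide field_simps)
  qed
qed

text \<open>A nonincreasing ratio tends to its infimum, so growth at infinity controls balls of
  every radius; the uniform bound \<open>w\<close> keeps the infimum positive.\<close>

lemma asymptotic_volume_ratio:
  fixes n :: nat
  assumes bg: "\<And>r R. 0 < r \<Longrightarrow> r \<le> R \<Longrightarrow> measure m (ball x R) / R ^ n \<le> measure m (ball x r) / r ^ n"
    and w: "0 < w" "\<And>R. 0 < R \<Longrightarrow> w \<le> measure m (ball x R) / R ^ n"
  shows "\<exists>a>0. ((\<lambda>R. measure m (ball x R) / R ^ n) \<longlongrightarrow> a) at_top \<and> (\<forall>R>0. a \<le> measure m (ball x R) / R ^ n)"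
proof -
  define v where "v R = measure m (ball x R) / R ^ n" for R
  define a where "a = Inf (v ` {0<..})"
  have bdd: "bdd_below (v ` {0<..})" using w(2) by (intro bdd_belowI[of _ w]) (auto simp: v_def)
  have low: "a \<le> v R" if "0 < R" for R
    unfolding a_def using that by (intro cInf_lower bdd) auto
  have "w \<le> a" unfolding a_def using w(2) by (intro cInf_greatest) (auto simp: v_def)
  moreover have "(v \<longlongrightarrow> a) at_top"
  proof (rule order_tendstoI)
    fix b assume "b < a"
    show "\<forall>\<^sub>F R in at_top. b < v R"
      using eventually_gt_at_top[of 0] by eventually_elim (use low \<open>b < a\<close> in \<open>auto intro: less_le_trans\<close>)
  next
    fix b assume "a < b"
    then obtain r where r: "0 < r" "v r < b"
      unfolding a_def using cInf_less_iff[OF _ bdd] by auto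
    show "\<forall>\<^sub>F R in at_top. v R < b"
      using eventually_ge_at_top[of r]
      by eventually_elim (use bg r in \<open>auto simp: v_def intro: le_less_trans\<close>)
  qed
  ultimately show ?thesis using w(1) low unfolding v_def by (intro exI[of _ a]) auto
qed

text \<open>The blow-down of the inequality. Each rescaled integral tends to a times the
  corresponding Euclidean radial integral, and the scaling relation combines the powers of a on the
  right into a^(1/s) a^(\<theta>/n), of which the first cancels with the left. Upper bounds
  \<open>H\<close> and \<open>X\<close> replace the integrals on the right so that truncated
  profiles can be tested with the untruncated values.\<close>

lemma radial_test_inequality:
  fixes n :: nat and g h :: "real \<Rightarrow> real"
  assumes ineq: "\<And>u. u \<in> Lip0 \<Longrightarrow> Lnorm m s u \<le> C * Lnorm m p (local_lip u) powr \<theta> * Lnorm m s' u powr (1 - \<theta>)"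
    and pos: "0 < s" "0 < p" "0 < s'" "0 < \<theta>" "\<theta> \<le> 1" "0 < C"
    and scale: "1 / s = \<theta> * (1 / p - 1 / n) + (1 - \<theta>) / s'" and "0 < n"
    and lim: "((\<lambda>R. measure m (ball x R) / R ^ n) \<longlongrightarrow> a) at_top" and "0 < a"
    and g: "L-lipschitz_on {0..} g" "\<And>r. 0 \<le> g r" "\<And>r. g r \<le> c" "\<And>r. T \<le> r \<Longrightarrow> g r = 0" "\<And>r. isCont g r"
    and h: "\<And>r. 0 \<le> r \<Longrightarrow> slope_le g r (h r)" "\<And>r. 0 \<le> h r" "\<And>r. h r \<le> c" "\<And>r. T \<le> r \<Longrightarrow> h r = 0"
    and D: "finite D" "\<And>r. 0 < r \<Longrightarrow> r \<notin> D \<Longrightarrow> isCont h r"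
    and h_meas[measurable]: "h \<in> borel_measurable borel" and "0 < T"
    and H: "n * (\<integral>r. indicator {0<..} r * (h r powr p * r ^ (n - 1)) \<partial>lborel) \<le> H" "0 < H"
    and X: "n * (\<integral>r. indicator {0<..} r * (g r powr s' * r ^ (n - 1)) \<partial>lborel) \<le> X" "0 < X"
  shows "(n * (\<integral>r. indicator {0<..} r * (g r powr s * r ^ (n - 1)) \<partial>lborel)) powr (1 / s)
    \<le> a powr (\<theta> / n) * (C * H powr (\<theta> / p) * X powr ((1 - \<theta>) / s'))"
proof -
  define J where "J \<phi> = n * (\<integral>r. indicator {0<..} r * (\<phi> r * r ^ (n - 1)) \<partial>lborel)" for \<phi>
  define \<Phi> where "\<Phi> \<phi> i = (\<integral>y. \<phi> (dist x y / Suc i) \<partial>m) / real (Suc i) ^ n" for \<phi> :: "real \<Rightarrow> real" and i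
  have g_meas[measurable]: "g \<in> borel_measurable borel"
    using g(5) by (intro borel_measurable_continuous_onI) (auto simp: continuous_on_eq_continuous_at)
  have cont_powr: "isCont (\<lambda>r. \<phi> r powr q) r" if "isCont \<phi> r" "0 < q" "\<And>r. 0 \<le> \<phi> r" for \<phi> :: "real \<Rightarrow> real" and q r
    using that unfolding isCont_def by (intro tendsto_powr') auto
  have bd: "\<bar>\<phi> r powr q\<bar> \<le> c powr q" if "0 < q" "\<And>r. 0 \<le> \<phi> r" "\<And>r. \<phi> r \<le> c" for \<phi> :: "real \<Rightarrow> real" and q r
    using that by (auto intro!: powr_mono2)
  have limg: "\<Phi> (\<lambda>r. g r powr q) \<longlonglongrightarrow> a * J (\<lambda>r. g r powr q)" if "0 < q" for q
    unfolding \<Phi>_def J_def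
    by (rule radial_integral_limit[OF lim \<open>0 < a\<close> \<open>0 < n\<close> _ bd[OF that g(2,3)] \<open>0 < T\<close> _ finite.emptyI])
      (use g that cont_powr[OF g(5) that g(2)] in auto)
  have limh: "\<Phi> (\<lambda>r. h r powr p) \<longlonglongrightarrow> a * J (\<lambda>r. h r powr p)"
    unfolding \<Phi>_def J_def
    by (rule radial_integral_limit[OF lim \<open>0 < a\<close> \<open>0 < n\<close> _ bd[OF pos(2) h(2,3)] \<open>0 < T\<close> _ D(1)])
      (use h pos cont_powr[OF D(2) pos(2) h(2)] in auto)
  have nn: "0 \<le> \<Phi> (\<lambda>r. \<phi> r powr q) i" for \<phi> :: "real \<Rightarrow> real" and q i
    unfolding \<Phi>_def by (intro divide_nonneg_nonneg integral_nonneg) auto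
  have Jnn: "0 \<le> J (\<lambda>r. g r powr q)" for q
  proof -
    have "0 \<le> indicator {0<..} r * (g r powr q * r ^ (n - 1))" for r by (cases "0 < r") auto
    then have "0 \<le> (\<integral>r. indicator {0<..} r * (g r powr q * r ^ (n - 1)) \<partial>lborel)"
      by (intro Bochner_Integration.integral_nonneg)
    then show ?thesis unfolding J_def by simp
  qed
  \<comment> \<open>The maxima keep the bases on the right positive in the limit. This matters for
    \<theta> = 1, the Sobolev case \<alpha> = n/(n - p): there the last exponent is 0, and
    \<open>powr\<close> with exponent 0 is discontinuous at base 0.\<close>
  have le: "\<Phi> (\<lambda>r. g r powr s) i powr (1 / s) \<le> C * max (\<Phi> (\<lambda>r. h r powr p) i) (a * H) powr (\<theta> / p) * max (\<Phi> (\<lambda>r. g r powr s') i) (a * X) powr ((1 - \<theta>) / s')" for i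
  proof -
    have "\<Phi> (\<lambda>r. g r powr s) i powr (1 / s) \<le> C * \<Phi> (\<lambda>r. h r powr p) i powr (\<theta> / p) * \<Phi> (\<lambda>r. g r powr s') i powr ((1 - \<theta>) / s')"
      unfolding \<Phi>_def
      by (rule scaled_radial_inequality[OF ineq _ _ _ _ _ scale \<open>0 < n\<close> g(1,2,4) h(1-4) h_meas]) (use pos in auto)
    also have "\<dots> \<le> C * max (\<Phi> (\<lambda>r. h r powr p) i) (a * H) powr (\<theta> / p) * max (\<Phi> (\<lambda>r. g r powr s') i) (a * X) powr ((1 - \<theta>) / s')"
      using pos nn by (intro mult_mono powr_mono2) auto
    finally show ?thesis .
  qed
  have "(\<lambda>i. \<Phi> (\<lambda>r. g r powr s) i powr (1 / s)) \<longlonglongrightarrow> (a * J (\<lambda>r. g r powr s)) powr (1 / s)"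
    using pos nn by (intro tendsto_powr' limg tendsto_const) auto
  moreover have "(\<lambda>i. C * max (\<Phi> (\<lambda>r. h r powr p) i) (a * H) powr (\<theta> / p) * max (\<Phi> (\<lambda>r. g r powr s') i) (a * X) powr ((1 - \<theta>) / s'))
     \<longlonglongrightarrow> C * max (a * J (\<lambda>r. h r powr p)) (a * H) powr (\<theta> / p) * max (a * J (\<lambda>r. g r powr s')) (a * X) powr ((1 - \<theta>) / s')"
    using \<open>0 < a\<close> H X pos by (intro tendsto_intros limg limh) (auto simp: max_def)
  ultimately have "(a * J (\<lambda>r. g r powr s)) powr (1 / s)
      \<le> C * max (a * J (\<lambda>r. h r powr p)) (a * H) powr (\<theta> / p) * max (a * J (\<lambda>r. g r powr s')) (a * X) powr ((1 - \<theta>) / s')"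
    by (rule LIMSEQ_le) (use le in auto)
  also have "max (a * J (\<lambda>r. h r powr p)) (a * H) = a * H"
    using H \<open>0 < a\<close> by (simp add: J_def max_def)
  also have "max (a * J (\<lambda>r. g r powr s')) (a * X) = a * X"
    using X \<open>0 < a\<close> by (simp add: J_def max_def)
  finally have "a powr (1 / s) * J (\<lambda>r. g r powr s) powr (1 / s)
      \<le> C * (a powr (\<theta> / p) * H powr (\<theta> / p)) * (a powr ((1 - \<theta>) / s') * X powr ((1 - \<theta>) / s'))"
    using \<open>0 < a\<close> H X Jnn by (simp add: powr_mult)
  also have "\<dots> = (a powr (\<theta> / p) * a powr ((1 - \<theta>) / s')) * (C * H powr (\<theta> / p) * X powr ((1 - \<theta>) / s'))"
    by (simp only: mult_ac)
  also have "a powr (\<theta> / p) * a powr ((1 - \<theta>) / s') = a powr (1 / s) * a powr (\<theta> / n)"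
    unfolding powr_add[symmetric] scale by (simp add: right_diff_distrib)
  finally have "J (\<lambda>r. g r powr s) powr (1 / s) \<le> a powr (\<theta> / n) * (C * H powr (\<theta> / p) * X powr ((1 - \<theta>) / s'))"
    using \<open>0 < a\<close> by simp
  then show ?thesis by (simp only: J_def)
qed

end

section \<open>Beta integrals and the constants\<close>

text \<open>For exponents above 1 the corner at 0 disappears. Profiles built from
  \<open>max 0 r\<close> are therefore differentiable on the whole line, where derivative bounds
  give Lipschitz bounds directly.\<close>

lemma has_real_derivative_max_powr:
  fixes c s :: real
  assumes "1 < c"
  shows "((\<lambda>s. max 0 s powr c) has_real_derivative c * max 0 s powr (c - 1)) (at s)"
proof -
  consider "s < 0" | "0 < s" | "s = 0" by linarith
  then show ?thesis
  proof cases
    case 1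
    have "((\<lambda>s. 0) has_real_derivative 0) (at s)" by simp
    then have "((\<lambda>s. max 0 s powr c) has_real_derivative 0) (at s)"
      by (rule has_field_derivative_transform_within_open[where S = "{..<0}"]) (use 1 in auto)
    then show ?thesis using 1 by simp
  next
    case 2
    have "((\<lambda>s. s powr c) has_real_derivative c * s powr (c - 1)) (at s)"
      by (rule has_real_derivative_powr[OF 2])
    then have "((\<lambda>s. max 0 s powr c) has_real_derivative c * s powr (c - 1)) (at s)"
      by (rule has_field_derivative_transform_within_open[where S = "{0<..}"]) (use 2 in auto)
    then show ?thesis using 2 by simp
  next
    case 3
    have "((\<lambda>h. \<bar>h\<bar> powr (c - 1)) \<longlongrightarrow> \<bar>0\<bar> powr (c - 1)) (at (0::real))"
      using assms by (intro tendsto_powr' tendsto_intros) auto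
    then have lim: "((\<lambda>h. \<bar>h\<bar> powr (c - 1)) \<longlongrightarrow> 0) (at (0::real))" by simp
    have bound: "norm (max 0 h powr c / h) \<le> norm (\<bar>h\<bar> powr (c - 1)) * 1" for h :: real
    proof (cases "0 < h")
      case True
      then show ?thesis by (simp add: powr_diff)
    qed auto
    have "((\<lambda>h. max 0 h powr c / h) \<longlongrightarrow> 0) (at 0)"
      by (rule tendsto_0_le[OF lim always_eventually[OF allI[OF bound]]])
    then have "((\<lambda>s. max 0 s powr c) has_real_derivative 0) (at 0)"
      using assms by (subst DERIV_def) simp
    then show ?thesis using 3 by simp
  qed
qed

text \<open>Nonnegativity of \<open>f\<close> turns its gauge integral into an absolute one, to
  which the change of variables for the completed Lebesgue measure applies; Borel measurability of
  the result leads back to \<open>lborel\<close>.\<close>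

lemma integral_lborel_change_of_variables:
  fixes f g g' :: "real \<Rightarrow> real"
  assumes S: "S \<in> sets borel" and gS: "g ` S = {0<..<1}"
    and der: "\<And>x. x \<in> S \<Longrightarrow> (g has_real_derivative g' x) (at x)" and inj: "inj_on g S"
    and f: "(f has_integral b) {0..1}" "\<And>t. 0 \<le> f t" and F: "(\<lambda>x. indicator S x * (\<bar>g' x\<bar> * f (g x))) \<in> borel_measurable borel"
  shows "integrable lborel (\<lambda>x. indicator S x * (\<bar>g' x\<bar> * f (g x)))"
    and "(\<integral>x. indicator S x * (\<bar>g' x\<bar> * f (g x)) \<partial>lborel) = b"
proof -
  have f': "(f has_integral b) {0<..<1}" using f(1) by (simp add: has_integral_Icc_iff_Ioo)
  then have int: "f integrable_on {0<..<1}" "integral {0<..<1} f = b" by (auto simp: has_integral_iff)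
  have "f absolutely_integrable_on {0<..<1}"
    using int(1) f(2) by (rule nonnegative_absolutely_integrable_1)
  then have img: "f absolutely_integrable_on g ` S \<and> integral (g ` S) f = b" using int(2) gS by simp
  have SL: "S \<in> sets lebesgue" using S by simp
  have "(\<lambda>x. \<bar>g' x\<bar> * f (g x)) absolutely_integrable_on S \<and> integral S (\<lambda>x. \<bar>g' x\<bar> * f (g x)) = b"
    using has_absolute_integral_change_of_variables_1'[OF SL has_field_derivative_at_within[OF der] inj] img by blast
  then have *: "set_integrable lebesgue S (\<lambda>x. \<bar>g' x\<bar> * f (g x))" "integral S (\<lambda>x. \<bar>g' x\<bar> * f (g x)) = b"
    by auto
  have "(LINT x:S|lebesgue. \<bar>g' x\<bar> * f (g x)) = b"
    using set_lebesgue_integral_eq_integral(2)[OF *(1)] *(2) by simp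
  then have L: "(\<integral>x. indicator S x * (\<bar>g' x\<bar> * f (g x)) \<partial>lebesgue) = b"
    by (simp add: set_lebesgue_integral_def)
  have I: "integrable lebesgue (\<lambda>x. indicator S x * (\<bar>g' x\<bar> * f (g x)))"
    using *(1) by (simp add: set_integrable_def)
  show "integrable lborel (\<lambda>x. indicator S x * (\<bar>g' x\<bar> * f (g x)))"
    using I F by (subst (asm) integrable_completion) auto
  show "(\<integral>x. indicator S x * (\<bar>g' x\<bar> * f (g x)) \<partial>lborel) = b"
    using L F by (subst (asm) integral_completion) auto
qed

lemma powr_image_unit:
  fixes c :: real
  assumes "0 < c"
  shows "(\<lambda>r. r powr c) ` {0<..<1} = {0<..<1}"
proof safe
  fix r :: real assume r: "r \<in> {0<..<1}"
  then have "r powr c < 1 powr c" using assms by (intro powr_less_mono2) auto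
  then show "r powr c \<in> {0<..<1}" using r by auto
next
  fix t :: real assume t: "t \<in> {0<..<1}"
  then have "t powr (1 / c) < 1 powr (1 / c)" using assms by (intro powr_less_mono2) auto
  then show "t \<in> (\<lambda>r. r powr c) ` {0<..<1}"
    using t assms by (intro image_eqI[of _ _ "t powr (1 / c)"]) (auto simp: powr_powr)
qed

text \<open>Substitution t = r^c in Euler's integral.\<close>

lemma Beta_integral_unit_interval:
  fixes c x y :: real
  assumes "0 < c" "0 < x" "0 < y"
  shows "integrable lborel (\<lambda>r. indicator {0<..<1} r * ((1 - r powr c) powr (y - 1) * r powr (c * x - 1)))"
    and "(\<integral>r. indicator {0<..<1} r * ((1 - r powr c) powr (y - 1) * r powr (c * x - 1)) \<partial>lborel) = Beta x y / c"
proof -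
  define f where "f t = t powr (x - 1) * (1 - t) powr (y - 1)" for t :: real
  define g' where "g' r = c * r powr (c - 1)" for r
  have eq: "indicator {0<..<1} r * (\<bar>g' r\<bar> * f (r powr c)) = c * (indicator {0<..<1} r * ((1 - r powr c) powr (y - 1) * r powr (c * x - 1)))" for r
  proof (cases "r \<in> {0<..<1}")
    case True
    have "r powr (c - 1) * r powr (c * (x - 1)) = r powr (c * x - 1)"
      unfolding powr_add[symmetric] by (simp add: algebra_simps)
    then show ?thesis using True assms by (simp add: g'_def f_def powr_powr abs_mult mult_ac)
  qed simp
  have der: "((\<lambda>r. r powr c) has_real_derivative g' r) (at r)" if "r \<in> {0<..<1}" for r
    unfolding g'_def using that by (intro has_real_derivative_powr) auto
  have inj: "inj_on (\<lambda>r. r powr c) {0<..<1}"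
    by (rule inj_on_inverseI[where g = "\<lambda>t. t powr (1 / c)"]) (use assms in \<open>auto simp: powr_powr\<close>)
  have int: "(f has_integral Beta x y) {0..1}"
    unfolding f_def using has_integral_Beta_real[of x y] assms by simp
  have nn: "0 \<le> f t" for t by (simp add: f_def)
  have meas: "(\<lambda>r. indicator {0<..<1} r * (\<bar>g' r\<bar> * f (r powr c))) \<in> borel_measurable borel"
    unfolding f_def g'_def by measurable
  note cv = integral_lborel_change_of_variables[OF _ powr_image_unit[OF \<open>0 < c\<close>] der inj int nn meas, unfolded eq]
  show "integrable lborel (\<lambda>r. indicator {0<..<1} r * ((1 - r powr c) powr (y - 1) * r powr (c * x - 1)))"
    using cv(1) \<open>0 < c\<close> by simp
  show "(\<integral>r. indicator {0<..<1} r * ((1 - r powr c) powr (y - 1) * r powr (c * x - 1)) \<partial>lborel) = Beta x y / c"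
    using cv(2) \<open>0 < c\<close> by (simp add: field_simps)
qed

text \<open>Substitution t = r^c/(1 + r^c), for which 1 - t = 1/(1 + r^c). The map is written as 1 -
  1/(1 + r^c) because this form is easy to differentiate and to invert.\<close>

lemma Beta_integral_half_line:
  fixes c x y :: real
  assumes "0 < c" "0 < x" "0 < y"
  shows "integrable lborel (\<lambda>r. indicator {0<..} r * ((1 + r powr c) powr (- (x + y)) * r powr (c * x - 1)))"
    and "(\<integral>r. indicator {0<..} r * ((1 + r powr c) powr (- (x + y)) * r powr (c * x - 1)) \<partial>lborel) = Beta x y / c"
proof -
  define f where "f t = t powr (x - 1) * (1 - t) powr (y - 1)" for t :: real
  define g where "g r = 1 - 1 / (1 + r powr c)" for r
  define g' where "g' r = c * r powr (c - 1) / (1 + r powr c)\<^sup>2" for r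
  have pos: "0 < 1 + r powr c" for r by (simp add: add_pos_nonneg)
  have eq: "indicator {0<..} r * (\<bar>g' r\<bar> * f (g r)) = c * (indicator {0<..} r * ((1 + r powr c) powr (- (x + y)) * r powr (c * x - 1)))" for r
  proof (cases "r \<in> {0<..}")
    case True
    define v where "v = 1 + r powr c"
    have v: "0 < v" using pos by (simp add: v_def)
    have gv: "g r = r powr c / v" "1 - g r = 1 / v" using v by (simp_all add: g_def v_def field_simps)
    have "f (g r) = g r powr (x - 1) * (1 - g r) powr (y - 1)" by (simp add: f_def)
    also have "\<dots> = (r powr c / v) powr (x - 1) * (1 / v) powr (y - 1)"
      unfolding gv(2) unfolding gv(1) ..
    also have "\<dots> = r powr (c * (x - 1)) * (v powr (- (x - 1)) * v powr (- (y - 1)))"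
    proof -
      have "(r powr c / v) powr (x - 1) = r powr (c * (x - 1)) * v powr (- (x - 1))"
        using v by (simp add: powr_divide powr_powr powr_minus_divide del: minus_diff_eq)
      moreover have "(1 / v) powr (y - 1) = v powr (- (y - 1))"
        using v by (simp add: powr_divide powr_minus_divide del: minus_diff_eq)
      ultimately show ?thesis by (simp only: mult.assoc)
    qed
    finally have fg: "f (g r) = r powr (c * (x - 1)) * (v powr (- (x - 1)) * v powr (- (y - 1)))" .
    have "\<bar>g' r\<bar> = c * r powr (c - 1) * v powr (- 2)"
      using v assms by (simp add: g'_def v_def[symmetric] powr_minus divide_inverse)
    then have "\<bar>g' r\<bar> * f (g r) = c * (r powr (c - 1) * r powr (c * (x - 1))) * (v powr (- 2) * v powr (- (x - 1)) * v powr (- (y - 1)))"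
      unfolding fg by (simp only: mult_ac)
    also have "r powr (c - 1) * r powr (c * (x - 1)) = r powr (c * x - 1)"
      unfolding powr_add[symmetric] by (simp add: algebra_simps)
    also have "v powr (- 2) * v powr (- (x - 1)) * v powr (- (y - 1)) = v powr (- (x + y))"
    proof -
      have "- 2 + - (x - 1) + - (y - 1) = - (x + y)" by simp
      then show ?thesis unfolding powr_add[symmetric] by (simp only:)
    qed
    finally show ?thesis using True by (simp add: v_def mult_ac)
  qed simp
  have der: "(g has_real_derivative g' r) (at r)" if "r \<in> {0<..}" for r
  proof -
    have "(g has_real_derivative 0 - (0 * (1 + r powr c) - 1 * (0 + c * r powr (c - 1))) / ((1 + r powr c) * (1 + r powr c))) (at r)"
      unfolding g_def using that pos[of r]
      by (intro DERIV_diff DERIV_divide DERIV_add DERIV_const has_real_derivative_powr) auto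
    then show ?thesis by (simp add: g'_def power2_eq_square)
  qed
  have img: "g ` {0<..} = {0<..<1}"
  proof (intro equalityI subsetI)
    fix t assume "t \<in> g ` {0<..}"
    then obtain r where r: "0 < r" "t = g r" by auto
    then have "0 < r powr c" by simp
    then show "t \<in> {0<..<1}" using r by (simp add: g_def add_pos_nonneg)
  next
    fix t :: real assume t: "t \<in> {0<..<1}"
    define r where "r = (t / (1 - t)) powr (1 / c)"
    have q: "0 < t / (1 - t)" using t by simp
    have "r powr c = t / (1 - t)" using q t assms by (simp add: r_def powr_powr)
    then have "1 + r powr c = 1 + t / (1 - t)" by simp
    also have "\<dots> = 1 / (1 - t)" using t by (simp add: field_simps)
    finally have "1 + r powr c = 1 / (1 - t)" .
    then have "g r = t" by (simp add: g_def)
    moreover have "0 < r" using q t by (simp add: r_def)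
    ultimately show "t \<in> g ` {0<..}" by (intro image_eqI[of _ _ r]) auto
  qed
  have inj: "inj_on g {0<..}"
  proof (rule inj_onI)
    fix r s :: real assume rs: "r \<in> {0<..}" "s \<in> {0<..}" "g r = g s"
    then have "1 / (1 + r powr c) = 1 / (1 + s powr c)" unfolding g_def by linarith
    then have "r powr c = s powr c" by (simp add: divide_inverse)
    then have "(r powr c) powr (1 / c) = (s powr c) powr (1 / c)" by simp
    then show "r = s" using rs assms by (simp add: powr_powr)
  qed
  have int: "(f has_integral Beta x y) {0..1}"
    unfolding f_def using has_integral_Beta_real[of x y] assms by simp
  have nn: "0 \<le> f t" for t by (simp add: f_def)
  have meas: "(\<lambda>r. indicator {0<..} r * (\<bar>g' r\<bar> * f (g r))) \<in> borel_measurable borel"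
    unfolding f_def g_def g'_def by measurable
  note cv = integral_lborel_change_of_variables[OF _ img der inj int nn meas, unfolded eq]
  show "integrable lborel (\<lambda>r. indicator {0<..} r * ((1 + r powr c) powr (- (x + y)) * r powr (c * x - 1)))"
    using cv(1) \<open>0 < c\<close> by simp
  show "(\<integral>r. indicator {0<..} r * ((1 + r powr c) powr (- (x + y)) * r powr (c * x - 1)) \<partial>lborel) = Beta x y / c"
    using cv(2) \<open>0 < c\<close> by (simp add: field_simps)
qed

lemma Lipschitz_of_derivative_bound:
  fixes f f' :: "real \<Rightarrow> real"
  assumes "\<And>r. (f has_real_derivative f' r) (at r)" "\<And>r. \<bar>f' r\<bar> \<le> L"
  shows "L-lipschitz_on S f"
proof (rule lipschitz_on_subset[OF _ subset_UNIV])
  show "L-lipschitz_on UNIV f"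
  proof (rule bounded_derivative_imp_lipschitz)
    show "(f has_derivative (\<lambda>h. f' r * h)) (at r within UNIV)" for r
      using assms(1)[of r] by (simp add: has_field_derivative_def)
    show "onorm (\<lambda>h. f' r * h) \<le> L" for r
      using assms(2)[of r] by (intro onorm_le) (auto simp: abs_mult intro: mult_right_mono)
    show "0 \<le> L" using assms(2)[of 0] by linarith
  qed simp
qed

section \<open>Exponent relations and identities for the two constants\<close>

lemma Beta_real_pos: "0 < x \<Longrightarrow> 0 < y \<Longrightarrow> 0 < Beta x (y :: real)"
  unfolding Beta_def by (intro divide_pos_pos mult_pos_pos Gamma_real_pos) auto

lemma nat_power_eq_powr_shift: "0 < r \<Longrightarrow> 0 < n \<Longrightarrow> 0 < c \<Longrightarrow> r ^ (n - 1) = r powr (c * (real n / c) - 1)"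
  by (simp add: powr_realpow[symmetric] of_nat_diff)

text \<open>
  Up to the factor \<open>\<omega>\<^sub>n\<close>, the quantity \<open>X\<close> is the integral over \<open>\<real>\<^sup>n\<close> of the power of the Euclidean
  extremal on the right-hand side of the inequality; \<open>X\<close> times the other fractions gives the
  integrals of the power on the left and of the \<open>p\<close>-th power of the gradient.
\<close>

lemma gn_G_identity:
  fixes \<alpha> p n :: real
  assumes A: "1 < p" "p < n" "1 < \<alpha>" "\<alpha> \<le> n / (n - p)"
  defines "q \<equiv> \<alpha> * (p - 1) + 1" and "c \<equiv> conj_exp p" and "\<theta> \<equiv> gn_theta \<alpha> p n"
  defines "b \<equiv> q / (\<alpha> - 1)"
  defines "X \<equiv> n / c * Beta (b - n / c) (n / c)"
  shows "0 < \<theta>" "\<theta> \<le> 1" "1 / (\<alpha> * p) = \<theta> * (1 / p - 1 / n) + (1 - \<theta>) / q"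
    "0 < b - n / c" "0 < X" "0 < gn_G \<alpha> p n"
    "(X * ((b - n / c) / b)) powr (1 / (\<alpha> * p)) =
      gn_G \<alpha> p n * unit_ball_vol n powr (\<theta> / n) *
      (((c / (\<alpha> - 1)) powr p * (X * (n / c / b))) powr (\<theta> / p) * X powr ((1 - \<theta>) / q))"
proof -
  have c: "0 < c" using A by (simp add: c_def conj_exp_def)
  have q: "1 < q" using A by (simp add: q_def)
  have n: "0 < n" "0 < n - p" using A by auto
  have \<alpha>: "0 < \<alpha>" "0 < \<alpha> - 1" "\<alpha> * (n - p) \<le> n" using A by (auto simp: field_simps)
  have b: "0 < b" using q \<alpha> by (simp add: b_def)
  \<comment> \<open>Positivity of b - n/c is integrability at infinity of the q-th power of the
    extremal. The bound \<alpha> \<le> n/(n - p) gives p/(\<alpha> - 1) \<ge> n - p, and what is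
    left over is n/p - 1 > 0.\<close>
  have "n / c = n - n / p" using A by (simp add: c_def conj_exp_def field_simps)
  moreover have "b = p - 1 + p / (\<alpha> - 1)" using A by (simp add: b_def q_def field_simps)
  moreover have "n - p \<le> p / (\<alpha> - 1)" using \<alpha> by (simp add: field_simps)
  moreover have "1 < n / p" using A by simp
  ultimately show bnc: "0 < b - n / c" by linarith
  have ps: "sobolev_exp p n - \<alpha> * p + \<alpha> - 1 = sobolev_exp p n - q" by (simp add: q_def algebra_simps)
  have "p * \<alpha> \<le> p * (n / (n - p))" using A by (intro mult_left_mono) auto
  then have "\<alpha> * p \<le> sobolev_exp p n" by (simp add: sobolev_exp_def mult.commute)
  moreover have qap: "\<alpha> * p - q = \<alpha> - 1" by (simp add: q_def algebra_simps)
  ultimately have psq: "0 < sobolev_exp p n - q" "\<alpha> * p \<le> sobolev_exp p n" using \<alpha> by linarith+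
  have P: "0 < sobolev_exp p n" using A by (simp add: sobolev_exp_def)
  have \<theta>: "\<theta> = sobolev_exp p n * (\<alpha> - 1) / (\<alpha> * p * (sobolev_exp p n - q))"
    by (simp add: \<theta>_def gn_theta_def ps)
  show \<theta>0: "0 < \<theta>" unfolding \<theta> using P \<alpha> psq A by simp
  have "\<alpha> * p * q \<le> sobolev_exp p n * q" using psq q by (intro mult_right_mono) auto
  moreover have "sobolev_exp p n * (\<alpha> - 1) = sobolev_exp p n * (\<alpha> * p) - sobolev_exp p n * q"
    unfolding qap[symmetric] by (simp add: algebra_simps)
  ultimately have "sobolev_exp p n * (\<alpha> - 1) \<le> \<alpha> * p * (sobolev_exp p n - q)" by (simp add: algebra_simps)
  then show "\<theta> \<le> 1" unfolding \<theta> using P \<alpha> psq A by (simp add: field_simps)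
  \<comment> \<open>In terms of the Sobolev exponent, \<theta> is the Hoelder interpolation
    parameter that places \<open>\<alpha> * p\<close> between q and
    \<open>sobolev_exp p n\<close>.\<close>
  have inv: "1 / p - 1 / n = 1 / sobolev_exp p n" using A by (simp add: sobolev_exp_def field_simps)
  have "\<theta> * (1 / q - 1 / sobolev_exp p n) = 1 / q - 1 / (\<alpha> * p)"
  proof -
    have "1 / q - 1 / sobolev_exp p n = (sobolev_exp p n - q) / (q * sobolev_exp p n)"
      using P q by (simp add: field_simps)
    then have "\<theta> * (1 / q - 1 / sobolev_exp p n) = (\<alpha> - 1) / (\<alpha> * p * q)"
      unfolding \<theta> using P psq by simp
    also have "\<dots> = 1 / q - 1 / (\<alpha> * p)" unfolding qap[symmetric] using q A by (simp add: field_simps)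
    finally show ?thesis .
  qed
  then show scale: "1 / (\<alpha> * p) = \<theta> * (1 / p - 1 / n) + (1 - \<theta>) / q"
    unfolding inv by (simp add: algebra_simps diff_divide_distrib)
  define B where "B = Beta (b - n / c) (n / c)"
  have B: "0 < B" unfolding B_def using bnc c n by (intro Beta_real_pos) auto
  have XB: "X = n / c * B" by (simp add: X_def B_def)
  show X: "0 < X" using B c n by (simp add: XB)
  define \<omega> where "\<omega> = unit_ball_vol n"
  have \<omega>: "0 < \<omega>" using n by (simp add: \<omega>_def)
  have G: "gn_G \<alpha> p n = ((\<alpha> - 1) / c) powr \<theta> * ((c / n) powr (\<theta> / p + \<theta> / n) * (b - n / c) powr (1 / (\<alpha> * p)) *
      b powr (\<theta> / p - 1 / (\<alpha> * p))) / (\<omega> * B) powr (\<theta> / n)"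
    by (simp add: gn_G_def Let_def \<theta>_def c_def b_def q_def \<omega>_def B_def)
  show Gpos: "0 < gn_G \<alpha> p n" unfolding G using \<alpha> c n bnc b \<omega> B by simp
  \<comment> \<open>Logarithms turn the identity between products of powers into one that is linear
    in ln n, ln c, ln b, ln B and the like; the scaling relation, in the form \<open>e1\<close>,
    then matches the coefficients.\<close>
  define e where "e = 1 / (\<alpha> * p)"
  have lnX: "ln X = ln n - ln c + ln B" using B c n by (simp add: XB ln_mult ln_div)
  have lnL: "ln ((X * ((b - n / c) / b)) powr e) = e * (ln X + ln (b - n / c) - ln b)"
    using X bnc b by (simp add: ln_powr ln_mult ln_div)
  have lnG: "ln (gn_G \<alpha> p n) = \<theta> * (ln (\<alpha> - 1) - ln c) + (\<theta> / p + \<theta> / n) * (ln c - ln n) + e * ln (b - n / c)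
      + (\<theta> / p - e) * ln b - \<theta> / n * (ln \<omega> + ln B)"
    unfolding G e_def[symmetric] using \<alpha> c n bnc b \<omega> B by (simp add: ln_powr ln_mult ln_div)
  have lnH: "ln (((c / (\<alpha> - 1)) powr p * (X * (n / c / b))) powr (\<theta> / p))
     = \<theta> / p * (p * (ln c - ln (\<alpha> - 1)) + (ln X + (ln n - ln c - ln b)))"
    using X \<alpha> c n b by (simp add: ln_powr ln_mult ln_div)
  have Hpos: "0 < (c / (\<alpha> - 1)) powr p * (X * (n / c / b))" using X \<alpha> c n b by simp
  have lnR: "ln (gn_G \<alpha> p n * \<omega> powr (\<theta> / n) * (h powr (\<theta> / p) * X powr u))
     = ln (gn_G \<alpha> p n) + \<theta> / n * ln \<omega> + (ln (h powr (\<theta> / p)) + u * ln X)" if "0 < h" for h u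
    using Gpos X \<omega> that by (simp add: ln_mult ln_powr)
  have e1: "(1 - \<theta>) / q = e - \<theta> / p + \<theta> / n" using scale by (simp add: e_def right_diff_distrib)
  have e2: "\<theta> / p * (p * z) = \<theta> * z" for z using A by simp
  have "ln ((X * ((b - n / c) / b)) powr e)
    = ln (gn_G \<alpha> p n * \<omega> powr (\<theta> / n) * (((c / (\<alpha> - 1)) powr p * (X * (n / c / b))) powr (\<theta> / p) * X powr ((1 - \<theta>) / q)))"
    unfolding lnL lnR[OF Hpos] lnH lnG e1 distrib_left[of "\<theta> / p"] e2 lnX by (simp add: algebra_simps)
  then have "(X * ((b - n / c) / b)) powr e
    = gn_G \<alpha> p n * \<omega> powr (\<theta> / n) * (((c / (\<alpha> - 1)) powr p * (X * (n / c / b))) powr (\<theta> / p) * X powr ((1 - \<theta>) / q))"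
    using Gpos X \<omega> \<alpha> c n b bnc by (subst (asm) ln_inj_iff) auto
  then show "(X * ((b - n / c) / b)) powr (1 / (\<alpha> * p)) =
      gn_G \<alpha> p n * unit_ball_vol n powr (\<theta> / n) *
      (((c / (\<alpha> - 1)) powr p * (X * (n / c / b))) powr (\<theta> / p) * X powr ((1 - \<theta>) / q))"
    by (simp only: e_def \<omega>_def)
qed

text \<open>For \<alpha> < 1 the order of the exponents is reversed, \<open>\<alpha> * p\<close> <
  q, so \<open>X\<close> now belongs to the power \<open>\<alpha> * p\<close>, which stands on the
  right. The extremal has compact support, and positivity of \<open>b\<close> is immediate.\<close>

lemma gn_N_identity:
  fixes \<alpha> p n :: real
  assumes A: "1 < p" "p < n" "0 < \<alpha>" "\<alpha> < 1"
  defines "q \<equiv> \<alpha> * (p - 1) + 1" and "c \<equiv> conj_exp p" and "\<gamma> \<equiv> gn_gamma \<alpha> p n"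
  defines "b \<equiv> q / (1 - \<alpha>)"
  defines "X \<equiv> n / c * Beta b (n / c)"
  shows "0 < \<gamma>" "\<gamma> \<le> 1" "1 / q = \<gamma> * (1 / p - 1 / n) + (1 - \<gamma>) / (\<alpha> * p)"
    "0 < b" "0 < X" "0 < gn_N \<alpha> p n"
    "(X * (b / (b + n / c))) powr (1 / q) =
      gn_N \<alpha> p n * unit_ball_vol n powr (\<gamma> / n) *
      (((c / (1 - \<alpha>)) powr p * (X * (n / c / (b + n / c)))) powr (\<gamma> / p) * X powr ((1 - \<gamma>) / (\<alpha> * p)))"
proof -
  have c: "0 < c" using A by (simp add: c_def conj_exp_def)
  have q: "1 < q" using A by (simp add: q_def)
  have n: "0 < n" "0 < n - p" using A by auto
  show b: "0 < b" using q A by (simp add: b_def)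
  define b' where "b' = b + n / c"
  have b': "0 < b'" unfolding b'_def using b c n by (intro add_pos_pos) auto
  have qap: "q - \<alpha> * p = 1 - \<alpha>" by (simp add: q_def algebra_simps)
  have P: "0 < sobolev_exp p n" using A by (simp add: sobolev_exp_def)
  have pP: "p < sobolev_exp p n" using A by (simp add: sobolev_exp_def field_simps)
  have "p - q = (1 - \<alpha>) * (p - 1)" by (simp add: q_def algebra_simps)
  moreover have "0 < (1 - \<alpha>) * (p - 1)" using A by simp
  ultimately have qp: "q < p" by linarith
  have psq: "0 < sobolev_exp p n - \<alpha> * p" using pP qp qap A by linarith
  have \<gamma>: "\<gamma> = sobolev_exp p n * (1 - \<alpha>) / ((sobolev_exp p n - \<alpha> * p) * q)"
    by (simp add: \<gamma>_def gn_gamma_def q_def algebra_simps)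
  show \<gamma>0: "0 < \<gamma>" unfolding \<gamma> using P psq q A by simp
  have "\<alpha> * p * q \<le> \<alpha> * p * sobolev_exp p n" using pP qp A by (intro mult_left_mono) auto
  moreover have "sobolev_exp p n * (1 - \<alpha>) = sobolev_exp p n * q - sobolev_exp p n * (\<alpha> * p)"
    unfolding qap[symmetric] by (simp add: algebra_simps)
  ultimately have "sobolev_exp p n * (1 - \<alpha>) \<le> (sobolev_exp p n - \<alpha> * p) * q" by (simp add: algebra_simps)
  then show "\<gamma> \<le> 1" unfolding \<gamma> using P psq q by (simp add: field_simps)
  have inv: "1 / p - 1 / n = 1 / sobolev_exp p n" using A by (simp add: sobolev_exp_def field_simps)
  have "\<gamma> * (1 / (\<alpha> * p) - 1 / sobolev_exp p n) = 1 / (\<alpha> * p) - 1 / q"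
  proof -
    have "1 / (\<alpha> * p) - 1 / sobolev_exp p n = (sobolev_exp p n - \<alpha> * p) / (\<alpha> * p * sobolev_exp p n)"
      using P A by (simp add: field_simps)
    then have "\<gamma> * (1 / (\<alpha> * p) - 1 / sobolev_exp p n) = (1 - \<alpha>) / (\<alpha> * p * q)"
      unfolding \<gamma> using P psq by simp
    also have "\<dots> = 1 / (\<alpha> * p) - 1 / q" unfolding qap[symmetric] using q A by (simp add: field_simps)
    finally show ?thesis .
  qed
  then show scale: "1 / q = \<gamma> * (1 / p - 1 / n) + (1 - \<gamma>) / (\<alpha> * p)"
    unfolding inv by (simp add: algebra_simps diff_divide_distrib)
  define B where "B = Beta b (n / c)"
  have B: "0 < B" unfolding B_def using b c n by (intro Beta_real_pos) auto
  have XB: "X = n / c * B" by (simp add: X_def B_def)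
  show X: "0 < X" using B c n by (simp add: XB)
  define \<omega> where "\<omega> = unit_ball_vol n"
  have \<omega>: "0 < \<omega>" using n by (simp add: \<omega>_def)
  have G: "gn_N \<alpha> p n = ((1 - \<alpha>) / c) powr \<gamma> * ((c / n) powr (\<gamma> / p + \<gamma> / n) * b' powr (\<gamma> / p - 1 / q) *
      b powr (1 / q)) / (\<omega> * B) powr (\<gamma> / n)"
    by (simp add: gn_N_def Let_def \<gamma>_def c_def b_def q_def \<omega>_def B_def b'_def)
  show Gpos: "0 < gn_N \<alpha> p n" unfolding G using A(4) c n b' b \<omega> B by simp
  define e where "e = 1 / q"
  have \<alpha>: "0 < 1 - \<alpha>" using A by simp
  have lnX: "ln X = ln n - ln c + ln B" using B c n by (simp add: XB ln_mult ln_div)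
  have lnL: "ln ((X * (b / b')) powr e) = e * (ln X + ln b - ln b')"
    using X b' b by (simp add: ln_powr ln_mult ln_div)
  have lnG: "ln (gn_N \<alpha> p n) = \<gamma> * (ln (1 - \<alpha>) - ln c) + (\<gamma> / p + \<gamma> / n) * (ln c - ln n) + (\<gamma> / p - e) * ln b'
      + e * ln b - \<gamma> / n * (ln \<omega> + ln B)"
    unfolding G e_def[symmetric] using \<alpha> c n b' b \<omega> B by (simp add: ln_powr ln_mult ln_div)
  have lnH: "ln (((c / (1 - \<alpha>)) powr p * (X * (n / c / b'))) powr (\<gamma> / p))
     = \<gamma> / p * (p * (ln c - ln (1 - \<alpha>)) + (ln X + (ln n - ln c - ln b')))"
    using X \<alpha> c n b' by (simp add: ln_powr ln_mult ln_div)
  have Hpos: "0 < (c / (1 - \<alpha>)) powr p * (X * (n / c / b'))" using X \<alpha> c n b' by simp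
  have lnR: "ln (gn_N \<alpha> p n * \<omega> powr (\<gamma> / n) * (h powr (\<gamma> / p) * X powr u))
     = ln (gn_N \<alpha> p n) + \<gamma> / n * ln \<omega> + (ln (h powr (\<gamma> / p)) + u * ln X)" if "0 < h" for h u
    using Gpos X \<omega> that by (simp add: ln_mult ln_powr)
  have e1: "(1 - \<gamma>) / (\<alpha> * p) = e - \<gamma> / p + \<gamma> / n" using scale by (simp add: e_def right_diff_distrib)
  have e2: "\<gamma> / p * (p * z) = \<gamma> * z" for z using A by simp
  have "ln ((X * (b / b')) powr e)
    = ln (gn_N \<alpha> p n * \<omega> powr (\<gamma> / n) * (((c / (1 - \<alpha>)) powr p * (X * (n / c / b'))) powr (\<gamma> / p) * X powr ((1 - \<gamma>) / (\<alpha> * p))))"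
    unfolding lnL lnR[OF Hpos] lnH lnG e1 distrib_left[of "\<gamma> / p"] e2 lnX by (simp add: algebra_simps)
  then have "(X * (b / b')) powr e
    = gn_N \<alpha> p n * \<omega> powr (\<gamma> / n) * (((c / (1 - \<alpha>)) powr p * (X * (n / c / b'))) powr (\<gamma> / p) * X powr ((1 - \<gamma>) / (\<alpha> * p)))"
    using Gpos X \<omega> \<alpha> c n b b' by (subst (asm) ln_inj_iff) auto
  then show "(X * (b / (b + n / c))) powr (1 / q) =
      gn_N \<alpha> p n * unit_ball_vol n powr (\<gamma> / n) *
      (((c / (1 - \<alpha>)) powr p * (X * (n / c / (b + n / c)))) powr (\<gamma> / p) * X powr ((1 - \<gamma>) / (\<alpha> * p)))"
    by (simp only: e_def \<omega>_def b'_def)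
qed

section \<open>The extremal functions\<close>

text \<open>Cancelling \<open>Y\<close> and raising to the power n/\<theta> isolates a.\<close>

lemma volume_ratio_from_constants:
  fixes a C G Y \<omega> \<theta> n :: real
  assumes pos: "0 < C" "0 < G" "0 < \<omega>" "0 < a" "0 < Y" "0 < \<theta>" "0 < n"
    and le: "G * \<omega> powr (\<theta> / n) * Y \<le> a powr (\<theta> / n) * (C * Y)"
  shows "(G / C) powr (n / \<theta>) * \<omega> \<le> a"
proof -
  have "G / C * \<omega> powr (\<theta> / n) \<le> a powr (\<theta> / n)" using le pos by (simp add: field_simps)
  then have "(G / C * \<omega> powr (\<theta> / n)) powr (n / \<theta>) \<le> (a powr (\<theta> / n)) powr (n / \<theta>)"
    using pos by (intro powr_mono2) auto
  also have "(G / C * \<omega> powr (\<theta> / n)) powr (n / \<theta>) = (G / C) powr (n / \<theta>) * (\<omega> powr (\<theta> / n)) powr (n / \<theta>)"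
    using pos by (subst powr_mult) auto
  finally show ?thesis using pos by (simp add: powr_powr)
qed

lemma isCont_max_powr: "0 < e \<Longrightarrow> isCont f r \<Longrightarrow> isCont (\<lambda>r. max 0 (f r) powr e) (r :: real)" for e :: real
  unfolding isCont_def by (intro tendsto_powr' tendsto_max tendsto_const) auto

lemma radial_Beta_half_line:
  fixes n :: nat and c y :: real
  assumes "0 < c" "0 < n" "0 < y"
  shows "integrable lborel (\<lambda>r. indicator {0<..} r * ((1 + r powr c) powr (- (n / c + y)) * r ^ (n - 1)))"
    and "n * (\<integral>r. indicator {0<..} r * ((1 + r powr c) powr (- (n / c + y)) * r ^ (n - 1)) \<partial>lborel) = n / c * Beta (n / c) y"
proof -
  have eq: "indicator {0<..} r * ((1 + r powr c) powr (- (n / c + y)) * r ^ (n - 1))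
      = indicator {0<..} r * ((1 + r powr c) powr (- (n / c + y)) * r powr (c * (n / c) - 1))" for r :: real
    using nat_power_eq_powr_shift[of r n c] assms by (cases "0 < r") auto
  show "integrable lborel (\<lambda>r. indicator {0<..} r * ((1 + r powr c) powr (- (n / c + y)) * r ^ (n - 1)))"
    unfolding eq using assms by (intro Beta_integral_half_line) auto
  show "n * (\<integral>r. indicator {0<..} r * ((1 + r powr c) powr (- (n / c + y)) * r ^ (n - 1)) \<partial>lborel) = n / c * Beta (n / c) y"
    unfolding eq using assms by (subst Beta_integral_half_line(2)) auto
qed

lemma eq_divide_if_mult_eq: "0 < b \<Longrightarrow> b * x = y \<Longrightarrow> x = y / b" for b :: real
  by (auto simp: field_simps)

lemma not_nonpos_Int_of_pos: "0 < x \<Longrightarrow> x \<notin> \<int>\<^sub>\<le>\<^sub>0" for x :: real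
  by (auto dest: nonpos_Ints_nonpos)

context proper_mms
begin

text \<open>
  The extremal \<open>f = (1 + r\<^bsup>p'\<^esup>)\<^bsup>-1/(\<alpha>-1)\<^esup>\<close> is not compactly supported, so it is
  replaced by \<open>max 0 (f - f T)\<close> and \<open>T\<close> is sent to infinity.
\<close>

lemma volume_ratio_bound_G:
  fixes n :: nat and p \<alpha> C a :: real
  assumes A: "1 < p" "p < n" "1 < \<alpha>" "\<alpha> \<le> n / (n - p)" and "0 < C"
    and ineq: "\<And>u. u \<in> Lip0 \<Longrightarrow> Lnorm m (\<alpha> * p) u \<le> C * Lnorm m p (local_lip u) powr gn_theta \<alpha> p n
                 * Lnorm m (\<alpha> * (p - 1) + 1) u powr (1 - gn_theta \<alpha> p n)"
    and lim: "((\<lambda>R. measure m (ball x R) / R ^ n) \<longlongrightarrow> a) at_top" and "0 < a"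
  shows "(gn_G \<alpha> p n / C) powr (n / gn_theta \<alpha> p n) * unit_ball_vol n \<le> a"
proof -
  define q where "q = \<alpha> * (p - 1) + 1"
  define c where "c = conj_exp p"
  define \<theta> where "\<theta> = gn_theta \<alpha> p n"
  define b where "b = q / (\<alpha> - 1)"
  define X where "X = n / c * Beta (b - n / c) (n / c)"
  note id = gn_G_identity[OF A, folded q_def c_def \<theta>_def, folded b_def, folded X_def]
  define H where "H = (c / (\<alpha> - 1)) powr p * (X * (n / c / b))"
  define k where "k = 1 / (\<alpha> - 1)"
  have n: "0 < n" using A by simp
  have c: "1 < c" using A by (simp add: c_def conj_exp_def field_simps)
  have cp: "(c - 1) * p = c" using A by (simp add: c_def conj_exp_def field_simps)
  have q: "1 < q" using A by (simp add: q_def)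
  have k: "0 < k" using A by (simp add: k_def)
  have b: "0 < b" using q A by (simp add: b_def)
  \<comment> \<open>With f = (1 + r^c)^(-k), these relations give the power of 1 + r^c in each
    integrand: -b in the q-th power of f, and -(b + 1) both in its power \<open>\<alpha> * p\<close>
    and in the p-th power of its derivative, the latter with an additional factor r^c by
    \<open>cp\<close>.\<close>
  have kq: "k * q = b" by (simp add: k_def b_def)
  have kap: "k * (\<alpha> * p) = b + 1" using A by (simp add: k_def b_def q_def field_simps)
  have k1p: "(k + 1) * p = b + 1" using A by (simp add: k_def b_def q_def field_simps)
  have H: "0 < H" using id(5) c b n A by (simp add: H_def)
  \<comment> \<open>The maximum extends the profile to negative arguments as a constant; it stays
    continuously differentiable because c > 1.\<close>
  define P where "P r = max 0 r powr c" for r :: real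
  define f where "f r = (1 + P r) powr (- k)" for r
  define f' where "f' r = - k * (1 + P r) powr (- k - 1) * (c * max 0 r powr (c - 1))" for r
  have P0: "0 \<le> P r" for r by (simp add: P_def)
  have der: "(f has_real_derivative f' r) (at r)" for r
  proof -
    have "((\<lambda>r. 1 + P r) has_real_derivative 0 + c * max 0 r powr (c - 1)) (at r)"
      unfolding P_def by (intro DERIV_add DERIV_const has_real_derivative_max_powr c)
    moreover have "((\<lambda>s. s powr (- k)) has_real_derivative - k * (1 + P r) powr (- k - 1)) (at (1 + P r))"
      using P0[of r] by (intro has_real_derivative_powr) auto
    ultimately show ?thesis unfolding f_def f'_def using DERIV_chain2 by fastforce
  qed
  define L where "L = k * c"
  have L: "0 < L" using k c by (simp add: L_def)
  have f'L: "\<bar>f' r\<bar> \<le> L" for r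
  proof -
    define v where "v = max 0 r"
    have "v powr (c - 1) \<le> 1 + P r"
    proof (cases "v \<le> 1")
      case True
      then have "v powr (c - 1) \<le> 1 powr (c - 1)" using c by (intro powr_mono2) (auto simp: v_def)
      then show ?thesis using P0[of r] by simp
    next
      case False
      then have "v powr (c - 1) \<le> v powr c" by (intro powr_mono) auto
      then show ?thesis by (simp add: P_def v_def)
    qed
    moreover have "(1 + P r) powr (- k - 1) \<le> (1 + P r) powr (- 1)" using P0[of r] k by (intro powr_mono) auto
    ultimately have "(1 + P r) powr (- k - 1) * v powr (c - 1) \<le> (1 + P r) powr (- 1) * (1 + P r)"
      by (intro mult_mono) auto
    also have "\<dots> = 1" using P0[of r] by (simp add: powr_minus)
    finally have "k * c * ((1 + P r) powr (- k - 1) * v powr (c - 1)) \<le> k * c * 1"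
      using k c by (intro mult_left_mono) auto
    then show ?thesis using k c by (simp add: f'_def L_def v_def abs_mult mult_ac)
  qed
  have anti: "f s \<le> f r" if "r \<le> s" for r s
  proof -
    have "P r \<le> P s" unfolding P_def using that c by (intro powr_mono2) auto
    then show ?thesis unfolding f_def using P0[of r] k by (intro powr_mono2') auto
  qed
  have f0: "0 < f r" and f1: "f r \<le> 1" for r
  proof -
    have "1 + P r \<noteq> 0" using P0[of r] by linarith
    then show "0 < f r" by (simp add: f_def)
    have "f r \<le> 1 powr (- k)" unfolding f_def using P0[of r] k by (intro powr_mono2') auto
    then show "f r \<le> 1" by simp
  qed
  have fcont: "isCont f r" for r using der[of r] by (rule DERIV_isCont)
  have f'cont: "isCont f' r" for r
  proof -
    have "isCont (\<lambda>r. max 0 r powr c) r" "isCont (\<lambda>r. max 0 r powr (c - 1)) r"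
      using c by (auto intro!: isCont_max_powr[where f = "\<lambda>r. r"])
    moreover have "1 + max 0 r powr c \<noteq> 0" using P0[of r] by (simp add: P_def add_nonneg_eq_0_iff)
    ultimately show ?thesis unfolding f'_def P_def isCont_def by (intro tendsto_intros) (use c in auto)
  qed
  have f_meas[measurable]: "f \<in> borel_measurable borel"
    using fcont by (intro borel_measurable_continuous_onI) (auto simp: continuous_on_eq_continuous_at)
  have f'_meas[measurable]: "f' \<in> borel_measurable borel"
    using f'cont by (intro borel_measurable_continuous_onI) (auto simp: continuous_on_eq_continuous_at)
  have fpow: "f r powr t = (1 + r powr c) powr (- (k * t))" if "0 < r" for r t
    using that by (simp add: f_def P_def powr_powr)
  have Iq: "integrable lborel (\<lambda>r. indicator {0<..} r * (f r powr q * r ^ (n - 1)))"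
    "n * (\<integral>r. indicator {0<..} r * (f r powr q * r ^ (n - 1)) \<partial>lborel) = X"
  proof -
    have "indicator {0<..} r * (f r powr q * r ^ (n - 1)) = indicator {0<..} r * ((1 + r powr c) powr (- (n / c + (b - n / c))) * r ^ (n - 1))" for r
      by (cases "0 < r") (auto simp: fpow kq)
    then show "integrable lborel (\<lambda>r. indicator {0<..} r * (f r powr q * r ^ (n - 1)))"
      "n * (\<integral>r. indicator {0<..} r * (f r powr q * r ^ (n - 1)) \<partial>lborel) = X"
      using radial_Beta_half_line[of c n "b - n / c"] c n id(4) by (simp_all only: X_def Beta_commute)
  qed
  have Is: "integrable lborel (\<lambda>r. indicator {0<..} r * (f r powr (\<alpha> * p) * r ^ (n - 1)))"
    "n * (\<integral>r. indicator {0<..} r * (f r powr (\<alpha> * p) * r ^ (n - 1)) \<partial>lborel) = X * ((b - n / c) / b)"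
  proof -
    have eq: "indicator {0<..} r * (f r powr (\<alpha> * p) * r ^ (n - 1)) = indicator {0<..} r * ((1 + r powr c) powr (- (n / c + (b - n / c + 1))) * r ^ (n - 1))" for r
    proof (cases "0 < r")
      case True
      have "n / c + (b - n / c + 1) = b + 1" by simp
      then show ?thesis using True by (simp only: fpow kap)
    qed simp
    have y: "0 < b - n / c + 1" using id(4) by simp
    have c0: "0 < c" using c by simp
    note R = radial_Beta_half_line[OF c0 n y]
    show "integrable lborel (\<lambda>r. indicator {0<..} r * (f r powr (\<alpha> * p) * r ^ (n - 1)))"
      using R(1) by (simp only: eq)
    \<comment> \<open>The recurrence of the Beta function expresses the shifted integral through
      \<open>X\<close>; this is the origin of the factor (b - n/c)/b.\<close>
    have "(n / c + (b - n / c)) * Beta (n / c) (b - n / c + 1) = (b - n / c) * Beta (n / c) (b - n / c)"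
      by (rule Beta_plus1_right[OF not_nonpos_Int_of_pos[OF id(4)]])
    then have "b * Beta (n / c) (b - n / c + 1) = (b - n / c) * Beta (n / c) (b - n / c)" by simp
    then have "Beta (n / c) (b - n / c + 1) = (b - n / c) * Beta (n / c) (b - n / c) / b"
      by (rule eq_divide_if_mult_eq[OF b])
    then show "n * (\<integral>r. indicator {0<..} r * (f r powr (\<alpha> * p) * r ^ (n - 1)) \<partial>lborel) = X * ((b - n / c) / b)"
      unfolding eq R(2) by (simp add: X_def Beta_commute[of "n / c"])
  qed
  have Ih: "integrable lborel (\<lambda>r. indicator {0<..} r * (\<bar>f' r\<bar> powr p * r ^ (n - 1)))"
    "n * (\<integral>r. indicator {0<..} r * (\<bar>f' r\<bar> powr p * r ^ (n - 1)) \<partial>lborel) = H"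
  proof -
    have eq: "indicator {0<..} r * (\<bar>f' r\<bar> powr p * r ^ (n - 1)) = (k * c) powr p *
        (indicator {0<..} r * ((1 + r powr c) powr (- ((n / c + 1) + (b - n / c))) * r powr (c * (n / c + 1) - 1)))" for r
    proof (cases "0 < r")
      case True
      have "\<bar>f' r\<bar> = k * c * ((1 + r powr c) powr (- (k + 1)) * r powr (c - 1))"
        using True k c by (simp add: f'_def P_def abs_mult mult_ac)
      moreover have "(- k - 1) * p = - ((k + 1) * p)" by (simp add: algebra_simps)
      ultimately have "\<bar>f' r\<bar> powr p = (k * c) powr p * ((1 + r powr c) powr (- ((k + 1) * p)) * r powr ((c - 1) * p))"
        using k c by (simp add: powr_mult powr_powr)
      also have "(k + 1) * p = (n / c + 1) + (b - n / c)" using k1p by simp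
      also have "(c - 1) * p = c" by (rule cp)
      finally have "\<bar>f' r\<bar> powr p * r ^ (n - 1) = (k * c) powr p * ((1 + r powr c) powr (- ((n / c + 1) + (b - n / c))) * (r powr c * r powr (c * (n / c) - 1)))"
        using True n c by (simp only: nat_power_eq_powr_shift[of r n c] mult_ac)
      also have "r powr c * r powr (c * (n / c) - 1) = r powr (c * (n / c + 1) - 1)"
        unfolding powr_add[symmetric] by (simp add: algebra_simps)
      finally show ?thesis using True by simp
    qed simp
    have c0: "0 < c" using c by simp
    have nc: "0 < n / c" using n c by simp
    then have nc1: "0 < n / c + 1" by simp
    note R = Beta_integral_half_line[OF c0 nc1 id(4)]
    show "integrable lborel (\<lambda>r. indicator {0<..} r * (\<bar>f' r\<bar> powr p * r ^ (n - 1)))"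
      unfolding eq by (intro integrable_mult_right impI R(1))
    have "(n / c + (b - n / c)) * Beta (n / c + 1) (b - n / c) = n / c * Beta (n / c) (b - n / c)"
      by (rule Beta_plus1_left[OF not_nonpos_Int_of_pos[OF nc]])
    then have "b * Beta (n / c + 1) (b - n / c) = n / c * Beta (n / c) (b - n / c)" by simp
    then have B: "Beta (n / c + 1) (b - n / c) = n / c * Beta (n / c) (b - n / c) / b"
      by (rule eq_divide_if_mult_eq[OF b])
    have "n * (\<integral>r. indicator {0<..} r * (\<bar>f' r\<bar> powr p * r ^ (n - 1)) \<partial>lborel) = n * ((k * c) powr p * (Beta (n / c + 1) (b - n / c) / c))"
      unfolding eq R(2)[symmetric] by simp
    also have "\<dots> = H"
      unfolding B H_def X_def k_def by (simp add: Beta_commute[of "n / c"] mult_ac)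
    finally show "n * (\<integral>r. indicator {0<..} r * (\<bar>f' r\<bar> powr p * r ^ (n - 1)) \<partial>lborel) = H" .
  qed
  define g where "g T r = max 0 (f r - f T)" for T r
  define h where "h T r = (if r \<le> T then \<bar>f' r\<bar> else 0)" for T r
  have g_meas[measurable]: "g T \<in> borel_measurable borel" for T unfolding g_def by measurable
  have h_meas[measurable]: "h T \<in> borel_measurable borel" for T unfolding h_def by measurable
  have gf: "0 \<le> g T r" "g T r \<le> f r" for T r using f0[of r] f0[of T] by (auto simp: g_def)
  have test: "(n * (\<integral>r. indicator {0<..} r * (g T r powr (\<alpha> * p) * r ^ (n - 1)) \<partial>lborel)) powr (1 / (\<alpha> * p))
    \<le> a powr (\<theta> / n) * (C * H powr (\<theta> / p) * X powr ((1 - \<theta>) / q))" if T: "0 < T" for T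
  \<comment> \<open>The support bound is T + 1 since \<open>h T\<close> still equals the absolute
    derivative of f at T itself. Its jump at T is the single exceptional point.\<close>
  proof (rule radial_test_inequality[OF ineq[folded \<theta>_def q_def] _ _ _ _ _ _ id(3) n lim \<open>0 < a\<close>,
        where T = "T + 1" and D = "{T}" and L = L and c = "1 + L" and h = "h T"])
    show "L-lipschitz_on {0..} (g T)"
    proof (rule lipschitz_onI)
      fix r s
      have "dist (f r) (f s) \<le> L * dist r s"
        using Lipschitz_of_derivative_bound[OF der f'L, of UNIV] by (auto dest: lipschitz_onD)
      moreover have "\<bar>g T r - g T s\<bar> \<le> \<bar>f r - f s\<bar>" by (auto simp: g_def max_def)
      ultimately show "dist (g T r) (g T s) \<le> L * dist r s" by (simp add: dist_real_def)
    qed (use L in simp)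
    show "slope_le (g T) r (h T r)" if "0 \<le> r" for r
    proof (cases "r \<le> T")
      case True
      have "slope_le f r \<bar>f' r\<bar>" using has_field_derivative_at_within[OF der] by (rule slope_le_deriv)
      then have "slope_le (g T) r \<bar>f' r\<bar>" by (rule slope_le_contraction) (auto simp: g_def max_def)
      then show ?thesis using True by (simp add: h_def)
    next
      case False
      have zero: "g T s = 0" if "T \<le> s" for s using anti[OF that] by (simp add: g_def)
      have "slope_le (g T) r 0"
      proof (rule slope_le_locally_constant[of "r - T"])
        fix s assume "\<bar>s - r\<bar> < r - T"
        then have "T \<le> s" by linarith
        then show "g T s = g T r" using zero False by simp
      qed (use False in simp)
      then show ?thesis using False by (simp add: h_def)
    qed
    show "isCont (h T) r" if "0 < r" "r \<notin> {T}" for r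
    proof (cases "r < T")
      case True
      have "\<forall>\<^sub>F s in nhds r. h T s = \<bar>f' s\<bar>"
        using eventually_nhds_in_open[of "{..<T}" r] True by (auto elim!: eventually_mono simp: h_def)
      then have "isCont (h T) r \<longleftrightarrow> isCont (\<lambda>s. \<bar>f' s\<bar>) r" by (rule isCont_cong)
      moreover have "isCont (\<lambda>s. \<bar>f' s\<bar>) r" using f'cont[of r] by (intro continuous_intros)
      ultimately show ?thesis by blast
    next
      case False
      have "\<forall>\<^sub>F s in nhds r. h T s = 0"
        using eventually_nhds_in_open[of "{T<..}" r] False that by (auto elim!: eventually_mono simp: h_def)
      then have "isCont (h T) r \<longleftrightarrow> isCont (\<lambda>s. 0 :: real) r" by (rule isCont_cong)
      then show ?thesis by simp
    qed
    show "isCont (g T) r" for r unfolding g_def using fcont[of r] by (intro continuous_intros)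
    show "g T r \<le> 1 + L" "h T r \<le> 1 + L" "0 \<le> h T r" "0 \<le> g T r" for r
      using gf[of T r] f1[of r] f'L[of r] L by (auto simp: h_def)
    show "g T r = 0" "h T r = 0" if "T + 1 \<le> r" for r
      using anti[of T r] that by (auto simp: g_def h_def)
    have "(\<integral>r. indicator {0<..} r * (h T r powr p * r ^ (n - 1)) \<partial>lborel) \<le> (\<integral>r. indicator {0<..} r * (\<bar>f' r\<bar> powr p * r ^ (n - 1)) \<partial>lborel)"
    proof (rule integral_mono')
      fix r :: real
      show "indicator {0<..} r * (h T r powr p * r ^ (n - 1)) \<le> indicator {0<..} r * (\<bar>f' r\<bar> powr p * r ^ (n - 1))"
        by (cases "0 < r") (auto simp: h_def)
      show "0 \<le> indicator {0<..} r * (\<bar>f' r\<bar> powr p * r ^ (n - 1))" by (cases "0 < r") auto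
    qed (rule Ih(1))
    then show "n * (\<integral>r. indicator {0<..} r * (h T r powr p * r ^ (n - 1)) \<partial>lborel) \<le> H"
      unfolding Ih(2)[symmetric] by (intro mult_left_mono) auto
    have "(\<integral>r. indicator {0<..} r * (g T r powr q * r ^ (n - 1)) \<partial>lborel) \<le> (\<integral>r. indicator {0<..} r * (f r powr q * r ^ (n - 1)) \<partial>lborel)"
    proof (rule integral_mono')
      fix r :: real
      have "g T r powr q \<le> f r powr q" using gf q by (intro powr_mono2) auto
      then show "indicator {0<..} r * (g T r powr q * r ^ (n - 1)) \<le> indicator {0<..} r * (f r powr q * r ^ (n - 1))"
        by (cases "0 < r") (auto intro: mult_right_mono)
      show "0 \<le> indicator {0<..} r * (f r powr q * r ^ (n - 1))" by (cases "0 < r") auto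
    qed (rule Iq(1))
    then show "n * (\<integral>r. indicator {0<..} r * (g T r powr q * r ^ (n - 1)) \<partial>lborel) \<le> X"
      unfolding Iq(2)[symmetric] by (intro mult_left_mono) auto
  qed (use A q id \<open>0 < C\<close> H T in auto)
  have flim: "(\<lambda>i. f (real (Suc i))) \<longlonglongrightarrow> 0"
  proof -
    have "(\<lambda>i. (1 + real (Suc i) powr c) powr (- k)) \<longlonglongrightarrow> 0"
    proof (rule tendsto_neg_powr)
      have "filterlim (\<lambda>i. real (Suc i)) at_top sequentially"
        using filterlim_compose[OF filterlim_real_sequentially filterlim_Suc] .
      moreover have "real (Suc i) \<le> 1 + real (Suc i) powr c" for i
        using powr_mono[of 1 c "real (Suc i)"] c by simp
      ultimately show "filterlim (\<lambda>i. 1 + real (Suc i) powr c) at_top sequentially"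
        by (rule filterlim_at_top_mono[OF _ always_eventually[OF allI]])
    qed (use k in simp)
    then show ?thesis by (simp add: f_def P_def)
  qed
  \<comment> \<open>The right-hand side of \<open>test\<close> already holds the untruncated values,
    so T tends to infinity on the left only, dominated by the integrable power of f.\<close>
  have "(\<lambda>i. \<integral>r. indicator {0<..} r * (g (real (Suc i)) r powr (\<alpha> * p) * r ^ (n - 1)) \<partial>lborel)
     \<longlonglongrightarrow> (\<integral>r. indicator {0<..} r * (f r powr (\<alpha> * p) * r ^ (n - 1)) \<partial>lborel)"
  proof (rule integral_dominated_convergence[OF _ _ Is(1)])
    show "AE r in lborel. (\<lambda>i. indicator {0<..} r * (g (real (Suc i)) r powr (\<alpha> * p) * r ^ (n - 1))) \<longlonglongrightarrow> indicator {0<..} r * (f r powr (\<alpha> * p) * r ^ (n - 1))"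
    proof (rule AE_I2)
      fix r :: real
      have "(\<lambda>i. g (real (Suc i)) r) \<longlonglongrightarrow> max 0 (f r - 0)"
        unfolding g_def by (intro tendsto_intros flim)
      then have "(\<lambda>i. g (real (Suc i)) r) \<longlonglongrightarrow> f r" using f0[of r] by simp
      then show "(\<lambda>i. indicator {0<..} r * (g (real (Suc i)) r powr (\<alpha> * p) * r ^ (n - 1))) \<longlonglongrightarrow> indicator {0<..} r * (f r powr (\<alpha> * p) * r ^ (n - 1))"
        using f0[of r] by (intro tendsto_intros) auto
    qed
    show "AE r in lborel. norm (indicator {0<..} r * (g (real (Suc i)) r powr (\<alpha> * p) * r ^ (n - 1))) \<le> indicator {0<..} r * (f r powr (\<alpha> * p) * r ^ (n - 1))" for i
    proof (rule AE_I2)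
      fix r :: real
      have "g (real (Suc i)) r powr (\<alpha> * p) \<le> f r powr (\<alpha> * p)" using gf A by (intro powr_mono2) auto
      then show "norm (indicator {0<..} r * (g (real (Suc i)) r powr (\<alpha> * p) * r ^ (n - 1))) \<le> indicator {0<..} r * (f r powr (\<alpha> * p) * r ^ (n - 1))"
        by (cases "0 < r") (auto simp: abs_mult intro: mult_right_mono)
    qed
  qed measurable
  then have "(\<lambda>i. n * (\<integral>r. indicator {0<..} r * (g (real (Suc i)) r powr (\<alpha> * p) * r ^ (n - 1)) \<partial>lborel))
     \<longlonglongrightarrow> X * ((b - n / c) / b)"
    unfolding Is(2)[symmetric] by (intro tendsto_intros)
  then have "(\<lambda>i. (n * (\<integral>r. indicator {0<..} r * (g (real (Suc i)) r powr (\<alpha> * p) * r ^ (n - 1)) \<partial>lborel)) powr (1 / (\<alpha> * p)))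
     \<longlonglongrightarrow> (X * ((b - n / c) / b)) powr (1 / (\<alpha> * p))"
    using id(4,5) b by (intro tendsto_powr tendsto_const) auto
  then have "(X * ((b - n / c) / b)) powr (1 / (\<alpha> * p)) \<le> a powr (\<theta> / n) * (C * H powr (\<theta> / p) * X powr ((1 - \<theta>) / q))"
    by (rule LIMSEQ_le_const2) (use test in auto)
  then have "gn_G \<alpha> p n * unit_ball_vol n powr (\<theta> / n) * (H powr (\<theta> / p) * X powr ((1 - \<theta>) / q))
      \<le> a powr (\<theta> / n) * (C * (H powr (\<theta> / p) * X powr ((1 - \<theta>) / q)))"
    unfolding id(7) H_def[symmetric] by (simp only: mult.assoc)
  then show ?thesis unfolding \<theta>_def[symmetric]
    using id(1,5,6) H \<open>0 < C\<close> \<open>0 < a\<close> n by (intro volume_ratio_from_constants) auto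
qed

end

section \<open>The compactly supported extremal for \<alpha> < 1\<close>

lemma radial_Beta_unit_interval:
  fixes n :: nat and c y :: real
  assumes "0 < c" "0 < n" "0 < y"
  shows "integrable lborel (\<lambda>r. indicator {0<..<1} r * ((1 - r powr c) powr (y - 1) * r ^ (n - 1)))"
    and "n * (\<integral>r. indicator {0<..<1} r * ((1 - r powr c) powr (y - 1) * r ^ (n - 1)) \<partial>lborel) = n / c * Beta (n / c) y"
proof -
  have eq: "indicator {0<..<1} r * ((1 - r powr c) powr (y - 1) * r ^ (n - 1))
      = indicator {0<..<1} r * ((1 - r powr c) powr (y - 1) * r powr (c * (n / c) - 1))" for r :: real
    using nat_power_eq_powr_shift[of r n c] assms by (cases "0 < r") auto
  show "integrable lborel (\<lambda>r. indicator {0<..<1} r * ((1 - r powr c) powr (y - 1) * r ^ (n - 1)))"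
    unfolding eq using assms by (intro Beta_integral_unit_interval) auto
  show "n * (\<integral>r. indicator {0<..<1} r * ((1 - r powr c) powr (y - 1) * r ^ (n - 1)) \<partial>lborel) = n / c * Beta (n / c) y"
    unfolding eq using assms by (subst Beta_integral_unit_interval(2)) auto
qed

context proper_mms
begin

text \<open>The Euclidean extremal is the positive part of 1 - r^c to the power k = 1/(1 -
  \<alpha>). It vanishes from r = 1 on, and k > 1 makes it continuously differentiable across r = 1,
  so it can be inserted directly.\<close>

lemma volume_ratio_bound_N:
  fixes n :: nat and p \<alpha> C a :: real
  assumes A: "1 < p" "p < n" "0 < \<alpha>" "\<alpha> < 1" and "0 < C"
    and ineq: "\<And>u. u \<in> Lip0 \<Longrightarrow> Lnorm m (\<alpha> * (p - 1) + 1) u \<le> C * Lnorm m p (local_lip u) powr gn_gamma \<alpha> p n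
                 * Lnorm m (\<alpha> * p) u powr (1 - gn_gamma \<alpha> p n)"
    and lim: "((\<lambda>R. measure m (ball x R) / R ^ n) \<longlongrightarrow> a) at_top" and "0 < a"
  shows "(gn_N \<alpha> p n / C) powr (n / gn_gamma \<alpha> p n) * unit_ball_vol n \<le> a"
proof -
  define q where "q = \<alpha> * (p - 1) + 1"
  define c where "c = conj_exp p"
  define \<gamma> where "\<gamma> = gn_gamma \<alpha> p n"
  define b where "b = q / (1 - \<alpha>)"
  define X where "X = n / c * Beta b (n / c)"
  note id = gn_N_identity[OF A, folded q_def c_def \<gamma>_def, folded b_def, folded X_def]
  define H where "H = (c / (1 - \<alpha>)) powr p * (X * (n / c / (b + n / c)))"
  define k where "k = 1 / (1 - \<alpha>)"
  have n: "0 < n" using A by simp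
  have c: "1 < c" using A by (simp add: c_def conj_exp_def field_simps)
  have c0: "0 < c" using c by simp
  have cp: "(c - 1) * p = c" using A by (simp add: c_def conj_exp_def field_simps)
  have q: "1 < q" using A by (simp add: q_def)
  have k: "1 < k" using A by (simp add: k_def)
  have b: "0 < b" by (rule id(4))
  have nc: "0 < n / c" using n c by simp
  have bnc: "0 < b + n / c" using b nc by simp
  \<comment> \<open>The powers of 1 - r^c are b in the q-th power of f, and b - 1 both in its power
    \<open>\<alpha> * p\<close> and in the p-th power of its derivative. In Beta integrals they
    correspond to the arguments b + 1 and b.\<close>
  have kq: "k * q = b" by (simp add: k_def b_def)
  have kap: "k * (\<alpha> * p) = b - 1" using A by (simp add: k_def b_def q_def field_simps)
  have k1p: "(k - 1) * p = b - 1" using A by (simp add: k_def b_def q_def field_simps)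
  have H: "0 < H" using id(5) c bnc n A by (simp add: H_def)
  define P where "P r = max 0 r powr c" for r :: real
  define f where "f r = max 0 (1 - P r) powr k" for r
  define f' where "f' r = k * max 0 (1 - P r) powr (k - 1) * (0 - c * max 0 r powr (c - 1))" for r
  have P0: "0 \<le> P r" for r by (simp add: P_def)
  have P1: "1 \<le> P r" if "1 \<le> r" for r using that c by (simp add: P_def ge_one_powr_ge_zero)
  have der: "(f has_real_derivative f' r) (at r)" for r
  proof -
    have "((\<lambda>r. 1 - P r) has_real_derivative 0 - c * max 0 r powr (c - 1)) (at r)"
      unfolding P_def by (intro DERIV_diff DERIV_const has_real_derivative_max_powr c)
    from DERIV_chain2[OF has_real_derivative_max_powr[OF k] this]
    show ?thesis unfolding f_def f'_def .
  qed
  define L where "L = k * c"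
  have L: "0 < L" using k c by (simp add: L_def)
  have f'0: "f' r = 0" if "1 \<le> r" for r using P1[OF that] k by (simp add: f'_def)
  have f0: "f r = 0" if "1 \<le> r" for r using P1[OF that] k by (simp add: f_def)
  have f'L: "\<bar>f' r\<bar> \<le> L" for r
  proof (cases "1 \<le> r")
    case False
    have "max 0 (1 - P r) powr (k - 1) \<le> 1 powr (k - 1)" using P0[of r] k by (intro powr_mono2) auto
    moreover have "max 0 r powr (c - 1) \<le> 1 powr (c - 1)" using False c by (intro powr_mono2) auto
    ultimately have "max 0 (1 - P r) powr (k - 1) * max 0 r powr (c - 1) \<le> 1 * 1"
      by (intro mult_mono) auto
    then have "k * c * (max 0 (1 - P r) powr (k - 1) * max 0 r powr (c - 1)) \<le> k * c * 1"
      using k c by (intro mult_left_mono) auto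
    then show ?thesis using k c by (simp add: f'_def L_def abs_mult mult_ac)
  qed (use f'0 L in simp)
  have fnn: "0 \<le> f r" for r by (simp add: f_def)
  have f1: "f r \<le> 1" for r
  proof -
    have "f r \<le> 1 powr k" unfolding f_def using P0[of r] k by (intro powr_mono2) auto
    then show ?thesis by simp
  qed
  have fcont: "isCont f r" for r using der[of r] by (rule DERIV_isCont)
  have f'cont: "isCont f' r" for r
  proof -
    have 1: "isCont (\<lambda>r. max 0 r powr c) r" "isCont (\<lambda>r. max 0 r powr (c - 1)) r"
      using c by (auto intro!: isCont_max_powr[where f = "\<lambda>r. r"])
    have "isCont (\<lambda>r. 1 - P r) r" unfolding P_def by (intro continuous_diff continuous_const 1)
    then have "isCont (\<lambda>r. max 0 (1 - P r) powr (k - 1)) r" using k by (intro isCont_max_powr) auto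
    then show ?thesis unfolding f'_def by (intro continuous_mult continuous_diff continuous_const 1)
  qed
  have f'_meas[measurable]: "f' \<in> borel_measurable borel"
    using f'cont by (intro borel_measurable_continuous_onI) (auto simp: continuous_on_eq_continuous_at)
  have P_lt: "r powr c < 1" if "0 < r" "r < 1" for r
  proof -
    have "r powr c < 1 powr c" using that c by (intro powr_less_mono2) auto
    then show ?thesis by simp
  qed
  have fint: "indicator {0<..} r * (f r powr t * r ^ (n - 1)) = indicator {0<..<1} r * ((1 - r powr c) powr (k * t) * r ^ (n - 1))" for r t
  proof -
    consider "r \<le> 0" | "0 < r" "r < 1" | "1 \<le> r" by linarith
    then show ?thesis
    proof cases
      case 2
      then show ?thesis using P_lt[of r] by (simp add: f_def P_def powr_powr)
    qed (auto simp: f0)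
  qed
  have Iap: "n * (\<integral>r. indicator {0<..} r * (f r powr (\<alpha> * p) * r ^ (n - 1)) \<partial>lborel) = X"
    unfolding fint kap radial_Beta_unit_interval(2)[OF c0 n b] by (simp add: X_def Beta_commute)
  have Iq: "n * (\<integral>r. indicator {0<..} r * (f r powr q * r ^ (n - 1)) \<partial>lborel) = X * (b / (b + n / c))"
  proof -
    have b1: "0 < b + 1" using b by simp
    have "n * (\<integral>r. indicator {0<..} r * (f r powr q * r ^ (n - 1)) \<partial>lborel) = n / c * Beta (n / c) (b + 1)"
      unfolding fint kq using radial_Beta_unit_interval(2)[OF c0 n b1] by simp
    moreover have "(b + n / c) * Beta (n / c) (b + 1) = b * Beta (n / c) b"
      unfolding add.commute[of b "n / c"] by (rule Beta_plus1_right[OF not_nonpos_Int_of_pos[OF b]])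
    then have "Beta (n / c) (b + 1) = b * Beta (n / c) b / (b + n / c)"
      by (rule eq_divide_if_mult_eq[OF bnc])
    ultimately show ?thesis by (simp add: X_def Beta_commute[of "n / c"] mult_ac)
  qed
  have Ih: "n * (\<integral>r. indicator {0<..} r * (\<bar>f' r\<bar> powr p * r ^ (n - 1)) \<partial>lborel) = H"
  proof -
    have eq: "indicator {0<..} r * (\<bar>f' r\<bar> powr p * r ^ (n - 1)) = (k * c) powr p *
        (indicator {0<..<1} r * ((1 - r powr c) powr (b - 1) * r powr (c * (n / c + 1) - 1)))" for r
    proof -
      consider "r \<le> 0" | "0 < r" "r < 1" | "1 \<le> r" by linarith
      then show ?thesis
      proof cases
        case 2
        have "\<bar>f' r\<bar> = k * c * ((1 - r powr c) powr (k - 1) * r powr (c - 1))"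
          using 2 P_lt[of r] k c by (simp add: f'_def P_def abs_mult mult_ac)
        then have "\<bar>f' r\<bar> powr p = (k * c) powr p * ((1 - r powr c) powr ((k - 1) * p) * r powr ((c - 1) * p))"
          using k c by (simp add: powr_mult powr_powr)
        also have "(k - 1) * p = b - 1" by (rule k1p)
        also have "(c - 1) * p = c" by (rule cp)
        finally have "\<bar>f' r\<bar> powr p * r ^ (n - 1) = (k * c) powr p * ((1 - r powr c) powr (b - 1) * (r powr c * r powr (c * (n / c) - 1)))"
          using 2 n c by (simp only: nat_power_eq_powr_shift[of r n c] mult_ac)
        also have "r powr c * r powr (c * (n / c) - 1) = r powr (c * (n / c + 1) - 1)"
          unfolding powr_add[symmetric] by (simp add: algebra_simps)
        finally show ?thesis using 2 by simp
      qed (auto simp: f'0)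
    qed
    have nc1: "0 < n / c + 1" using nc by simp
    have "(b + n / c) * Beta (n / c + 1) b = n / c * Beta (n / c) b"
      unfolding add.commute[of b "n / c"] by (rule Beta_plus1_left[OF not_nonpos_Int_of_pos[OF nc]])
    then have B: "Beta (n / c + 1) b = n / c * Beta (n / c) b / (b + n / c)"
      by (rule eq_divide_if_mult_eq[OF bnc])
    have "n * (\<integral>r. indicator {0<..} r * (\<bar>f' r\<bar> powr p * r ^ (n - 1)) \<partial>lborel) = n * ((k * c) powr p * (Beta (n / c + 1) b / c))"
      unfolding eq Beta_integral_unit_interval(2)[OF c0 nc1 b, symmetric] by simp
    also have "\<dots> = H"
      unfolding B H_def X_def k_def by (simp add: Beta_commute[of "n / c"] mult_ac)
    finally show ?thesis .
  qed
  have "(n * (\<integral>r. indicator {0<..} r * (f r powr q * r ^ (n - 1)) \<partial>lborel)) powr (1 / q)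
    \<le> a powr (\<gamma> / n) * (C * H powr (\<gamma> / p) * X powr ((1 - \<gamma>) / (\<alpha> * p)))"
  proof (rule radial_test_inequality[OF ineq[folded \<gamma>_def q_def] _ _ _ _ _ _ id(3) n lim \<open>0 < a\<close>,
        where T = 1 and D = "{}" and L = L and c = "1 + L" and h = "\<lambda>r. \<bar>f' r\<bar>"])
    show "L-lipschitz_on {0..} f" by (rule Lipschitz_of_derivative_bound[OF der f'L])
    show "slope_le f r \<bar>f' r\<bar>" for r
      using has_field_derivative_at_within[OF der] by (rule slope_le_deriv)
    show "isCont (\<lambda>r. \<bar>f' r\<bar>) r" for r using f'cont by (intro continuous_intros)
    show "f r \<le> 1 + L" "\<bar>f' r\<bar> \<le> 1 + L" for r using f1[of r] f'L[of r] L by auto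
  qed (use A q id \<open>0 < C\<close> H f0 f'0 fnn fcont Ih Iap in auto)
  then have "gn_N \<alpha> p n * unit_ball_vol n powr (\<gamma> / n) * (H powr (\<gamma> / p) * X powr ((1 - \<gamma>) / (\<alpha> * p)))
      \<le> a powr (\<gamma> / n) * (C * (H powr (\<gamma> / p) * X powr ((1 - \<gamma>) / (\<alpha> * p))))"
    unfolding Iq id(7) H_def[symmetric] by (simp only: mult.assoc)
  then show ?thesis unfolding \<gamma>_def[symmetric]
    using id(1,5,6) H \<open>0 < C\<close> \<open>0 < a\<close> n by (intro volume_ratio_from_constants) auto
qed

end

section \<open>Exclusion of compactness, and conclusion\<close>

context proper_mms
begin

lemma noncompact_of_inequality:
  assumes ineq: "\<And>u. u \<in> Lip0 \<Longrightarrow> Lnorm m s u \<le> C * Lnorm m p (local_lip u) powr \<theta> * Lnorm m s' u powr (1 - \<theta>)"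
    and "0 < p"
  shows "\<not> compact (UNIV :: 'a set)"
proof
  assume comp: "compact (UNIV :: 'a set)"
  then have bdd: "bounded (UNIV :: 'a set)" by (rule compact_imp_bounded)
  have "0-lipschitz_on UNIV (\<lambda>y :: 'a. 1 :: real)" by (rule lipschitz_onI) auto
  then have "(\<lambda>y :: 'a. 1 :: real) \<in> Lip0" using comp by (auto simp: Lip0_def)
  from ineq[OF this] have "Lnorm m s (\<lambda>y. 1) \<le> C * Lnorm m p (local_lip (\<lambda>y. 1)) powr \<theta> * Lnorm m s' (\<lambda>y. 1) powr (1 - \<theta>)" .
  also have "local_lip (\<lambda>y :: 'a. 1) = (\<lambda>y. 0)" by (rule ext) (rule local_lip_const)
  also have "Lnorm m p (\<lambda>y. 0) = 0" by (simp add: Lnorm_def)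
  \<comment> \<open>The gradient factor is \<open>0 powr \<theta>\<close>, which is 0 for every
    \<theta>.\<close>
  finally have "Lnorm m s (\<lambda>y. 1) \<le> 0" by simp
  moreover have "0 < Lnorm m s (\<lambda>y. 1)"
  proof -
    obtain x :: 'a where True by simp
    have "measure m (ball x 1) \<le> measure m UNIV" using bdd by (intro measure_mono_bounded) auto
    then have "0 < measure m UNIV" using measure_ball_pos[of 1 x] by simp
    then show ?thesis by (simp add: Lnorm_def)
  qed
  ultimately show False by simp
qed

text \<open>The skeleton common to both statements, with abstract exponents and \<theta>. The sharp
  constants enter only through \<open>bound\<close>, a lower bound for every positive asymptotic
  volume ratio.\<close>

lemma volume_growth_of_inequality:
  fixes n :: nat
  assumes CD: "CD m K (real n)" "0 \<le> K" "2 \<le> n"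
    and ineq: "\<And>u. u \<in> Lip0 \<Longrightarrow> Lnorm m s u \<le> C * Lnorm m p (local_lip u) powr \<theta> * Lnorm m s' u powr (1 - \<theta>)"
    and pos: "0 < s" "0 < p" "0 < s'" "0 < \<theta>" "\<theta> \<le> 1" "0 < C"
    and scale: "1 / s = \<theta> * (1 / p - 1 / n) + (1 - \<theta>) / s'"
    and bound: "\<And>x a. ((\<lambda>R. measure m (ball x R) / R ^ n) \<longlongrightarrow> a) at_top \<Longrightarrow> 0 < a \<Longrightarrow> v \<le> a"
  shows "K = 0 \<and> (\<forall>x. \<forall>\<rho>\<ge>0. emeasure m (ball x \<rho>) \<ge> ennreal (v * \<rho> ^ n))"
proof (intro conjI allI impI)
  have n: "1 < real n" "0 < n" using CD(3) by auto
  show "K = 0"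
    using bonnet_myers[OF CD(1) n(1)] noncompact_of_inequality[OF ineq pos(2)] CD(2) by linarith
  fix x :: 'a and \<rho> :: real assume "0 \<le> \<rho>"
  have bg: "measure m (ball x R) / R ^ n \<le> measure m (ball x r) / r ^ n" if "0 < r" "r \<le> R" for r R
    using bishop_gromov[OF CD(1) n(1) CD(2) that, of x] that by (simp add: powr_realpow)
  obtain w where w: "0 < w" "\<And>R. 0 < R \<Longrightarrow> w \<le> measure m (ball x R) / R ^ n"
    using volume_ratio_lower_bound[OF ineq pos scale n(2) bg] by blast
  obtain a where a: "0 < a" "((\<lambda>R. measure m (ball x R) / R ^ n) \<longlongrightarrow> a) at_top"
    "\<And>R. 0 < R \<Longrightarrow> a \<le> measure m (ball x R) / R ^ n"
    using asymptotic_volume_ratio[OF bg w] by blast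
  show "ennreal (v * \<rho> ^ n) \<le> emeasure m (ball x \<rho>)"
  proof (cases "\<rho> = 0")
    case False
    then have "0 < \<rho>" using \<open>0 \<le> \<rho>\<close> by simp
    have "v \<le> measure m (ball x \<rho>) / \<rho> ^ n" using bound[OF a(2,1)] a(3)[OF \<open>0 < \<rho>\<close>] by linarith
    then have "v * \<rho> ^ n \<le> measure m (ball x \<rho>)" using \<open>0 < \<rho>\<close> by (simp add: field_simps)
    then show ?thesis by (simp add: emeasure_eq_measure_bounded ennreal_leI)
  qed (use n in \<open>simp add: zero_power\<close>)
qed

end

theorem theorem1p1:
  fixes m :: "'a::polish_space measure" and n :: nat and K p :: real and x0 :: 'a
  assumes "n \<ge> 2" and "K \<ge> 0"
    and "metric_measure_space m"
    and proper: "\<And>S :: 'a set. closed S \<Longrightarrow> bounded S \<Longrightarrow> compact S"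
    and "CD m K (real n)"
    and "1 < p" and "p < real n"
    and "Liminf (at_right 0)
           (\<lambda>\<rho>. emeasure m (ball x0 \<rho>) / ennreal (unit_ball_vol (real n) * \<rho> ^ n)) = 1"
  shows "(\<forall>\<alpha> C. 1 < \<alpha> \<and> \<alpha> \<le> real n / (real n - p) \<and> C \<ge> gn_G \<alpha> p (real n) \<and>
            (\<forall>u\<in>Lip0. Lnorm m (\<alpha> * p) u \<le>
               C * Lnorm m p (local_lip u) powr gn_theta \<alpha> p (real n)
                 * Lnorm m (\<alpha> * (p - 1) + 1) u powr (1 - gn_theta \<alpha> p (real n)))
          \<longrightarrow> K = 0 \<and>
            (\<forall>x. \<forall>\<rho>\<ge>0. emeasure m (ball x \<rho>) \<ge>
               ennreal ((gn_G \<alpha> p (real n) / C) powr (real n / gn_theta \<alpha> p (real n))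
                        * unit_ball_vol (real n) * \<rho> ^ n)))
       \<and> (\<forall>\<alpha> C. 0 < \<alpha> \<and> \<alpha> < 1 \<and> C \<ge> gn_N \<alpha> p (real n) \<and>
            (\<forall>u\<in>Lip0. Lnorm m (\<alpha> * (p - 1) + 1) u \<le>
               C * Lnorm m p (local_lip u) powr gn_gamma \<alpha> p (real n)
                 * Lnorm m (\<alpha> * p) u powr (1 - gn_gamma \<alpha> p (real n)))
          \<longrightarrow> K = 0 \<and>
            (\<forall>x. \<forall>\<rho>\<ge>0. emeasure m (ball x \<rho>) \<ge>
               ennreal ((gn_N \<alpha> p (real n) / C) powr (real n / gn_gamma \<alpha> p (real n))
                        * unit_ball_vol (real n) * \<rho> ^ n)))"
proof -
  interpret proper_mms m using assms(3) proper by unfold_locales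
  have q: "0 < \<alpha> * (p - 1) + 1" "0 < \<alpha> * p" if "0 < \<alpha>" for \<alpha>
    using that assms(6) by (auto intro: add_pos_pos)
  have p: "0 < p" using assms(6) by simp
  show ?thesis
  proof (intro conjI; intro allI impI; elim conjE)
    fix \<alpha> C
    assume \<alpha>: "1 < \<alpha>" "\<alpha> \<le> real n / (real n - p)" and C: "gn_G \<alpha> p (real n) \<le> C"
      and "\<forall>u\<in>Lip0. Lnorm m (\<alpha> * p) u \<le> C * Lnorm m p (local_lip u) powr gn_theta \<alpha> p (real n)
                 * Lnorm m (\<alpha> * (p - 1) + 1) u powr (1 - gn_theta \<alpha> p (real n))"
    then have ineq: "\<And>u. u \<in> Lip0 \<Longrightarrow> Lnorm m (\<alpha> * p) u \<le> C * Lnorm m p (local_lip u) powr gn_theta \<alpha> p (real n)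
                 * Lnorm m (\<alpha> * (p - 1) + 1) u powr (1 - gn_theta \<alpha> p (real n))" by blast
    note id = gn_G_identity[OF assms(6,7) \<alpha>]
    have C0: "0 < C" using id(6) C by linarith
    have "0 < \<alpha>" using \<alpha> by simp
    \<comment> \<open>For \<alpha> > 1 the exponent on the left is \<open>\<alpha> * p\<close> and
      the one on the right \<open>\<alpha> * (p - 1) + 1\<close>; for \<alpha> < 1 they exchange
      roles, and so do the two halves of \<open>q\<close>.\<close>
    show "K = 0 \<and> (\<forall>x. \<forall>\<rho>\<ge>0. ennreal ((gn_G \<alpha> p (real n) / C) powr (real n / gn_theta \<alpha> p (real n))
                        * unit_ball_vol (real n) * \<rho> ^ n) \<le> emeasure m (ball x \<rho>))"
      by (rule volume_growth_of_inequality[OF assms(5,2,1) ineq q(2)[OF \<open>0 < \<alpha>\<close>] p q(1)[OF \<open>0 < \<alpha>\<close>] id(1,2) C0 id(3)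
            volume_ratio_bound_G[OF assms(6,7) \<alpha> C0 ineq]])
  next
    fix \<alpha> C
    assume \<alpha>: "0 < \<alpha>" "\<alpha> < 1" and C: "gn_N \<alpha> p (real n) \<le> C"
      and "\<forall>u\<in>Lip0. Lnorm m (\<alpha> * (p - 1) + 1) u \<le> C * Lnorm m p (local_lip u) powr gn_gamma \<alpha> p (real n)
                 * Lnorm m (\<alpha> * p) u powr (1 - gn_gamma \<alpha> p (real n))"
    then have ineq: "\<And>u. u \<in> Lip0 \<Longrightarrow> Lnorm m (\<alpha> * (p - 1) + 1) u \<le> C * Lnorm m p (local_lip u) powr gn_gamma \<alpha> p (real n)
                 * Lnorm m (\<alpha> * p) u powr (1 - gn_gamma \<alpha> p (real n))" by blast
    note id = gn_N_identity[OF assms(6,7) \<alpha>]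
    have C0: "0 < C" using id(6) C by linarith
    show "K = 0 \<and> (\<forall>x. \<forall>\<rho>\<ge>0. ennreal ((gn_N \<alpha> p (real n) / C) powr (real n / gn_gamma \<alpha> p (real n))
                        * unit_ball_vol (real n) * \<rho> ^ n) \<le> emeasure m (ball x \<rho>))"
      by (rule volume_growth_of_inequality[OF assms(5,2,1) ineq q(1)[OF \<alpha>(1)] p q(2)[OF \<alpha>(1)] id(1,2) C0 id(3)
            volume_ratio_bound_N[OF assms(6,7) \<alpha> C0 ineq]])
  qed
qed

end
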